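(* Let $d\ge 1$, $\alpha\in(0,1)$, $\beta>0$. Let $\gamma\in(0,1)$ be a sufficiently small universal positive constant, and let $r(x)$, $\Theta(x)=(b(x),D_{\mathrm{o}}(x),D_{\mathrm{f}}(x))$ and $\widehat\Theta(x)=(\widehat b(x),\widehat D_{\mathrm{o}}(x),\widehat D_{\mathrm{f}}(x))$ be $\gamma$-Hölder continuous and periodic functions defined on $\mathbb{R}^d$, with periodicity defined on the unit cell $Q=(0,2\pi]^d$. Here $r$ is real-valued, $b,\widehat b$ take values in $\mathbb{R}^d$, $D_{\mathrm{o}},\widehat D_{\mathrm{o}}$ take values in the real $d\times d$ matrices, and $D_{\mathrm{f}},\widehat D_{\mathrm{f}}$ are real-valued; $D_{\mathrm{o}}$ is symmetric and uniformly positive definite, and $D_{\mathrm{f}}(x)\ge\lambda_{\mathrm{f}}>0$ for all $x$, for some constant $\lambda_{\mathrm{f}}$. If $\|\Theta-\widehat\Theta\|_{C^{0,\gamma}(\mathbb{R}^d)}\le\epsilon$, then $$\|V-\widehat V\|_{C^{2,\gamma}(\mathbb{R}^d)}<C\,\epsilon,$$ where $C>0$ is independent of $\epsilon$, and $V,\widehat V\in C^{2,\gamma}(\mathbb{R}^d)$ denote the solutions of $$\beta V(x)=r(x)+b(x)\cdot\nabla V(x)+D_{\mathrm{o}}(x):\nabla^2V(x)-D_{\mathrm{f}}(x)(-\Delta)^{\alpha}V(x)$$ and $$\beta \widehat V(x)=r(x)+\widehat b(x)\cdot\nabla \widehat V(x)+\widehat D_{\mathrm{o}}(x):\nabla^2\widehat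 V(x)-\widehat D_{\mathrm{f}}(x)(-\Delta)^{\alpha}\widehat V(x)$$ on $\mathbb{R}^d$, respectively.
   Context: In the source, $V$ is the value function of a policy evaluation problem with discount coefficient $\beta$ and reward function $r$, and $\Theta$ collects the drift, ordinary diffusion and fractional diffusion coefficients of the underlying dynamics; $\widehat\Theta$ is an estimate of $\Theta$ and $\widehat V$ is the resulting approximate value function. For a matrix $A$ and the Hessian $\nabla^2V$, $A:\nabla^2V=\sum_{i,j}A_{ij}\partial_i\partial_jV$. The fractional Laplacian is $(-\Delta)^{\alpha}f(x)=C_{d,\alpha}\,\mathrm{P.V.}\int_{\mathbb{R}^d}\frac{f(x)-f(y)}{|x-y|^{d+2\alpha}}\,dy$, where $C_{d,\alpha}>0$ is the standard normalizing constant (so that the Fourier symbol is $|\xi|^{2\alpha}$). $C^{k,\gamma}(\mathbb{R}^d)$ is the usual Hölder space of functions with bounded continuous derivatives up to order $k$ and globally $\gamma$-Hölder derivatives of order $k$, with its usual norm; for vector- or matrix-valued functions, and for triples such as $\Theta$, the norm is taken componentwise. Periodic with unit cell $Q=(0,2\pi]^d$ means $2\pi$-periodic in each coordinate.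
   Formalization: The bound is proved for 0 < ε ≤ ε0, where ε0 > 0, like C, depends only on γ, α, β, r and Θ; without a threshold it fails (r = 0, b̂ = 0, D̂_o = −βI, D̂_f = 0 has solutions t cos x_1 for every t), and at ε = 0 the strict inequality would read 0 < 0. *)

theory Defs
  imports "HOL-Analysis.Analysis"
begin

definition partial_deriv :: "'n::finite \<Rightarrow> (real^'n \<Rightarrow> real) \<Rightarrow> real^'n \<Rightarrow> real" where
  "partial_deriv i f x = frechet_derivative f (at x) (axis i 1)"

text \<open>A list of coordinates of length \<open>m\<close> stands for a multi-index of order \<open>m\<close>.\<close>

primrec partial_derivs :: "'n::finite list \<Rightarrow> (real^'n \<Rightarrow> real) \<Rightarrow> real^'n \<Rightarrow> real" where
  "partial_derivs [] f = f"
| "partial_derivs (i # is) f = partial_deriv i (partial_derivs is f)"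

definition gradient :: "(real^'n::finite \<Rightarrow> real) \<Rightarrow> real^'n \<Rightarrow> real^'n" where
  "gradient f x = (\<chi> i. partial_derivs [i] f x)"

definition hessian :: "(real^'n::finite \<Rightarrow> real) \<Rightarrow> real^'n \<Rightarrow> real^'n^'n" where
  "hessian f x = (\<chi> i j. partial_derivs [i, j] f x)"

definition frobenius_prod :: "real^'n::finite^'n \<Rightarrow> real^'n^'n \<Rightarrow> real" where
  "frobenius_prod A B = (\<Sum>i\<in>UNIV. \<Sum>j\<in>UNIV. A $ i $ j * B $ i $ j)"

definition holder_continuous :: "real \<Rightarrow> (real^'n::finite \<Rightarrow> real) \<Rightarrow> bool" where
  "holder_continuous \<gamma> f \<longleftrightarrow> (\<exists>K. \<forall>x y. \<bar>f x - f y\<bar> \<le> K * dist x y powr \<gamma>)"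

definition holder_seminorm :: "real \<Rightarrow> (real^'n::finite \<Rightarrow> real) \<Rightarrow> real" where
  "holder_seminorm \<gamma> f = Sup {\<bar>f x - f y\<bar> / dist x y powr \<gamma> |x y. x \<noteq> y}"

definition scalar_holder_space :: "nat \<Rightarrow> real \<Rightarrow> (real^'n::finite \<Rightarrow> real) set" where
  "scalar_holder_space k \<gamma> = {f.
     (\<forall>is. length is < k \<longrightarrow> (\<forall>x. partial_derivs is f differentiable at x)) \<and>
     (\<forall>is. length is \<le> k \<longrightarrow>
        continuous_on UNIV (partial_derivs is f) \<and> bounded (range (partial_derivs is f))) \<and>
     (\<forall>is. length is = k \<longrightarrow> holder_continuous \<gamma> (partial_derivs is f))}"

text \<open>The norm takes the maximum over the derivatives of a fixed order, so using lists for
  multi-indices does not change its value. It is meaningful on \<open>scalar_holder_space k \<gamma>\<close> only,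
  since \<open>Sup\<close> on the reals is unspecified for unbounded sets.\<close>

definition scalar_holder_norm :: "nat \<Rightarrow> real \<Rightarrow> (real^'n::finite \<Rightarrow> real) \<Rightarrow> real" where
  "scalar_holder_norm k \<gamma> f =
     (\<Sum>m\<le>k. MAX is\<in>{is. length is = m}. SUP x. \<bar>partial_derivs is f x\<bar>) +
     (MAX is\<in>{is. length is = k}. holder_seminorm \<gamma> (partial_derivs is f))"

text \<open>Functions with values in a Euclidean space are treated componentwise. For vectors, matrices
  and tuples of these, the inner products with \<open>Basis\<close> are exactly the scalar entries.\<close>

definition holder_space ::
    "nat \<Rightarrow> real \<Rightarrow> (real^'n::finite \<Rightarrow> 'b::euclidean_space) set" where
  "holder_space k \<gamma> = {f. \<forall>e\<in>Basis. (\<lambda>x. f x \<bullet> e) \<in> scalar_holder_space k \<gamma>}"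

definition holder_norm ::
    "nat \<Rightarrow> real \<Rightarrow> (real^'n::finite \<Rightarrow> 'b::euclidean_space) \<Rightarrow> real" where
  "holder_norm k \<gamma> f = (MAX e\<in>Basis. scalar_holder_norm k \<gamma> (\<lambda>x. f x \<bullet> e))"

definition cell_periodic :: "(real^'n::finite \<Rightarrow> 'b) \<Rightarrow> bool" where
  "cell_periodic f \<longleftrightarrow> (\<forall>x i. f (x + (2 * pi) *\<^sub>R axis i 1) = f x)"

definition uniformly_positive_definite :: "(real^'n::finite \<Rightarrow> real^'n^'n) \<Rightarrow> bool" where
  "uniformly_positive_definite A \<longleftrightarrow>
     (\<exists>c>0. \<forall>x \<xi>. c * (norm \<xi>)\<^sup>2 \<le> \<xi> \<bullet> (A x *v \<xi>))"

text \<open>The constant \<open>4\<^sup>\<alpha> \<Gamma>(d/2 + \<alpha>) / (\<pi>\<^bsup>d/2\<^esup> |\<Gamma>(-\<alpha>)|)\<close>, for which the operator below has Fourier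
  symbol \<open>|\<xi>|\<^bsup>2\<alpha>\<^esup>\<close>.\<close>

definition frac_laplacian_const :: "nat \<Rightarrow> real \<Rightarrow> real" where
  "frac_laplacian_const d \<alpha> =
     4 powr \<alpha> * Gamma (real d / 2 + \<alpha>) / (pi powr (real d / 2) * \<bar>Gamma (- \<alpha>)\<bar>)"

text \<open>The limit over shrinking excised balls is the principal value.\<close>

definition frac_laplacian :: "real \<Rightarrow> (real^'n::finite \<Rightarrow> real) \<Rightarrow> real^'n \<Rightarrow> real" where
  "frac_laplacian \<alpha> f x = frac_laplacian_const CARD('n) \<alpha> *
     Lim (at_right 0) (\<lambda>\<delta>. LINT y:{y. \<delta> < norm (x - y)}|lborel.
       (f x - f y) / norm (x - y) powr (real CARD('n) + 2 * \<alpha>))"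

definition policy_evaluation_solution ::
    "real \<Rightarrow> real \<Rightarrow> (real^'n::finite \<Rightarrow> real) \<Rightarrow>
     (real^'n \<Rightarrow> real^'n) \<Rightarrow> (real^'n \<Rightarrow> real^'n^'n) \<Rightarrow> (real^'n \<Rightarrow> real) \<Rightarrow>
     (real^'n \<Rightarrow> real) \<Rightarrow> bool" where
  "policy_evaluation_solution \<alpha> \<beta> r b D\<^sub>o D\<^sub>f V \<longleftrightarrow>
     (\<forall>x. \<beta> * V x = r x + b x \<bullet> gradient V x + frobenius_prod (D\<^sub>o x) (hessian V x)
            - D\<^sub>f x * frac_laplacian \<alpha> V x)"

end

theory Submission
  imports Defs
begin

text \<open>The theorem follows from an a priori estimate for a linear elliptic equation and an absorption
argument.

Put \<open>W = V - V'\<close>. Subtracting the two equations shows that \<open>W\<close> solves the equation with the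
coefficients \<open>(b, D\<^sub>o, D\<^sub>f)\<close> and the source
\<open>g = (b - b') \<bullet> \<nabla>V' + (D\<^sub>o - D\<^sub>o') : \<nabla>\<^sup>2V' - (D\<^sub>f - D\<^sub>f') (-\<Delta>)\<^sup>\<alpha>V'\<close>, whose Hoelder norm is at most
\<open>C \<epsilon> \<parallel>V'\<parallel> \<le> C \<epsilon> (\<parallel>V\<parallel> + \<parallel>W\<parallel>)\<close>. The a priori estimate \<open>\<parallel>W\<parallel> \<le> C \<parallel>g\<parallel>\<close> (lemma \<open>a_priori_estimate\<close>),
which also bounds \<open>\<parallel>V\<parallel>\<close> by \<open>r\<close>, then gives the theorem once \<open>\<epsilon>\<close> is so small that the term
\<open>C \<epsilon> \<parallel>W\<parallel>\<close> can be absorbed (lemma \<open>stability\<close>).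

The a priori estimate has two halves. The supremum of a solution is bounded by the maximum principle
(\<open>maximum_principle\<close>): at a maximum the Hessian is negative semidefinite and the fractional Laplacian
is nonnegative. As the domain is the whole space, a maximum is first created by adding a small multiple of a bump.
The Hoelder seminorm of the Hessian is bounded by a Schauder estimate (\<open>schauder_estimate\<close>). In it
the gradient term and the nonlocal term are of lower order: by interpolation their Hoelder norms
are at most \<open>\<eta> [\<nabla>\<^sup>2u] + C\<^sub>\<eta> sup \<bar>u\<bar>\<close> for every \<open>\<eta> > 0\<close> (\<open>lower_order_interpolation\<close>). For
the fractional Laplacian this holds for all \<open>\<alpha> < 1\<close> because the second difference of \<open>u\<close> is
\<open>O(\<bar>z\<bar>\<^sup>2)\<close> near the singularity, while the far part of the integral sees only \<open>u\<close> itself.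

What remains is the second order part with coefficients frozen at a point. Instead of potential
theory this uses a quantitative Liouville theorem (\<open>hessian_oscillation\<close>). Let \<open>A : \<nabla>\<^sup>2p\<close> be small and \<open>p\<close>
bounded on a large ball. Reflecting \<open>p\<close> in a hyperplane adapted to \<open>A\<close> and comparing with a quadratic
barrier on a half ball shows that \<open>p\<close> is nearly constant (\<open>halfspace_estimate\<close>). This is applied to
\<open>p = w(\<cdot> + h) - w\<close>, where \<open>w\<close> is a second difference quotient of \<open>u\<close>: if \<open>p\<close> is nearly the constant
\<open>p(x)\<close>, then \<open>w(x + nh) - w(x)\<close> is nearly \<open>n p(x)\<close>, but Hoelder continuity of the Hessian only
allows growth of order \<open>n\<^bsup>\<gamma>\<^esup>\<close>. Hence \<open>p(x)\<close>, and with it the oscillation of the Hessian, is a small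
fraction of its Hoelder constant plus a multiple of the oscillation of \<open>A : \<nabla>\<^sup>2u\<close>. A bound by a
fraction of itself is then iterated (\<open>halving_iteration\<close>).\<close>

section \<open>Functions with a Hessian\<close>

text \<open>The row product \<open>h v* H\<close> fits the convention that the entry \<open>(i, j)\<close> of a Hessian is the \<open>i\<close>-th
partial derivative of the \<open>j\<close>-th one. Keeping \<open>u\<close>, \<open>G\<close> and \<open>H\<close> together lets differences, dilations and
reflections of \<open>u\<close> be formed without differentiating again.\<close>

definition has_hessian ::
    "(real^'n::finite \<Rightarrow> real) \<Rightarrow> (real^'n \<Rightarrow> real^'n) \<Rightarrow> (real^'n \<Rightarrow> real^'n^'n) \<Rightarrow> bool" where
  "has_hessian u G H \<longleftrightarrow>
     (\<forall>x. (u has_derivative (\<lambda>h. G x \<bullet> h)) (at x)) \<and>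
     (\<forall>x. (G has_derivative (\<lambda>h. h v* H x)) (at x))"

lemma bilinear_form_expand: "(v v* M) \<bullet> w = (\<Sum>i\<in>UNIV. \<Sum>j\<in>UNIV. v $ i * w $ j * M $ i $ j)"
  for v w :: "real^'n::finite"
proof -
  have "(v v* M) \<bullet> w = (\<Sum>j\<in>UNIV. \<Sum>i\<in>UNIV. v $ i * w $ j * M $ i $ j)"
    unfolding inner_vec_def vector_matrix_mult_def
    by (simp add: sum_distrib_left sum_distrib_right mult_ac)
  also have "\<dots> = (\<Sum>i\<in>UNIV. \<Sum>j\<in>UNIV. v $ i * w $ j * M $ i $ j)" by (rule sum.swap)
  finally show ?thesis .
qed

lemma vector_matrix_mult_diff_right: "h v* (M - N) = h v* M - h v* (N :: real^'n::finite^'m::finite)"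
  by (simp add: vector_matrix_mult_def vec_eq_iff algebra_simps sum_subtractf)

lemma vector_matrix_mult_scaleR_right: "h v* (c *\<^sub>R M) = c *\<^sub>R (h v* (M :: real^'n::finite^'m::finite))"
  by (simp add: vector_matrix_mult_def vec_eq_iff sum_distrib_left mult_ac)

lemma vector_matrix_mult_scaleR_left: "(c *\<^sub>R h) v* M = c *\<^sub>R (h v* (M :: real^'n::finite^'m::finite))"
  by (simp add: vector_matrix_mult_def vec_eq_iff sum_distrib_left mult_ac)

lemma has_hessian_diff:
  assumes "has_hessian u G H" "has_hessian u' G' H'"
  shows "has_hessian (\<lambda>x. u x - u' x) (\<lambda>x. G x - G' x) (\<lambda>x. H x - H' x)"
  using assms unfolding has_hessian_def inner_diff_left vector_matrix_mult_diff_right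
  by (auto intro!: has_derivative_diff)

lemma has_hessian_cmult:
  assumes "has_hessian u G H"
  shows "has_hessian (\<lambda>x. c * u x) (\<lambda>x. c *\<^sub>R G x) (\<lambda>x. c *\<^sub>R H x)"
  using assms unfolding has_hessian_def inner_scaleR_left vector_matrix_mult_scaleR_right
  by (auto intro!: has_derivative_mult_right has_derivative_scaleR_right)

lemma has_hessian_dilate:
  fixes a :: "real^'n::finite"
  assumes "has_hessian u G H"
  shows "has_hessian (\<lambda>x. u (a + c *\<^sub>R x)) (\<lambda>x. c *\<^sub>R G (a + c *\<^sub>R x)) (\<lambda>x. c\<^sup>2 *\<^sub>R H (a + c *\<^sub>R x))"
proof -
  have d: "((\<lambda>x. a + c *\<^sub>R x) has_derivative (\<lambda>h. c *\<^sub>R h)) (at x)" for x :: "real^'n"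
    by (auto intro!: derivative_eq_intros)
  have 1: "((\<lambda>x. u (a + c *\<^sub>R x)) has_derivative (\<lambda>h. G (a + c *\<^sub>R x) \<bullet> (c *\<^sub>R h))) (at x)" for x
    by (rule has_derivative_compose[OF d, of u "\<lambda>k. G (a + c *\<^sub>R x) \<bullet> k"])
      (use assms in \<open>auto simp: has_hessian_def\<close>)
  have 2: "((\<lambda>x. G (a + c *\<^sub>R x)) has_derivative (\<lambda>h. (c *\<^sub>R h) v* H (a + c *\<^sub>R x))) (at x)" for x
    by (rule has_derivative_compose[OF d, of G "\<lambda>k. k v* H (a + c *\<^sub>R x)"])
      (use assms in \<open>auto simp: has_hessian_def\<close>)
  have e: "(\<lambda>h. h v* (c\<^sup>2 *\<^sub>R H x)) = (\<lambda>h. c *\<^sub>R ((c *\<^sub>R h) v* H x))" for x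
    by (simp add: vector_matrix_mult_scaleR_right vector_matrix_mult_scaleR_left power2_eq_square)
  have e': "(c *\<^sub>R g) \<bullet> h = g \<bullet> (c *\<^sub>R h)" for g h :: "real^'n" by simp
  show ?thesis unfolding has_hessian_def e e'
    using 1 2 by (auto intro!: has_derivative_scaleR_right)
qed

lemma has_hessian_translate:
  assumes "has_hessian u G H"
  shows "has_hessian (\<lambda>x. u (a + x)) (\<lambda>x. G (a + x)) (\<lambda>x. H (a + x))"
  using has_hessian_dilate[OF assms, of a 1] by simp

lemma has_hessian_continuous: "has_hessian u G H \<Longrightarrow> continuous_on S u"
  unfolding has_hessian_def
  by (meson continuous_at_imp_continuous_on has_derivative_continuous)

lemma has_hessian_deriv_line:
  assumes "has_hessian u G H"
  shows "((\<lambda>t. u (x + t *\<^sub>R w)) has_real_derivative G (x + t *\<^sub>R w) \<bullet> w) (at t)"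
    and "((\<lambda>t. G (x + t *\<^sub>R w) \<bullet> v) has_real_derivative (w v* H (x + t *\<^sub>R w)) \<bullet> v) (at t)"
proof -
  have d: "((\<lambda>t. x + t *\<^sub>R w) has_derivative (\<lambda>h. h *\<^sub>R w)) (at t)"
    by (auto intro!: derivative_eq_intros)
  have 1: "((\<lambda>t. u (x + t *\<^sub>R w)) has_derivative (\<lambda>h. G (x + t *\<^sub>R w) \<bullet> (h *\<^sub>R w))) (at t)"
    by (rule has_derivative_compose[OF d, of u "\<lambda>k. G (x + t *\<^sub>R w) \<bullet> k"])
      (use assms in \<open>auto simp: has_hessian_def\<close>)
  show "((\<lambda>t. u (x + t *\<^sub>R w)) has_real_derivative G (x + t *\<^sub>R w) \<bullet> w) (at t)"
    using 1 by (simp add: has_field_derivative_def mult_commute_abs)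
  have "((\<lambda>t. G (x + t *\<^sub>R w)) has_derivative (\<lambda>h. (h *\<^sub>R w) v* H (x + t *\<^sub>R w))) (at t)"
    by (rule has_derivative_compose[OF d, of G "\<lambda>k. k v* H (x + t *\<^sub>R w)"])
      (use assms in \<open>auto simp: has_hessian_def\<close>)
  then have "((\<lambda>t. G (x + t *\<^sub>R w) \<bullet> v) has_derivative (\<lambda>h. ((h *\<^sub>R w) v* H (x + t *\<^sub>R w)) \<bullet> v)) (at t)"
    by (rule has_derivative_inner_left)
  moreover have "(\<lambda>h. ((h *\<^sub>R w) v* H (x + t *\<^sub>R w)) \<bullet> v) = (*) ((w v* H (x + t *\<^sub>R w)) \<bullet> v)"
    by (auto simp: vector_matrix_mult_scaleR_left mult_commute_abs)
  ultimately show "((\<lambda>t. G (x + t *\<^sub>R w) \<bullet> v) has_real_derivative (w v* H (x + t *\<^sub>R w)) \<bullet> v) (at t)"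
    by (simp add: has_field_derivative_def)
qed

lemma second_derivative_test:
  assumes C: "has_hessian u G H" and "open S" "x \<in> S" and m: "\<And>y. y \<in> S \<Longrightarrow> u y \<le> u x"
  shows "G x = 0" and "(w v* H x) \<bullet> w \<le> 0"
proof -
  obtain e where e: "e > 0" "ball x e \<subseteq> S"
    using assms open_contains_ball by blast
  show G0: "G x = 0"
  proof -
    have "(\<lambda>h. G x \<bullet> h) = (\<lambda>h. 0)"
    proof (rule differential_zero_maxmin[of x S u])
      show "(u has_derivative (\<bullet>) (G x)) (at x)" using C unfolding has_hessian_def by auto
    qed (use assms in auto)
    then have "G x \<bullet> G x = 0" by metis
    then show ?thesis by simp
  qed
  show "(w v* H x) \<bullet> w \<le> 0"
  proof (rule ccontr)
    assume "\<not> ?thesis"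
    then have pos: "(w v* H x) \<bullet> w > 0" by simp
    then have w: "w \<noteq> 0" by auto
    have "((\<lambda>t. G (x + t *\<^sub>R w) \<bullet> w) has_real_derivative (w v* H (x + 0 *\<^sub>R w)) \<bullet> w) (at 0)"
      by (rule has_hessian_deriv_line[OF C])
    then have "((\<lambda>t. G (x + t *\<^sub>R w) \<bullet> w) has_real_derivative (w v* H x) \<bullet> w) (at 0)" by simp
    from DERIV_pos_inc_right[OF this pos] obtain d where d: "d > 0"
      "\<And>h. 0 < h \<Longrightarrow> h < d \<Longrightarrow> G (x + h *\<^sub>R w) \<bullet> w > 0" using G0 by auto
    define t where "t = min (d/2) (e / (2 * norm w))"
    have t: "t > 0" "t < d" "t * norm w < e"
    proof -
      show "t > 0" "t < d" using d e w by (auto simp: t_def)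
      have "t \<le> e / (2 * norm w)" by (simp add: t_def)
      then have "t * norm w \<le> e / 2" using w by (simp add: field_simps)
      then show "t * norm w < e" using e by simp
    qed
    have "u (x + 0 *\<^sub>R w) < u (x + t *\<^sub>R w)"
    proof (rule DERIV_pos_imp_increasing_open[of 0 t "\<lambda>t. u (x + t *\<^sub>R w)"])
      show "0 < t" by fact
      show "\<exists>y. ((\<lambda>t. u (x + t *\<^sub>R w)) has_real_derivative y) (at s) \<and> 0 < y" if "0 < s" "s < t" for s
        using has_hessian_deriv_line(1)[OF C, of x w s] d(2)[of s] that t by auto
      show "continuous_on {0..t} (\<lambda>t. u (x + t *\<^sub>R w))"
        by (rule DERIV_continuous_on) (use has_hessian_deriv_line(1)[OF C, of x w] DERIV_subset in blast)
    qed
    moreover have "x + t *\<^sub>R w \<in> S" using e t by (auto simp: dist_norm)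
    ultimately show False using m by fastforce
  qed
qed

section \<open>Comparison principle for a constant elliptic matrix\<close>

lemma frobenius_prod_diff_right: "frobenius_prod A (B - C) = frobenius_prod A B - frobenius_prod A C"
  by (simp add: frobenius_prod_def algebra_simps sum_subtractf)

lemma frobenius_prod_diff_left: "frobenius_prod (A - B) C = frobenius_prod A C - frobenius_prod B C"
  by (simp add: frobenius_prod_def algebra_simps sum_subtractf)

lemma frobenius_prod_add_right: "frobenius_prod A (B + C) = frobenius_prod A B + frobenius_prod A C"
  by (simp add: frobenius_prod_def algebra_simps sum.distrib)

lemma frobenius_prod_scaleR_right: "frobenius_prod A (c *\<^sub>R B) = c * frobenius_prod A B"
  by (simp add: frobenius_prod_def algebra_simps sum_distrib_left)

text \<open>Gaussian elimination writes \<open>A\<close> as a sum of nonnegative multiples of matrices \<open>a a\<^sup>T\<close>, and \<open>(a a\<^sup>T) : M\<close> is the value at \<open>a\<close> of the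
quadratic form of \<open>M\<close>. The induction runs over the set of indices on which \<open>A\<close> is supported.\<close>

lemma frobenius_prod_psd_nsd:
  fixes A M :: "real^'n::finite^'n"
  assumes "transpose A = A" "\<And>\<xi>. 0 \<le> \<xi> \<bullet> (A *v \<xi>)" and M: "\<And>w. (w v* M) \<bullet> w \<le> 0"
  shows "frobenius_prod A M \<le> 0"
proof -
  have quad: "\<xi> \<bullet> (A *v \<xi>) = (\<Sum>i\<in>UNIV. \<Sum>j\<in>UNIV. \<xi> $ i * \<xi> $ j * A $ i $ j)" for A :: "real^'n^'n" and \<xi>
    by (simp add: inner_vec_def matrix_vector_mult_def sum_distrib_left mult_ac)
  have "frobenius_prod A M \<le> 0" if "finite S" "\<And>i j. A $ i $ j = A $ j $ i"
      "\<And>\<xi>. 0 \<le> (\<Sum>i\<in>UNIV. \<Sum>j\<in>UNIV. \<xi> $ i * \<xi> $ j * A $ i $ j)"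
      "\<And>i j. A $ i $ j \<noteq> 0 \<Longrightarrow> i \<in> S" for S and A :: "real^'n^'n"
    using that
  proof (induction S arbitrary: A rule: finite_induct)
    case empty
    have "A $ i $ j = 0" for i j using empty(3)[of i j] by blast
    then show ?case by (simp add: frobenius_prod_def)
  next
    case (insert k S)
    define q where "q \<xi> = (\<Sum>i\<in>UNIV. \<Sum>j\<in>UNIV. \<xi> $ i * \<xi> $ j * A $ i $ j)" for \<xi>
    define a where "a = A $ k"
    have q0: "q \<xi> \<ge> 0" for \<xi> unfolding q_def by (rule insert.prems(2))
    have axk: "axis k 1 \<bullet> v = v $ k" for v :: "real^'n" by (simp add: inner_axis')
    have Ak: "A *v axis k 1 = a"
      using insert.prems(1)[of _ k] by (simp add: matrix_vector_mult_basis column_def a_def vec_eq_iff)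
    have qk: "q (\<xi> + t *\<^sub>R axis k 1) = q \<xi> + 2 * t * (a \<bullet> \<xi>) + t\<^sup>2 * A $ k $ k" for \<xi> t
    proof -
      have "q (\<xi> + t *\<^sub>R axis k 1) = (\<xi> + t *\<^sub>R axis k 1) \<bullet> (A *v (\<xi> + t *\<^sub>R axis k 1))"
        unfolding q_def quad ..
      also have "\<dots> = \<xi> \<bullet> (A *v \<xi>) + t * (axis k 1 \<bullet> (A *v \<xi>)) + t * (\<xi> \<bullet> (A *v axis k 1)) + t\<^sup>2 * (axis k 1 \<bullet> (A *v axis k 1))"
        by (simp add: matrix_vector_mult_add_rdistrib matrix_vector_mult_scaleR inner_add_left inner_add_right algebra_simps power2_eq_square)
      also have "axis k 1 \<bullet> (A *v \<xi>) = a \<bullet> \<xi>"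
        by (simp add: axk matrix_vector_mul_component a_def)
      also have "\<xi> \<bullet> (A *v axis k 1) = a \<bullet> \<xi>"
        by (simp add: Ak inner_commute)
      also have "axis k 1 \<bullet> (A *v axis k 1) = A $ k $ k"
        by (simp only: Ak axk) (simp add: a_def)
      also have "\<xi> \<bullet> (A *v \<xi>) = q \<xi>" unfolding q_def quad ..
      finally show ?thesis by simp
    qed
    have Akk: "A $ k $ k \<ge> 0" using q0[of "0 + 1 *\<^sub>R axis k 1"] unfolding qk by (simp add: q_def)
    show ?case
    proof (cases "A $ k $ k = 0")
      case True
      \<comment> \<open>A zero pivot makes the form affine along \<open>e\<^sub>k\<close>, and a nonnegative affine function is constant.\<close>
      have row: "a \<bullet> \<xi> = 0" for \<xi>
      proof (rule ccontr)
        assume n: "a \<bullet> \<xi> \<noteq> 0"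
        have "q (\<xi> + (- (q \<xi> + 1) / (2 * (a \<bullet> \<xi>))) *\<^sub>R axis k 1) = - 1"
          unfolding qk True using n by (simp add: field_simps)
        then show False using q0 by (metis not_one_le_zero neg_0_le_iff_le)
      qed
      then have "a = 0" by (metis inner_eq_zero_iff)
      then have "A $ k $ j = 0" for j by (simp add: a_def)
      then have "i \<in> S" if "A $ i $ j \<noteq> 0" for i j
        using that insert.prems(3)[OF that] by (cases "i = k") auto
      then show ?thesis using insert.IH[OF insert.prems(1,2)] by blast
    next
      case False
      \<comment> \<open>Eliminating the pivot keeps the form nonnegative: the value at \<open>\<xi>\<close> of the form of \<open>A'\<close> is the minimum of the form of \<open>A\<close> on the line \<open>\<xi> + t e\<^sub>k\<close>.\<close>
      define A' where "A' = (\<chi> i j. A $ i $ j - a $ i * a $ j / A $ k $ k)"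
      have A'c: "A' $ i $ j = A $ i $ j - a $ i * a $ j / A $ k $ k" for i j by (simp add: A'_def)
      have sq: "(\<Sum>i\<in>UNIV. \<Sum>j\<in>UNIV. \<xi> $ i * \<xi> $ j * (a $ i * a $ j / A $ k $ k)) = (a \<bullet> \<xi>)\<^sup>2 / A $ k $ k" for \<xi>
        by (simp add: inner_vec_def power2_eq_square sum_product sum_divide_distrib mult_ac)
      have "frobenius_prod A' M \<le> 0"
      proof (rule insert.IH)
        show "A' $ i $ j = A' $ j $ i" for i j using insert.prems(1) by (simp add: A'c mult.commute)
        show "0 \<le> (\<Sum>i\<in>UNIV. \<Sum>j\<in>UNIV. \<xi> $ i * \<xi> $ j * A' $ i $ j)" for \<xi>
        proof -
          have "(\<Sum>i\<in>UNIV. \<Sum>j\<in>UNIV. \<xi> $ i * \<xi> $ j * A' $ i $ j) = q \<xi> - (a \<bullet> \<xi>)\<^sup>2 / A $ k $ k"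
            unfolding A'c right_diff_distrib sum_subtractf sq q_def ..
          also have "\<dots> = q (\<xi> + (- (a \<bullet> \<xi>) / A $ k $ k) *\<^sub>R axis k 1)"
            unfolding qk using False by (simp add: field_simps power2_eq_square)
          finally show ?thesis using q0 by simp
        qed
        show "i \<in> S" if "A' $ i $ j \<noteq> 0" for i j
        proof -
          have "A' $ k $ j = 0" using False by (simp add: A'c a_def)
          then have "i \<noteq> k" using that by auto
          moreover have "i \<in> insert k S"
            using that insert.prems(3)[of i j] insert.prems(3)[of i k] insert.prems(1)[of i k]
            unfolding A'c by (cases "A $ i $ j = 0") (auto simp: a_def)
          ultimately show ?thesis by auto
        qed
      qed
      moreover have "frobenius_prod A M = frobenius_prod A' M + ((a v* M) \<bullet> a) / A $ k $ k"
        unfolding frobenius_prod_def bilinear_form_expand A'c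
        by (simp add: algebra_simps sum_subtractf sum_divide_distrib)
      moreover have "((a v* M) \<bullet> a) / A $ k $ k \<le> 0"
        using M[of a] Akk by (simp add: divide_nonpos_nonneg)
      ultimately show ?thesis by linarith
    qed
  qed
  from this[of UNIV A] show ?thesis using assms unfolding quad
    by (auto simp: transpose_def vec_eq_iff)
qed

text \<open>An interior maximum is excluded because there the Hessian is negative semidefinite, so that its
product with \<open>A\<close> cannot be positive.\<close>

lemma comparison_principle:
  fixes A :: "real^'n::finite^'n"
  assumes A: "transpose A = A" "\<And>\<xi>. 0 \<le> \<xi> \<bullet> (A *v \<xi>)"
    and C: "has_hessian v G H" and D: "open D" "bounded D"
    and sub: "\<And>x. x \<in> D \<Longrightarrow> frobenius_prod A (H x) > 0"
    and bd: "\<And>x. x \<in> frontier D \<Longrightarrow> v x \<le> 0"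
    and x: "x \<in> D"
  shows "v x \<le> 0"
proof -
  have "compact (closure D)" using D by simp
  moreover have xc: "x \<in> closure D" using x closure_subset by (rule subsetD[rotated])
  ultimately have "\<exists>z\<in>closure D. \<forall>y\<in>closure D. v y \<le> v z"
    by (intro continuous_attains_sup has_hessian_continuous[OF C]) auto
  then obtain z where z: "z \<in> closure D" "\<And>y. y \<in> closure D \<Longrightarrow> v y \<le> v z" by auto
  have "z \<notin> D"
  proof
    assume "z \<in> D"
    have "(w v* H z) \<bullet> w \<le> 0" for w
    proof (rule second_derivative_test(2)[OF C D(1) \<open>z \<in> D\<close>])
      show "v y \<le> v z" if "y \<in> D" for y using z(2) that closure_subset[of D] by auto
    qed
    then have "frobenius_prod A (H z) \<le> 0" by (rule frobenius_prod_psd_nsd[OF A])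
    then show False using sub[OF \<open>z \<in> D\<close>] by simp
  qed
  then have "z \<in> frontier D" using z D by (simp add: frontier_def interior_open)
  then show ?thesis using bd z(2)[OF xc] by force
qed

section \<open>A half-space estimate by reflection\<close>

text \<open>If \<open>n \<bullet> m = 2\<close>, this is the (generally oblique) reflection that fixes the hyperplane orthogonal to
\<open>n\<close> and sends \<open>m\<close> to \<open>- m\<close>.\<close>

definition rank_one_shear :: "real^'n::finite \<Rightarrow> real^'n \<Rightarrow> real^'n \<Rightarrow> real^'n" where
  "rank_one_shear n m x = x - (n \<bullet> x) *\<^sub>R m"

text \<open>The map is \<open>T = 1 - m n\<^sup>T\<close>, and the Hessian of the composition is \<open>T\<^sup>T M T\<close>, multiplied out.\<close>

lemma has_hessian_shear:
  fixes n m :: "real^'n::finite"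
  assumes "has_hessian u G H"
  shows "has_hessian (\<lambda>x. u (rank_one_shear n m x))
    (\<lambda>x. G (rank_one_shear n m x) - (m \<bullet> G (rank_one_shear n m x)) *\<^sub>R n)
    (\<lambda>x. let M = H (rank_one_shear n m x) in
       (\<chi> i j. M $ i $ j - n $ i * (m v* M) $ j - (M *v m) $ i * n $ j
          + ((m v* M) \<bullet> m) * (n $ i * n $ j)))"
proof -
  have d: "(rank_one_shear n m has_derivative (\<lambda>h. h - (n \<bullet> h) *\<^sub>R m)) (at x)" for x
    unfolding rank_one_shear_def[abs_def] by (auto intro!: derivative_eq_intros)
  have 1: "((\<lambda>x. u (rank_one_shear n m x)) has_derivative
      (\<lambda>h. G (rank_one_shear n m x) \<bullet> (h - (n \<bullet> h) *\<^sub>R m))) (at x)" for x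
    by (rule has_derivative_compose[OF d, of u "\<lambda>k. G (rank_one_shear n m x) \<bullet> k"])
      (use assms in \<open>auto simp: has_hessian_def\<close>)
  have 2: "((\<lambda>x. G (rank_one_shear n m x)) has_derivative
      (\<lambda>h. (h - (n \<bullet> h) *\<^sub>R m) v* H (rank_one_shear n m x))) (at x)" for x
    by (rule has_derivative_compose[OF d, of G "\<lambda>k. k v* H (rank_one_shear n m x)"])
      (use assms in \<open>auto simp: has_hessian_def\<close>)
  have 3: "((\<lambda>x. G (rank_one_shear n m x) - (m \<bullet> G (rank_one_shear n m x)) *\<^sub>R n) has_derivative
      (\<lambda>h. (h - (n \<bullet> h) *\<^sub>R m) v* H (rank_one_shear n m x) -
         (m \<bullet> ((h - (n \<bullet> h) *\<^sub>R m) v* H (rank_one_shear n m x))) *\<^sub>R n)) (at x)" for x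
    by (intro has_derivative_diff 2 has_derivative_scaleR_left has_derivative_inner_right)
  have swap: "m \<bullet> (h v* M) = h \<bullet> (M *v m)" for M :: "real^'n^'n" and h
    by (metis dot_lmul_matrix inner_commute)
  have dl: "(h - k) v* M = h v* M - k v* M" for h k and M :: "real^'n^'n"
    by (simp add: vector_matrix_mult_def vec_eq_iff algebra_simps sum_subtractf)
  have 4: "(h - (n \<bullet> h) *\<^sub>R m) v* M - (m \<bullet> ((h - (n \<bullet> h) *\<^sub>R m) v* M)) *\<^sub>R n =
     h v* (\<chi> i j. M $ i $ j - n $ i * (m v* M) $ j - (M *v m) $ i * n $ j
          + ((m v* M) \<bullet> m) * (n $ i * n $ j))" (is "?l = ?r") for M :: "real^'n^'n" and h
  proof -
    have "?l = h v* M - (n \<bullet> h) *\<^sub>R (m v* M) - (h \<bullet> (M *v m)) *\<^sub>R n + ((n \<bullet> h) * ((m v* M) \<bullet> m)) *\<^sub>R n"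
      by (simp add: dl vector_matrix_mult_scaleR_left inner_diff_right swap inner_commute[of m "m v* M"]
            inner_commute[of "M *v m" m] algebra_simps)
         (simp add: inner_commute[of m] dot_lmul_matrix)
    also have "\<dots> = ?r"
    proof -
      have 1: "(\<Sum>i\<in>UNIV. n $ i * (m v* M) $ j * h $ i) = (n \<bullet> h) * (m v* M) $ j" for j
        by (simp add: inner_vec_def sum_distrib_left sum_distrib_right mult_ac)
      have 2: "(\<Sum>i\<in>UNIV. (M *v m) $ i * n $ j * h $ i) = (h \<bullet> (M *v m)) * n $ j" for j
        by (simp add: inner_vec_def sum_distrib_left sum_distrib_right mult_ac)
      have 3: "(\<Sum>i\<in>UNIV. q * (n $ i * n $ j) * h $ i) = (n \<bullet> h) * q * n $ j" for j q
        by (simp add: inner_vec_def sum_distrib_left sum_distrib_right mult_ac)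
      have "?r $ j = (h v* M - (n \<bullet> h) *\<^sub>R (m v* M) - (h \<bullet> (M *v m)) *\<^sub>R n
          + ((n \<bullet> h) * ((m v* M) \<bullet> m)) *\<^sub>R n) $ j" for j
      proof -
        have "?r $ j = (\<Sum>i\<in>UNIV. (M $ i $ j - n $ i * (m v* M) $ j - (M *v m) $ i * n $ j
            + ((m v* M) \<bullet> m) * (n $ i * n $ j)) * h $ i)"
          unfolding vector_matrix_mult_def[of h] by (auto intro!: sum.cong simp: mult.commute)
        also have "\<dots> = (\<Sum>i\<in>UNIV. M $ i $ j * h $ i) - (n \<bullet> h) * (m v* M) $ j
            - (h \<bullet> (M *v m)) * n $ j + (n \<bullet> h) * ((m v* M) \<bullet> m) * n $ j"
          unfolding left_diff_distrib distrib_right sum.distrib sum_subtractf 1 2 3 ..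
        also have "(\<Sum>i\<in>UNIV. M $ i $ j * h $ i) = (h v* M) $ j"
          unfolding vector_matrix_mult_def[of h] by (auto intro!: sum.cong simp: mult.commute)
        finally show ?thesis by simp
      qed
      then show ?thesis unfolding vec_eq_iff by simp
    qed
    finally show ?thesis .
  qed
  have 5: "G y \<bullet> (h - (n \<bullet> h) *\<^sub>R m) = (G y - (m \<bullet> G y) *\<^sub>R n) \<bullet> h" for y h
    by (simp add: inner_diff_left inner_diff_right inner_commute)
  show ?thesis
    unfolding has_hessian_def Let_def 4[symmetric] 5[symmetric] using 1 3 by blast
qed

text \<open>With \<open>m\<close> in the direction \<open>A n\<close>, the reflection \<open>T = 1 - m n\<^sup>T\<close> satisfies \<open>T A T\<^sup>T = A\<close>: it is an isometry for the
metric in which \<open>A : \<nabla>\<^sup>2\<close> is the Laplacian, and so it commutes with this operator.\<close>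

lemma frobenius_prod_shear:
  fixes n m :: "real^'n::finite"
  assumes A: "transpose A = A" and m: "m = (2 / (n \<bullet> (A *v n))) *\<^sub>R (A *v n)" and s: "n \<bullet> (A *v n) \<noteq> 0"
  shows "frobenius_prod A (\<chi> i j. M $ i $ j - n $ i * (m v* M) $ j - (M *v m) $ i * n $ j
          + ((m v* M) \<bullet> m) * (n $ i * n $ j)) = frobenius_prod A M"
proof -
  define a where "a = A *v n"
  define s where "s = n \<bullet> a"
  define q where "q = (a v* M) \<bullet> a"
  have As: "A $ i $ j = A $ j $ i" for i j using A by (simp add: transpose_def vec_eq_iff)
  have a1: "(\<Sum>j\<in>UNIV. A $ i $ j * n $ j) = a $ i" for i
    by (simp add: a_def matrix_vector_mult_def)
  have a2: "(\<Sum>i\<in>UNIV. A $ i $ j * n $ i) = a $ j" for j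
    unfolding a1[symmetric] by (rule sum.cong[OF refl], subst As, rule refl)
  have m': "m = (2 / s) *\<^sub>R a" by (simp add: m s_def a_def)
  have e1: "(\<Sum>i\<in>UNIV. \<Sum>j\<in>UNIV. A $ i $ j * (n $ i * (m v* M) $ j)) = (2 / s) * q"
  proof -
    have "(\<Sum>i\<in>UNIV. \<Sum>j\<in>UNIV. A $ i $ j * (n $ i * (m v* M) $ j)) =
      (\<Sum>j\<in>UNIV. (\<Sum>i\<in>UNIV. A $ i $ j * n $ i) * (m v* M) $ j)"
      unfolding sum_distrib_right by (subst sum.swap) (simp add: mult_ac)
    also have "\<dots> = a \<bullet> (m v* M)" by (simp add: a2 inner_vec_def)
    also have "\<dots> = (2 / s) * q"
      by (simp add: m' vector_matrix_mult_scaleR_left q_def inner_commute)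
    finally show ?thesis .
  qed
  have e2: "(\<Sum>i\<in>UNIV. \<Sum>j\<in>UNIV. A $ i $ j * ((M *v m) $ i * n $ j)) = (2 / s) * q"
  proof -
    have "(\<Sum>i\<in>UNIV. \<Sum>j\<in>UNIV. A $ i $ j * ((M *v m) $ i * n $ j)) =
      (\<Sum>i\<in>UNIV. (\<Sum>j\<in>UNIV. A $ i $ j * n $ j) * (M *v m) $ i)"
      unfolding sum_distrib_right by (simp add: mult_ac)
    also have "\<dots> = a \<bullet> (M *v m)" by (simp add: a1 inner_vec_def)
    also have "\<dots> = (2 / s) * q"
      by (simp add: m' matrix_vector_mult_scaleR q_def dot_lmul_matrix)
    finally show ?thesis .
  qed
  have e3: "(\<Sum>i\<in>UNIV. \<Sum>j\<in>UNIV. A $ i $ j * (k * (n $ i * n $ j))) = k * s" for k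
  proof -
    have "(\<Sum>i\<in>UNIV. \<Sum>j\<in>UNIV. A $ i $ j * (k * (n $ i * n $ j))) =
      k * (\<Sum>i\<in>UNIV. n $ i * (\<Sum>j\<in>UNIV. A $ i $ j * n $ j))"
      by (simp add: sum_distrib_left mult_ac)
    then show ?thesis by (simp add: a1 inner_vec_def s_def)
  qed
  have mq: "(m v* M) \<bullet> m = (2/s)\<^sup>2 * q"
    by (simp add: m' vector_matrix_mult_scaleR_left q_def power2_eq_square)
  have "s \<noteq> 0" using assms(3) by (simp add: s_def a_def)
  then show ?thesis
    unfolding frobenius_prod_def vec_lambda_beta distrib_left right_diff_distrib sum.distrib sum_subtractf e1 e2 e3 mq
    by (simp add: power2_eq_square)
qed

lemma has_hessian_barrier:
  fixes n :: "real^'n::finite"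
  shows "has_hessian (\<lambda>x. a * (norm x)\<^sup>2 + b * (n \<bullet> x) + c * (n \<bullet> x)\<^sup>2)
     (\<lambda>x. (2 * a) *\<^sub>R x + b *\<^sub>R n + (2 * c * (n \<bullet> x)) *\<^sub>R n)
     (\<lambda>x. (2 * a) *\<^sub>R mat 1 + (2 * c) *\<^sub>R (\<chi> i j. n $ i * n $ j))"
proof -
  have e: "h v* ((2 * a) *\<^sub>R mat 1 + (2 * c) *\<^sub>R (\<chi> i j. n $ i * n $ j)) = (2 * a) *\<^sub>R h + (2 * c * (n \<bullet> h)) *\<^sub>R n" for h
  proof -
    have ad: "h v* (P + Q) = h v* P + h v* Q" for P Q :: "real^'n^'n"
      by (simp add: vector_matrix_mult_def vec_eq_iff algebra_simps sum.distrib)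
    have "h v* (\<chi> i j. n $ i * n $ j) = (n \<bullet> h) *\<^sub>R n"
      by (simp add: vector_matrix_mult_def vec_eq_iff inner_vec_def sum_distrib_left sum_distrib_right mult_ac)
    then show ?thesis by (simp add: ad vector_matrix_mult_scaleR_right)
  qed
  show ?thesis
    unfolding has_hessian_def e dot_square_norm[symmetric]
    by (auto intro!: derivative_eq_intros simp: inner_add_left inner_commute algebra_simps)
qed

lemma frobenius_prod_barrier:
  "frobenius_prod A ((2 * a) *\<^sub>R mat 1 + (2 * c) *\<^sub>R (\<chi> i j. n $ i * n $ j)) =
     2 * a * (\<Sum>i\<in>UNIV. A $ i $ i) + 2 * c * (n \<bullet> (A *v n))"
  for A :: "real^'n::finite^'n"
proof -
  have "frobenius_prod A (mat 1) = (\<Sum>i\<in>UNIV. A $ i $ i)"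
    by (simp add: frobenius_prod_def mat_def if_distrib cong: if_cong)
  moreover have "frobenius_prod A (\<chi> i j. n $ i * n $ j) = n \<bullet> (A *v n)"
    by (simp add: frobenius_prod_def inner_vec_def matrix_vector_mult_def sum_distrib_left mult_ac)
  ultimately show ?thesis
    by (simp add: frobenius_prod_add_right frobenius_prod_scaleR_right)
qed

text \<open>The difference of \<open>p\<close> and its reflection in the hyperplane half way between \<open>x0\<close> and \<open>x0 + h\<close>
vanishes on that hyperplane. On a half ball of radius \<open>R\<close> it is dominated by a quadratic
supersolution that is large on the spherical part of the boundary but of size \<open>\<bar>h\<bar> / R\<close> near the centre.
With \<open>\<mu> = 0\<close> and \<open>R \<rightarrow> \<infinity>\<close> this is Liouville's theorem.\<close>

lemma halfspace_estimate_upper: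
  fixes A :: "real^'n::finite^'n"
  assumes A: "transpose A = A" and c: "0 < c" and ell: "\<And>\<xi>. c * (norm \<xi>)\<^sup>2 \<le> \<xi> \<bullet> (A *v \<xi>)"
    and tr: "(\<Sum>i\<in>UNIV. A $ i $ i) \<le> T" and nA: "\<And>v. norm (A *v v) \<le> T * norm v" and T: "0 \<le> T"
    and C: "has_hessian p G H" and R: "0 < R" and M: "0 < M" and mu: "0 \<le> \<mu>"
    and pM: "\<And>x. norm (x - x0) \<le> 2 * (1 + 2 * T / c) * R \<Longrightarrow> \<bar>p x\<bar> \<le> M"
    and pmu: "\<And>x. norm (x - x0) \<le> 2 * (1 + 2 * T / c) * R \<Longrightarrow> \<bar>frobenius_prod A (H x)\<bar> \<le> \<mu>"
    and h: "norm h \<le> R"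
  shows "p (x0 + h) - p x0 \<le> (2 * M + \<mu> * R\<^sup>2) * (1 + (T + 2) / c) * norm h / R"
proof (cases "h = 0")
  case True then show ?thesis by simp
next
  case False
  define L where "L = 1 + 2 * T / c"
  have L1: "L \<ge> 1" using T c by (simp add: L_def)
  have psd: "0 \<le> \<xi> \<bullet> (A *v \<xi>)" for \<xi> using ell[of \<xi>] c
    by (meson order_trans mult_nonneg_nonneg less_imp_le zero_le_power2)
  have "inj ((*v) A)"
  proof (rule linear_injective_0[OF matrix_vector_mul_linear, THEN iffD2], intro allI impI)
    fix v assume "A *v v = 0"
    then have "c * (norm v)\<^sup>2 \<le> 0" using ell[of v] by simp
    then have "(norm v)\<^sup>2 \<le> 0" using c by (simp add: mult_le_0_iff)
    then show "v = 0" by simp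
  qed
  then have "surj ((*v) A)" by (rule linear_injective_imp_surjective[OF matrix_vector_mul_linear _ refl])
  then obtain y where y: "A *v y = h" by (metis surjD)
  have y0: "y \<noteq> 0" using y False by auto
  \<comment> \<open>The unit normal is chosen parallel to the preimage of \<open>h\<close> under \<open>A\<close>, so that the reflection moves points in the direction \<open>A n\<close>, that is, along \<open>h\<close>.\<close>
  define n where "n = (1 / norm y) *\<^sub>R y"
  have n1: "norm n = 1" using y0 by (simp add: n_def)
  define s where "s = n \<bullet> (A *v n)"
  have An: "A *v n = (1 / norm y) *\<^sub>R h" by (simp add: n_def matrix_vector_mult_scaleR y)
  have s: "s \<ge> c" using ell[of n] n1 by (simp add: s_def)
  have s0: "s > 0" using s c by simp
  define m where "m = (2 / s) *\<^sub>R (A *v n)"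
  define S where "S = rank_one_shear n m"
  have nS: "norm (S x) \<le> L * norm x" for x
  proof -
    have "norm m \<le> 2 * T / c"
    proof -
      have "norm m = (2 / s) * norm (A *v n)" using s0 by (simp add: m_def)
      also have "\<dots> \<le> (2 / c) * T"
        using nA[of n] n1 s c s0 by (intro mult_mono divide_left_mono) auto
      finally show ?thesis by simp
    qed
    have "norm (S x) \<le> norm x + \<bar>n \<bullet> x\<bar> * norm m"
      unfolding S_def rank_one_shear_def by (metis norm_scaleR norm_triangle_ineq4)
    also have "\<dots> \<le> norm x + (norm n * norm x) * (2 * T / c)"
      using \<open>norm m \<le> 2 * T / c\<close> Cauchy_Schwarz_ineq2[of n x] by (intro add_left_mono mult_mono) auto
    finally show ?thesis by (simp add: n1 L_def algebra_simps)
  qed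
  define z where "z = x0 + (1/2) *\<^sub>R h"
  have nh: "n \<bullet> h = norm y * s" using y0 by (simp add: s_def An)
  have Sh: "S ((1/2) *\<^sub>R h) = - (1/2) *\<^sub>R h"
  proof -
    have "(n \<bullet> ((1/2) *\<^sub>R h)) *\<^sub>R m = h"
      using y0 s0 by (simp add: nh m_def An)
    moreover have "(1/2) *\<^sub>R h - h = - (1/2) *\<^sub>R h"
      by (simp add: vec_eq_iff)
    ultimately show ?thesis by (simp add: S_def rank_one_shear_def)
  qed
  \<comment> \<open>This \<open>K\<close> makes the barrier a strict supersolution: its operator value is \<open>2 B (tr A - K s) / R\<^sup>2 \<le> - 4 B / R\<^sup>2\<close>.\<close>
  define K where "K = (T + 2) / c"
  define B where "B = 2 * M + \<mu> * R\<^sup>2"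
  have B0: "B > 0" using M mu by (simp add: B_def add_pos_nonneg)
  have K1: "K \<ge> 0" using T c by (simp add: K_def)
  define Hs where "Hs = (\<lambda>x. let N = H (z + S x) in
       (\<chi> i j. N $ i $ j - n $ i * (m v* N) $ j - (N *v m) $ i * n $ j
          + ((m v* N) \<bullet> m) * (n $ i * n $ j)))"
  \<comment> \<open>With \<open>t = n \<bullet> x\<close> this is \<open>B (\<bar>x\<bar>\<^sup>2 / R\<^sup>2 + K (2 t / R - t\<^sup>2 / R\<^sup>2))\<close>, nonnegative for \<open>0 \<le> t \<le> R\<close>.\<close>
  define w where "w = (\<lambda>x. (B / R\<^sup>2) * (norm x)\<^sup>2 + (2 * B * K / R) * (n \<bullet> x) + (- (B * K / R\<^sup>2)) * (n \<bullet> x)\<^sup>2)"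
  define Hw where "Hw = ((2 * (B / R\<^sup>2)) *\<^sub>R mat 1 + (2 * (- (B * K / R\<^sup>2))) *\<^sub>R (\<chi> i j. n $ i * n $ j))"
  define v where "v = (\<lambda>x. (p (z + x) - p (z + S x)) - w x)"
  obtain Gv where Cv: "has_hessian v Gv (\<lambda>x. (H (z + x) - Hs x) - Hw)"
    using has_hessian_diff[OF has_hessian_diff[OF has_hessian_translate[OF C, of z]
       has_hessian_shear[OF has_hessian_translate[OF C, of z], of n m]]
       has_hessian_barrier[of "B / R\<^sup>2" "2 * B * K / R" n "- (B * K / R\<^sup>2)"]]
    unfolding v_def w_def Hs_def Hw_def S_def by blast
  have fHs: "frobenius_prod A (Hs x) = frobenius_prod A (H (z + S x))" for x
    unfolding Hs_def Let_def
    by (rule frobenius_prod_shear[OF A]) (use s0 in \<open>auto simp: m_def s_def\<close>)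
  define D where "D = ball 0 R \<inter> {x. 0 < n \<bullet> x}"
  have D: "open D" "bounded D" by (auto simp: D_def open_halfspace_gt)
  have in1: "norm ((z + x) - x0) \<le> 2 * L * R" if "norm x \<le> R" for x
  proof -
    have "norm ((z + x) - x0) \<le> norm ((1/2) *\<^sub>R h) + norm x" unfolding z_def using norm_triangle_ineq[of "(1/2) *\<^sub>R h" x] by (simp add: algebra_simps)
    also have "\<dots> \<le> R / 2 + R" using h that by simp
    also have "\<dots> \<le> 2 * 1 * R" using R by simp
    also have "\<dots> \<le> 2 * L * R" using L1 R by (intro mult_right_mono) auto
    finally show ?thesis .
  qed
  have in2: "norm ((z + S x) - x0) \<le> 2 * L * R" if "norm x \<le> R" for x
  proof -
    have "norm ((z + S x) - x0) \<le> norm ((1/2) *\<^sub>R h) + norm (S x)" unfolding z_def using norm_triangle_ineq[of "(1/2) *\<^sub>R h" "S x"] by (simp add: algebra_simps)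
    also have "\<dots> \<le> R / 2 + L * R" using h order_trans[OF nS[of x] mult_left_mono[OF that, of L]] L1 by simp
    also have "\<dots> \<le> 1 * R + L * R" using R by simp
    also have "\<dots> \<le> L * R + L * R" using L1 R by (intro add_right_mono mult_right_mono) auto
    finally show ?thesis by simp
  qed
  have sub: "frobenius_prod A (H (z + x) - Hs x - Hw) > 0" if "x \<in> D" for x
  proof -
    have x: "norm x \<le> R" using that by (simp add: D_def)
    have "frobenius_prod A Hw = (2 * B / R\<^sup>2) * ((\<Sum>i\<in>UNIV. A $ i $ i) - K * s)"
      unfolding Hw_def frobenius_prod_barrier s_def[symmetric] using R by (simp add: field_simps)
    also have "\<dots> \<le> (2 * B / R\<^sup>2) * (- 2)"
    proof -
      have "K * s \<ge> K * c" using s K1 by (intro mult_left_mono) auto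
      then have "K * s \<ge> T + 2" using c by (simp add: K_def)
      then have "(\<Sum>i\<in>UNIV. A $ i $ i) - K * s \<le> - 2" using tr by simp
      then show ?thesis using B0 by (intro mult_left_mono) auto
    qed
    also have "\<dots> = - (8 * M / R\<^sup>2) - 4 * \<mu>" using R by (simp add: B_def field_simps)
    also have "\<dots> < - 2 * \<mu>"
    proof -
      have "8 * M / R\<^sup>2 > 0" using M R by simp
      then show ?thesis using mu by linarith
    qed
    finally have "frobenius_prod A Hw < - 2 * \<mu>" .
    moreover have "\<bar>frobenius_prod A (H (z + x))\<bar> \<le> \<mu>" "\<bar>frobenius_prod A (H (z + S x))\<bar> \<le> \<mu>"
      using pmu in1[OF x] in2[OF x] unfolding L_def by auto
    ultimately show ?thesis unfolding frobenius_prod_diff_right fHs by linarith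
  qed
  have bd: "v x \<le> 0" if "x \<in> frontier D" for x
  proof -
    have fr: "x \<in> closure D" "x \<notin> D" using that D by (auto simp: frontier_def interior_open)
    have "closure D \<subseteq> cball 0 R \<inter> {x. 0 \<le> n \<bullet> x}"
      by (rule closure_minimal) (auto simp: D_def closed_halfspace_ge)
    then have x: "norm x \<le> R" "0 \<le> n \<bullet> x" using fr by auto
    have "n \<bullet> x \<le> norm n * norm x" by (rule norm_cauchy_schwarz)
    then have tR: "n \<bullet> x \<le> R" using x n1 by simp
    have w: "w x = B * ((norm x)\<^sup>2 / R\<^sup>2 + K * (n \<bullet> x) * (2 * R - n \<bullet> x) / R\<^sup>2)"
      unfolding w_def using R by (simp add: field_simps power2_eq_square)
    have nn: "K * (n \<bullet> x) * (2 * R - n \<bullet> x) / R\<^sup>2 \<ge> 0" using K1 x tR R by simp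
    show ?thesis
    proof (cases "n \<bullet> x = 0")
      case True
      then have "S x = x" by (simp add: S_def rank_one_shear_def)
      moreover have "w x \<ge> 0" unfolding w using nn B0 by simp
      ultimately show ?thesis by (simp add: v_def)
    next
      case False
      then have "norm x = R" using fr x by (auto simp: D_def)
      then have "w x \<ge> B * (1 + 0)" unfolding w using nn B0 R by (intro mult_left_mono add_mono) auto
      moreover have "B \<ge> 2 * M" using mu by (simp add: B_def)
      moreover have "\<bar>p (z + x)\<bar> \<le> M" "\<bar>p (z + S x)\<bar> \<le> M"
        using pM in1[OF x(1)] in2[OF x(1)] unfolding L_def by auto
      ultimately show ?thesis by (simp add: v_def)
    qed
  qed
  have hD: "(1/2) *\<^sub>R h \<in> D"
    using h R s0 y0 False nh by (simp add: D_def)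
  have "v ((1/2) *\<^sub>R h) \<le> 0"
    by (rule comparison_principle[OF A psd Cv D sub bd hD])
  moreover have "z + (1/2) *\<^sub>R h = x0 + h" "z + - (1/2) *\<^sub>R h = x0" by (simp_all add: z_def vec_eq_iff)
  ultimately have "p (x0 + h) - p x0 \<le> w ((1/2) *\<^sub>R h)"
    unfolding v_def Sh by simp
  also have "\<dots> \<le> B * ((norm h / R) + K * (norm h / R))"
  proof -
    have a: "(norm ((1/2) *\<^sub>R h))\<^sup>2 / R\<^sup>2 \<le> norm h / R"
    proof -
      have "(norm ((1/2) *\<^sub>R h))\<^sup>2 / R\<^sup>2 = (1/4) * (norm h / R) * (norm h / R)" by (simp add: power2_eq_square)
      also have "\<dots> \<le> 1 * (norm h / R) * 1" using h R by (intro mult_mono) auto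
      finally show ?thesis by simp
    qed
    have "n \<bullet> ((1/2) *\<^sub>R h) \<le> norm n * norm ((1/2) *\<^sub>R h)" by (rule norm_cauchy_schwarz)
    then have t: "n \<bullet> ((1/2) *\<^sub>R h) \<le> norm h / 2" using n1 by simp
    have b: "(2 * B * K / R) * (n \<bullet> ((1/2) *\<^sub>R h)) \<le> B * (K * (norm h / R))"
      using mult_left_mono[OF t, of "2 * B * K / R"] B0 K1 R by simp
    have c: "(- (B * K / R\<^sup>2)) * (n \<bullet> ((1/2) *\<^sub>R h))\<^sup>2 \<le> 0" using B0 K1 by simp
    have d: "(B / R\<^sup>2) * (norm ((1/2) *\<^sub>R h))\<^sup>2 \<le> B * (norm h / R)"
      using mult_left_mono[OF a, of B] B0 by simp
    show ?thesis unfolding w_def using b c d by (simp only: distrib_left)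
  qed
  also have "\<dots> = B * (1 + K) * norm h / R" using R by (simp add: field_simps)
  finally show ?thesis unfolding B_def K_def .
qed

text \<open>The constants below depend on \<open>A\<close> through \<open>c\<close> and \<open>T\<close> only, hence they are the same for all points at
which the coefficients are frozen.\<close>

definition elliptic_matrix :: "real \<Rightarrow> real \<Rightarrow> real^'n::finite^'n \<Rightarrow> bool" where
  "elliptic_matrix c T A \<longleftrightarrow> transpose A = A \<and> (\<forall>\<xi>. c * (norm \<xi>)\<^sup>2 \<le> \<xi> \<bullet> (A *v \<xi>)) \<and>
     (\<Sum>i\<in>UNIV. A $ i $ i) \<le> T \<and> (\<forall>v. norm (A *v v) \<le> T * norm v)"

lemma halfspace_estimate:
  fixes A :: "real^'n::finite^'n"
  assumes A: "elliptic_matrix c T A" and c: "0 < c" and T: "0 \<le> T"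
    and C: "has_hessian p G H" and R: "0 < R" and M: "0 < M" and mu: "0 \<le> \<mu>"
    and pM: "\<And>x. norm (x - x0) \<le> 2 * (1 + 2 * T / c) * R \<Longrightarrow> \<bar>p x\<bar> \<le> M"
    and pmu: "\<And>x. norm (x - x0) \<le> 2 * (1 + 2 * T / c) * R \<Longrightarrow> \<bar>frobenius_prod A (H x)\<bar> \<le> \<mu>"
    and h: "norm h \<le> R"
  shows "\<bar>p (x0 + h) - p x0\<bar> \<le> (2 * M + \<mu> * R\<^sup>2) * (1 + (T + 2) / c) * norm h / R"
proof -
  have A': "transpose A = A" "\<And>\<xi>. c * (norm \<xi>)\<^sup>2 \<le> \<xi> \<bullet> (A *v \<xi>)"
    "(\<Sum>i\<in>UNIV. A $ i $ i) \<le> T" "\<And>v. norm (A *v v) \<le> T * norm v"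
    using A unfolding elliptic_matrix_def by auto
  have 1: "p (x0 + h) - p x0 \<le> (2 * M + \<mu> * R\<^sup>2) * (1 + (T + 2) / c) * norm h / R"
    by (rule halfspace_estimate_upper[OF A'(1) c A'(2,3,4) T C R M mu pM pmu h])
  have "(-1) * p (x0 + h) - (-1) * p x0 \<le> (2 * M + \<mu> * R\<^sup>2) * (1 + (T + 2) / c) * norm h / R"
    by (rule halfspace_estimate_upper[OF A'(1) c A'(2,3,4) T has_hessian_cmult[OF C] R M mu _ _ h])
       (use pM pmu in \<open>simp_all only: frobenius_prod_scaleR_right, simp_all\<close>)
  then show ?thesis using 1 by linarith
qed

section \<open>Oscillation of the Hessian for a frozen operator\<close>

lemma second_difference_mean_value:
  assumes C: "has_hessian u G H"
  shows "\<exists>s t. 0 \<le> s \<and> s \<le> 1 \<and> 0 \<le> t \<and> t \<le> 1 \<and>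
    u (x + a + b) - u (x + a) - u (x + b) + u x = (a v* H (x + s *\<^sub>R a + t *\<^sub>R b)) \<bullet> b"
proof -
  have "((\<lambda>t. u (x + a + t *\<^sub>R b) - u (x + t *\<^sub>R b)) has_real_derivative
     (G (x + a + t *\<^sub>R b) \<bullet> b - G (x + t *\<^sub>R b) \<bullet> b)) (at t)" for t
    by (intro DERIV_diff has_hessian_deriv_line(1)[OF C])
  from MVT2[of 0 1, OF _ this] obtain t where t: "0 < t" "t < 1" and
    e1: "(u (x + a + b) - u (x + b)) - (u (x + a) - u x) = G (x + a + t *\<^sub>R b) \<bullet> b - G (x + t *\<^sub>R b) \<bullet> b"
    by auto
  have "((\<lambda>s. G (x + t *\<^sub>R b + s *\<^sub>R a) \<bullet> b) has_real_derivative (a v* H (x + t *\<^sub>R b + s *\<^sub>R a)) \<bullet> b) (at s)" for s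
    by (rule has_hessian_deriv_line(2)[OF C])
  from MVT2[of 0 1, OF _ this] obtain s where s: "0 < s" "s < 1" and
    e2: "G (x + t *\<^sub>R b + a) \<bullet> b - G (x + t *\<^sub>R b) \<bullet> b = (a v* H (x + t *\<^sub>R b + s *\<^sub>R a)) \<bullet> b"
    by auto
  show ?thesis
    using s t e1 e2 by (intro exI[of _ s] exI[of _ t]) (simp add: algebra_simps)
qed

lemma bilinear_form_axis: "(axis i s v* M) \<bullet> axis j t = s * t * M $ i $ j"
  for M :: "real^'n::finite^'n"
proof -
  have 1: "(axis i s v* M) $ j = s * M $ i $ j"
    unfolding vector_matrix_mult_def axis_def by (simp add: if_distrib if_distribR sum.delta mult.commute cong: if_cong)
  show ?thesis by (simp add: inner_axis 1)
qed

lemma norm_axis: "norm (axis i s :: real^'n::finite) = \<bar>s\<bar>"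
  by (simp add: norm_eq_sqrt_inner inner_axis_axis)

lemma second_difference_quotient:
  fixes u :: "real^'n::finite \<Rightarrow> real"
  assumes C: "has_hessian u G H" and s: "s > 0"
  shows "\<exists>\<xi>. norm \<xi> \<le> 2 * s \<and>
    (u (x + axis i s + axis j s) - u (x + axis i s) - u (x + axis j s) + u x) / s\<^sup>2 = H (x + \<xi>) $ i $ j"
proof -
  obtain p t where pt: "0 \<le> p" "p \<le> 1" "0 \<le> t" "t \<le> 1" and
    e: "u (x + axis i s + axis j s) - u (x + axis i s) - u (x + axis j s) + u x =
      (axis i s v* H (x + p *\<^sub>R axis i s + t *\<^sub>R axis j s)) \<bullet> axis j s"
    using second_difference_mean_value[OF C, of x "axis i s" "axis j s"] by blast
  have "norm (p *\<^sub>R axis i s + t *\<^sub>R axis j s :: real^'n) \<le> p * s + t * s"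
    using s pt norm_triangle_ineq[of "p *\<^sub>R axis i s :: real^'n" "t *\<^sub>R axis j s"] by (simp add: norm_axis)
  also have "\<dots> \<le> 1 * s + 1 * s" using pt s by (intro add_mono mult_right_mono) auto
  finally have n: "norm (p *\<^sub>R axis i s + t *\<^sub>R axis j s :: real^'n) \<le> 2 * s" by simp
  show ?thesis
    using n s unfolding e bilinear_form_axis
    by (intro exI[of _ "p *\<^sub>R axis i s + t *\<^sub>R axis j s"]) (simp add: power2_eq_square add.assoc)
qed

abbreviation hessian_holder :: "real \<Rightarrow> real \<Rightarrow> (real^'n::finite \<Rightarrow> real^'n^'n) \<Rightarrow> bool" where
  "hessian_holder \<gamma> K H \<equiv> (\<forall>x y i j. \<bar>H x $ i $ j - H y $ i $ j\<bar> \<le> K * norm (x - y) powr \<gamma>)"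

text \<open>The function \<open>w\<close> is a second difference quotient of \<open>u\<close> with step \<open>s\<close>, close to the entry \<open>(i, j)\<close> of the
Hessian, and \<open>p y = w (y + h) - w y\<close>. On a ball of radius \<open>R\<close> the half-space estimate makes \<open>p\<close> almost
constant, so \<open>n p(x)\<close> almost equals \<open>w (x + n h) - w x\<close>, which is at most \<open>K n\<^bsup>\<gamma>\<^esup>\<close>. Dividing by \<open>n\<close> leaves
\<open>K n\<^bsup>\<gamma> - 1\<^esup>\<close>; this is where \<open>\<gamma> < 1\<close> enters.\<close>

lemma hessian_oscillation_unit:
  fixes \<gamma> c T \<eta> :: real
  assumes g: "0 < \<gamma>" "\<gamma> < 1" and c: "0 < c" and T: "0 \<le> T" and eta: "0 < \<eta>"
  shows "\<exists>N\<ge>1. \<exists>C\<ge>0. \<forall>(A::real^'n::finite^'n) u G H K q x h i j.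
     elliptic_matrix c T A \<longrightarrow> has_hessian u G H \<longrightarrow> 0 < K \<longrightarrow> 0 \<le> q \<longrightarrow>
     hessian_holder \<gamma> K H \<longrightarrow>
     (\<forall>y z. norm (y - x) \<le> N \<longrightarrow> norm (z - x) \<le> N \<longrightarrow>
        \<bar>frobenius_prod A (H y) - frobenius_prod A (H z)\<bar> \<le> q) \<longrightarrow>
     norm h = 1 \<longrightarrow> \<bar>H (x + h) $ i $ j - H x $ i $ j\<bar> \<le> \<eta> * K + C * q"
proof -
  define K1 where "K1 = 1 + (T + 2) / c"
  define L where "L = 1 + 2 * T / c"
  have K1: "K1 > 0" using T c by (simp add: K1_def add_pos_nonneg)
  have L: "L \<ge> 1" using T c by (simp add: L_def)
  \<comment> \<open>The three error terms are made at most \<open>\<eta> K / 3\<close> each: the number \<open>n\<close> of steps controls \<open>K n\<^bsup>\<gamma> - 1\<^esup>\<close>, then \<open>R\<close> the variation of \<open>p\<close>, and \<open>s\<close> the distance of \<open>w\<close> from the Hessian.\<close>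
  obtain n :: nat where n: "real n \<ge> max 1 ((3 / \<eta>) powr (1 / (1 - \<gamma>)))"
    using real_arch_simple by blast
  have n1: "real n \<ge> 1" using n by simp
  have npow: "real n powr (\<gamma> - 1) \<le> \<eta> / 3"
  proof -
    have "3 / \<eta> = ((3 / \<eta>) powr (1 / (1 - \<gamma>))) powr (1 - \<gamma>)" using g eta by (simp add: powr_powr)
    also have "\<dots> \<le> real n powr (1 - \<gamma>)" using n g by (intro powr_mono2) auto
    finally have "3 / \<eta> \<le> real n powr (1 - \<gamma>)" .
    then have "inverse (real n powr (1 - \<gamma>)) \<le> inverse (3 / \<eta>)" using eta by (intro le_imp_inverse_le) auto
    moreover have "real n powr (\<gamma> - 1) = inverse (real n powr (1 - \<gamma>))"
      using powr_minus[of "real n" "1 - \<gamma>"] by simp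
    ultimately show ?thesis by simp
  qed
  define R where "R = max (real n) (6 * real n * K1 / \<eta>)"
  have R: "R \<ge> real n" "R \<ge> 1" "R > 0" using n1 by (auto simp: R_def)
  have RK: "real n * (2 * K1) / R \<le> \<eta> / 3"
  proof -
    have "6 * real n * K1 / \<eta> \<le> R" by (simp add: R_def)
    then have "6 * real n * K1 \<le> R * \<eta>" using eta by (simp add: field_simps)
    then show ?thesis using R by (simp add: field_simps)
  qed
  define s where "s = (\<eta> / 6) powr (1 / \<gamma>) / 2"
  have s: "s > 0" using eta by (simp add: s_def)
  have spow: "(2 * s) powr \<gamma> = \<eta> / 6" using g eta by (simp add: s_def powr_powr)
  \<comment> \<open>The operator applied to \<open>p\<close> involves eight translates by vectors of norm at most \<open>1 + 2 s\<close>.\<close>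
  define N where "N = 2 * L * R + 1 + 2 * s"
  define C where "C = real n * K1 * R * 4 / s\<^sup>2"
  have "2 * L * R \<ge> 0" using L R by simp
  then have N1: "N \<ge> 1" using s by (simp add: N_def)
  have C0: "C \<ge> 0" using K1 R by (simp add: C_def)
  have main: "\<bar>H (x + h) $ i $ j - H x $ i $ j\<bar> \<le> \<eta> * K + C * q"
    if A: "elliptic_matrix c T A" and u: "has_hessian u G H" and K: "0 < K" and q: "0 \<le> q"
      and HK: "\<And>x y i j. \<bar>H x $ i $ j - H y $ i $ j\<bar> \<le> K * norm (x - y) powr \<gamma>"
      and f: "\<And>y z. norm (y - x) \<le> N \<Longrightarrow> norm (z - x) \<le> N \<Longrightarrow>
        \<bar>frobenius_prod A (H y) - frobenius_prod A (H z)\<bar> \<le> q"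
      and h: "norm h = 1"
    for A :: "real^'n::finite^'n" and u G H K q x h i j
  proof -
    define a where "a = (axis i s :: real^'n)"
    define b where "b = (axis j s :: real^'n)"
    define w where "w y = (1 / s\<^sup>2) * ((u (a + b + y) - u (a + y)) - (u (b + y) - u y))" for y
    define Hw where "Hw y = (1 / s\<^sup>2) *\<^sub>R ((H (a + b + y) - H (a + y)) - (H (b + y) - H y))" for y
    obtain Gw where w: "has_hessian w Gw Hw"
      using has_hessian_cmult[OF has_hessian_diff[OF has_hessian_diff[OF has_hessian_translate[OF u, of "a+b"] has_hessian_translate[OF u, of a]] has_hessian_diff[OF has_hessian_translate[OF u, of b] u]], of "1 / s\<^sup>2"]
      unfolding w_def[abs_def] Hw_def[abs_def] by blast
    have w_near: "\<bar>w y - H y $ i $ j\<bar> \<le> K * (2 * s) powr \<gamma>" for y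
    proof -
      obtain \<xi> where x: "norm \<xi> \<le> 2 * s" "(u (y + a + b) - u (y + a) - u (y + b) + u y) / s\<^sup>2 = H (y + \<xi>) $ i $ j"
        using second_difference_quotient[OF u s, of y i j] unfolding a_def b_def by blast
      moreover have "w y = (u (y + a + b) - u (y + a) - u (y + b) + u y) / s\<^sup>2"
        using s by (simp add: w_def field_simps)
      ultimately have "w y = H (y + \<xi>) $ i $ j" by simp
      with x(1) have "\<bar>w y - H y $ i $ j\<bar> \<le> K * norm \<xi> powr \<gamma>" using HK[of "y + \<xi>" i j y] by simp
      also have "\<dots> \<le> K * (2 * s) powr \<gamma>" using x(1) g K by (intro mult_left_mono powr_mono2) auto
      finally show ?thesis .
    qed
    have w_hoelder: "\<bar>w y - w z\<bar> \<le> K * norm (y - z) powr \<gamma>" for y z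
    proof -
      have d: "has_hessian (\<lambda>e. u (y + e) - u (z + e)) (\<lambda>e. G (y + e) - G (z + e)) (\<lambda>e. H (y + e) - H (z + e))"
        by (intro has_hessian_diff has_hessian_translate u)
      obtain \<xi> where "((u (y + (0 + a + b)) - u (z + (0 + a + b))) - (u (y + (0 + a)) - u (z + (0 + a))) - (u (y + (0 + b)) - u (z + (0 + b))) + (u (y + 0) - u (z + 0))) / s\<^sup>2
          = (H (y + (0 + \<xi>)) - H (z + (0 + \<xi>))) $ i $ j"
        using second_difference_quotient[OF d s, of 0 i j] unfolding a_def b_def by blast
      moreover have "w y - w z = ((u (y + (0 + a + b)) - u (z + (0 + a + b))) - (u (y + (0 + a)) - u (z + (0 + a))) - (u (y + (0 + b)) - u (z + (0 + b))) + (u (y + 0) - u (z + 0))) / s\<^sup>2"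
        by (simp add: w_def add_ac diff_divide_distrib add_divide_distrib)
      ultimately have "w y - w z = H (y + \<xi>) $ i $ j - H (z + \<xi>) $ i $ j" by simp
      then show ?thesis using HK[of "y + \<xi>" i j "z + \<xi>"] by simp
    qed
    define p where "p y = w (h + y) - w y" for y
    define Hp where "Hp y = Hw (h + y) - Hw y" for y
    obtain Gp where p: "has_hessian p Gp Hp"
      using has_hessian_diff[OF has_hessian_translate[OF w, of h] w]
      unfolding p_def[abs_def] Hp_def[abs_def] by blast
    have pK: "\<bar>p y\<bar> \<le> K" for y using w_hoelder[of "h + y" y] h by (simp add: p_def)
    have nab: "norm a = s" "norm b = s" using s by (auto simp: a_def b_def norm_axis)
    have pmu: "\<bar>frobenius_prod A (Hp y)\<bar> \<le> 4 * q / s\<^sup>2" if y: "norm (y - x) \<le> 2 * (1 + 2 * T / c) * R" for y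
    proof -
      have near: "norm (k + y - x) \<le> N" if "norm k \<le> 1 + 2 * s" for k
        using norm_triangle_ineq[of k "y - x"] that y unfolding N_def L_def by (simp add: add_diff_eq)
      have k: "norm (a + b) \<le> 2 * s" "norm a \<le> 2 * s" "norm b \<le> 2 * s" "norm (0::real^'n) \<le> 2 * s"
        using nab s norm_triangle_ineq[of a b] by auto
      have k2: "norm (k + h) \<le> 1 + 2 * s" "norm k \<le> 1 + 2 * s" if "norm k \<le> 2 * s" for k
        using that h norm_triangle_ineq[of k h] by auto
      have fd: "\<bar>frobenius_prod A (H (k + h + y)) - frobenius_prod A (H (k + y))\<bar> \<le> q" if "norm k \<le> 2 * s" for k
        using f near k2 that by blast
      have "frobenius_prod A (Hp y) = (1 / s\<^sup>2) *
         ((frobenius_prod A (H ((a + b) + h + y)) - frobenius_prod A (H ((a + b) + y)))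
         - (frobenius_prod A (H (a + h + y)) - frobenius_prod A (H (a + y)))
         - (frobenius_prod A (H (b + h + y)) - frobenius_prod A (H (b + y)))
         + (frobenius_prod A (H (0 + h + y)) - frobenius_prod A (H (0 + y))))"
        unfolding Hp_def Hw_def frobenius_prod_diff_right frobenius_prod_scaleR_right
        by (simp add: add_ac diff_divide_distrib add_divide_distrib)
      also have "\<bar>\<dots>\<bar> \<le> (1 / s\<^sup>2) * (4 * q)"
        unfolding abs_mult using fd[OF k(1)] fd[OF k(2)] fd[OF k(3)] fd[OF k(4)]
        by (intro mult_mono) auto
      finally show ?thesis by simp
    qed
    define Q where "Q = (2 * K + 4 * q / s\<^sup>2 * R\<^sup>2) * K1 / R"
    have Q0: "Q \<ge> 0" using K q K1 R by (simp add: Q_def)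
    have step: "\<bar>p (x + real k *\<^sub>R h) - p x\<bar> \<le> real n * Q" if "k < n" for k
    proof -
      have "\<bar>p (x + real k *\<^sub>R h) - p x\<bar> \<le> (2 * K + 4 * q / s\<^sup>2 * R\<^sup>2) * (1 + (T + 2) / c) * norm (real k *\<^sub>R h) / R"
        by (rule halfspace_estimate[OF A c T p]) (use R K q pK pmu h that in auto)
      also have "\<dots> = Q * real k" using h by (simp add: Q_def K1_def)
      also have "\<dots> \<le> Q * real n" using that Q0 by (intro mult_left_mono) auto
      finally show ?thesis by (simp add: mult.commute)
    qed
    have "real n * \<bar>p x\<bar> \<le> K * real n powr \<gamma> + real n * (real n * Q)"
    proof -
      have "(\<Sum>k<n. p (x + real k *\<^sub>R h)) = (\<Sum>k<n. w (x + real (Suc k) *\<^sub>R h) - w (x + real k *\<^sub>R h))"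
        by (intro sum.cong) (auto simp: p_def algebra_simps)
      also have "\<dots> = w (x + real n *\<^sub>R h) - w x"
        using sum_lessThan_telescope[of "\<lambda>k. w (x + real k *\<^sub>R h)" n] by simp
      finally have tel: "(\<Sum>k<n. p (x + real k *\<^sub>R h)) = w (x + real n *\<^sub>R h) - w x" .
      have "\<bar>w (x + real n *\<^sub>R h) - w x\<bar> \<le> K * real n powr \<gamma>"
        using w_hoelder[of "x + real n *\<^sub>R h" x] h by simp
      moreover have "\<bar>\<Sum>k<n. (p (x + real k *\<^sub>R h) - p x)\<bar> \<le> (\<Sum>k<n. real n * Q)"
        by (rule order_trans[OF sum_abs]) (intro sum_mono step, simp)
      moreover have "real n * p x = (\<Sum>k<n. p (x + real k *\<^sub>R h)) - (\<Sum>k<n. (p (x + real k *\<^sub>R h) - p x))"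
        by (simp add: sum_subtractf)
      ultimately show ?thesis using tel by (simp add: abs_mult[symmetric, of "real n", simplified] abs_le_iff)
    qed
    then have "\<bar>p x\<bar> \<le> K * real n powr \<gamma> / real n + real n * Q"
      using n1 by (simp add: field_simps)
    also have "K * real n powr \<gamma> / real n = K * real n powr (\<gamma> - 1)"
      using n1 by (simp add: powr_diff)
    also have "\<dots> \<le> K * (\<eta> / 3)" using npow K by (intro mult_left_mono) auto
    also have "real n * Q = K * (real n * (2 * K1) / R) + C * q"
      using R s unfolding Q_def C_def by (simp add: field_simps power2_eq_square)
    also have "\<dots> \<le> K * (\<eta> / 3) + C * q" using RK K by (intro add_right_mono mult_left_mono) auto
    finally have px: "\<bar>p x\<bar> \<le> K * (\<eta> / 3) + (K * (\<eta> / 3) + C * q)" by simp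
    have "\<bar>w x - H x $ i $ j\<bar> \<le> K * (\<eta> / 6)" "\<bar>w (x + h) - H (x + h) $ i $ j\<bar> \<le> K * (\<eta> / 6)"
      using w_near spow by metis+
    moreover have "K * (\<eta> / 3) = \<eta> * K / 3" "K * (\<eta> / 6) = \<eta> * K / 6" by simp_all
    ultimately show ?thesis using px unfolding p_def add.commute[of h x] by linarith
  qed
  show ?thesis
    by (rule exI[of _ N], intro conjI N1, rule exI[of _ C], intro conjI C0 allI impI, rule main) auto
qed

text \<open>Reduction to a displacement of norm one by the dilation \<open>y \<mapsto> x + \<bar>h\<bar> y\<close>.\<close>

lemma hessian_oscillation:
  fixes \<gamma> c T \<eta> :: real
  assumes g: "0 < \<gamma>" "\<gamma> < 1" and c: "0 < c" and T: "0 \<le> T" and eta: "0 < \<eta>"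
  shows "\<exists>N\<ge>1. \<exists>C\<ge>0. \<forall>(A::real^'n::finite^'n) u G H K q x h i j.
     elliptic_matrix c T A \<longrightarrow> has_hessian u G H \<longrightarrow> 0 < K \<longrightarrow> 0 \<le> q \<longrightarrow>
     hessian_holder \<gamma> K H \<longrightarrow>
     (\<forall>y z. norm (y - x) \<le> N * norm h \<longrightarrow> norm (z - x) \<le> N * norm h \<longrightarrow>
        \<bar>frobenius_prod A (H y) - frobenius_prod A (H z)\<bar> \<le> q) \<longrightarrow>
     \<bar>H (x + h) $ i $ j - H x $ i $ j\<bar> \<le> \<eta> * K * norm h powr \<gamma> + C * q"
proof -
  obtain N C where N: "N \<ge> 1" and C: "C \<ge> 0" and
    osc: "\<And>(A::real^'n^'n) u G H K q x h i j. elliptic_matrix c T A \<Longrightarrow> has_hessian u G H \<Longrightarrow> 0 < K \<Longrightarrow> 0 \<le> q \<Longrightarrow>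
     hessian_holder \<gamma> K H \<Longrightarrow>
     (\<forall>y z. norm (y - x) \<le> N \<longrightarrow> norm (z - x) \<le> N \<longrightarrow>
        \<bar>frobenius_prod A (H y) - frobenius_prod A (H z)\<bar> \<le> q) \<Longrightarrow>
     norm h = 1 \<Longrightarrow> \<bar>H (x + h) $ i $ j - H x $ i $ j\<bar> \<le> \<eta> * K + C * q"
    using hessian_oscillation_unit[OF assms, where 'n='n] by metis
  have main: "\<bar>H (x + h) $ i $ j - H x $ i $ j\<bar> \<le> \<eta> * K * norm h powr \<gamma> + C * q"
    if A: "elliptic_matrix c T A" and u: "has_hessian u G H" and K: "0 < K" and q: "0 \<le> q"
      and HK: "\<And>x y i j. \<bar>H x $ i $ j - H y $ i $ j\<bar> \<le> K * norm (x - y) powr \<gamma>"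
      and f: "\<And>y z. norm (y - x) \<le> N * norm h \<Longrightarrow> norm (z - x) \<le> N * norm h \<Longrightarrow>
        \<bar>frobenius_prod A (H y) - frobenius_prod A (H z)\<bar> \<le> q"
    for A :: "real^'n::finite^'n" and u G H K q x h i j
  proof (cases "h = 0")
    case True
    then show ?thesis using C q by simp
  next
    case False
    define \<rho> where "\<rho> = norm h"
    have r: "\<rho> > 0" using False by (simp add: \<rho>_def)
    have "\<bar>(\<rho>\<^sup>2 *\<^sub>R H (x + \<rho> *\<^sub>R (0 + (1/\<rho>) *\<^sub>R h))) $ i $ j - (\<rho>\<^sup>2 *\<^sub>R H (x + \<rho> *\<^sub>R 0)) $ i $ j\<bar>
        \<le> \<eta> * (\<rho>\<^sup>2 * \<rho> powr \<gamma> * K) + C * (\<rho>\<^sup>2 * q)"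
    proof (rule osc[OF A has_hessian_dilate[OF u, of x \<rho>]]; (intro allI impI)?)
      show "0 < \<rho>\<^sup>2 * \<rho> powr \<gamma> * K" "0 \<le> \<rho>\<^sup>2 * q" "norm ((1/\<rho>) *\<^sub>R h) = 1"
        using r K q by (auto simp: \<rho>_def)
      show "\<bar>(\<rho>\<^sup>2 *\<^sub>R H (x + \<rho> *\<^sub>R y)) $ i $ j - (\<rho>\<^sup>2 *\<^sub>R H (x + \<rho> *\<^sub>R z)) $ i $ j\<bar> \<le> \<rho>\<^sup>2 * \<rho> powr \<gamma> * K * norm (y - z) powr \<gamma>" for y z i j
      proof -
        have "\<bar>(\<rho>\<^sup>2 *\<^sub>R H (x + \<rho> *\<^sub>R y)) $ i $ j - (\<rho>\<^sup>2 *\<^sub>R H (x + \<rho> *\<^sub>R z)) $ i $ j\<bar> = \<rho>\<^sup>2 * \<bar>H (x + \<rho> *\<^sub>R y) $ i $ j - H (x + \<rho> *\<^sub>R z) $ i $ j\<bar>"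
          by (simp add: abs_mult flip: right_diff_distrib)
        also have "\<dots> \<le> \<rho>\<^sup>2 * (K * norm (\<rho> *\<^sub>R (y - z)) powr \<gamma>)"
          using HK[of "x + \<rho> *\<^sub>R y" i j "x + \<rho> *\<^sub>R z"] by (intro mult_left_mono) (auto simp: scaleR_diff_right)
        also have "\<dots> = \<rho>\<^sup>2 * \<rho> powr \<gamma> * K * norm (y - z) powr \<gamma>" using r by (simp add: powr_mult)
        finally show ?thesis .
      qed
      show "\<bar>frobenius_prod A (\<rho>\<^sup>2 *\<^sub>R H (x + \<rho> *\<^sub>R y)) - frobenius_prod A (\<rho>\<^sup>2 *\<^sub>R H (x + \<rho> *\<^sub>R z))\<bar> \<le> \<rho>\<^sup>2 * q"
        if "norm (y - 0) \<le> N" "norm (z - 0) \<le> N" for y z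
      proof -
        have "norm (x + \<rho> *\<^sub>R y - x) \<le> N * norm h" "norm (x + \<rho> *\<^sub>R z - x) \<le> N * norm h"
          using that r by (auto simp: \<rho>_def mult.commute mult_right_mono)
        from f[OF this] show ?thesis
          by (simp add: frobenius_prod_scaleR_right abs_mult mult_left_mono flip: right_diff_distrib)
      qed
    qed
    also have "\<bar>(\<rho>\<^sup>2 *\<^sub>R H (x + \<rho> *\<^sub>R (0 + (1/\<rho>) *\<^sub>R h))) $ i $ j - (\<rho>\<^sup>2 *\<^sub>R H (x + \<rho> *\<^sub>R 0)) $ i $ j\<bar>
        = \<rho>\<^sup>2 * \<bar>H (x + h) $ i $ j - H x $ i $ j\<bar>"
      using r by (simp add: abs_mult flip: right_diff_distrib)
    also have "\<eta> * (\<rho>\<^sup>2 * \<rho> powr \<gamma> * K) + C * (\<rho>\<^sup>2 * q) = \<rho>\<^sup>2 * (\<eta> * K * norm h powr \<gamma> + C * q)"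
      by (simp add: \<rho>_def algebra_simps)
    finally show ?thesis using r by simp
  qed
  show ?thesis
    by (rule exI[of _ N], intro conjI N, rule exI[of _ C], intro conjI C allI impI, rule main) auto
qed

section \<open>The fractional Laplacian\<close>

text \<open>A substitute for polar coordinates: \<open>\<bar>f\<bar>\<close> is dominated by the sum over \<open>k\<close> of \<open>c k\<close> times the indicator of
the ball of radius \<open>r k\<close>, and the volumes of balls are known.\<close>

lemma integrable_dyadic_majorant:
  fixes f :: "real^'n::finite \<Rightarrow> real" and c r :: "nat \<Rightarrow> real"
  assumes f: "f \<in> borel_measurable lborel"
    and c: "\<And>k. 0 \<le> c k" and r: "\<And>k. 0 \<le> r k"
    and sum: "summable (\<lambda>k. c k * r k ^ CARD('n))"
    and maj: "\<And>z. f z \<noteq> 0 \<Longrightarrow> \<exists>k. norm z \<le> r k \<and> \<bar>f z\<bar> \<le> c k"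
  shows "integrable lborel f"
proof (rule integrableI_bounded[OF f])
  have "(\<integral>\<^sup>+z. ennreal (norm (f z)) \<partial>lborel)
      \<le> (\<integral>\<^sup>+z. (\<Sum>k. ennreal (c k) * indicator (cball 0 (r k)) (z :: real^'n)) \<partial>lborel)"
  proof (rule nn_integral_mono)
    fix z :: "real^'n"
    show "ennreal (norm (f z)) \<le> (\<Sum>k. ennreal (c k) * indicator (cball 0 (r k)) z)"
    proof (cases "f z = 0")
      case False
      then obtain k where k: "norm z \<le> r k" "\<bar>f z\<bar> \<le> c k" using maj by blast
      have "ennreal (norm (f z)) \<le> ennreal (c k) * indicator (cball 0 (r k)) z"
        using k by (simp add: ennreal_leI)
      also have "\<dots> \<le> (\<Sum>k. ennreal (c k) * indicator (cball 0 (r k)) z)"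
      proof -
        define g where "g k = ennreal (c k) * indicator (cball 0 (r k)) z" for k
        have "sum g {k} \<le> suminf g" by (intro sum_le_suminf) auto
        then have "g k \<le> suminf g" by simp
        then show ?thesis unfolding g_def .
      qed
      finally show ?thesis .
    qed simp
  qed
  also have "\<dots> = (\<Sum>k. ennreal (c k) * emeasure lborel (cball (0::real^'n) (r k)))"
  proof -
    have m: "(\<lambda>z. ennreal (c k) * indicator (cball 0 (r k)) (z :: real^'n)) \<in> borel_measurable lborel" for k
    proof -
      have [measurable]: "cball (0 :: real^'n) (r k) \<in> sets borel" by simp
      show ?thesis by measurable
    qed
    show ?thesis by (subst nn_integral_suminf[OF m]) (simp add: nn_integral_cmult_indicator)
  qed
  also have "\<dots> = (\<Sum>k. ennreal (unit_ball_vol CARD('n) * (c k * r k ^ CARD('n))))"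
    using c r by (simp add: emeasure_cball ennreal_mult' [symmetric] mult_ac)
  also have "\<dots> < \<infinity>"
  proof -
    have "(\<Sum>k. ennreal (unit_ball_vol CARD('n) * (c k * r k ^ CARD('n)))) \<noteq> top"
      using c r by (intro ennreal_suminf_neq_top summable_mult sum mult_nonneg_nonneg zero_le_power) auto
    then show ?thesis by (simp add: less_top)
  qed
  finally show "(\<integral>\<^sup>+z. ennreal (norm (f z)) \<partial>lborel) < \<infinity>" .
qed

lemma summable_two_powr_neg: "s > 0 \<Longrightarrow> summable (\<lambda>k. ((2::real) powr (- s)) ^ k)"
  by (rule summable_geometric) (simp add: powr_minus_divide)

text \<open>On the shell where \<open>2\<^bsup>-k-1\<^esup> < \<bar>z\<bar> \<le> 2\<^bsup>-k\<^esup>\<close> the integrand times the volume is of order \<open>2\<^bsup>-ks\<^esup>\<close>.\<close>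

lemma integrable_near_kernel:
  fixes s :: real
  assumes "0 < s" "s \<le> CARD('n::finite)"
  shows "integrable lborel (\<lambda>z::real^'n. indicator (cball 0 1) z * norm z powr (s - CARD('n)))"
proof (rule integrable_dyadic_majorant[where r = "\<lambda>k. (1/2) ^ k" and c = "\<lambda>k. ((1/2) ^ Suc k) powr (s - CARD('n))"])
  let ?d = "CARD('n)"
  have geo: "((1/2) ^ Suc k) powr (s - ?d) * ((1/2) ^ k) ^ ?d = 2 powr (?d - s) * (2 powr (- s)) ^ k" for k
  proof -
    have e: "(1/2::real) ^ m = 2 powr (- real m)" for m
      by (simp add: powr_minus_divide powr_realpow power_one_over)
    have "((1/2) ^ Suc k) powr (s - ?d) * ((1/2) ^ k) ^ ?d = 2 powr (- real (Suc k) * (s - ?d) + - real (k * ?d))"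
      unfolding power_mult[symmetric] unfolding e powr_powr powr_add[symmetric] by (rule refl)
    also have "- real (Suc k) * (s - ?d) + - real (k * ?d) = (?d - s) + (- s) * real k"
      by (simp add: algebra_simps)
    also have "2 powr \<dots> = 2 powr (?d - s) * (2 powr (- s)) ^ k"
      unfolding powr_add powr_powr[symmetric] by (simp add: powr_realpow)
    finally show ?thesis .
  qed
  show "summable (\<lambda>k. ((1/2) ^ Suc k) powr (s - ?d) * ((1/2) ^ k) ^ ?d)"
    unfolding geo by (rule summable_mult[OF summable_two_powr_neg[OF assms(1)]])
  have [measurable]: "cball (0 :: real^'n) 1 \<in> sets borel" by simp
  show "(\<lambda>z::real^'n. indicator (cball 0 1) z * norm z powr (s - CARD('n))) \<in> borel_measurable lborel"
    by measurable
  fix z :: "real^'n"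
  assume "indicator (cball 0 1) z * norm z powr (s - ?d) \<noteq> 0"
  then have z: "norm z \<le> 1" "0 < norm z" by (auto simp: indicator_def split: if_splits)
  define k where "k = (LEAST k. (1/2) ^ Suc k < norm z)"
  obtain m where "(1/2) ^ m < norm z" using z real_arch_pow_inv[of "norm z" "1/2"] by auto
  moreover have "(1/2::real) ^ Suc m \<le> (1/2) ^ m" by (rule power_decreasing) auto
  ultimately have "(1/2) ^ Suc m < norm z" by linarith
  then have k1: "(1/2) ^ Suc k < norm z" unfolding k_def by (rule LeastI)
  have k2: "norm z \<le> (1/2) ^ k"
  proof (cases k)
    case (Suc j)
    then have "j < k" by simp
    then have "\<not> (1/2) ^ Suc j < norm z" unfolding k_def by (rule not_less_Least)
    then show ?thesis using Suc by simp
  qed (use z in simp)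
  have "\<bar>indicator (cball 0 1) z * norm z powr (s - ?d)\<bar> \<le> ((1/2) ^ Suc k) powr (s - ?d)"
    using z k1 assms powr_mono2'[of "s - ?d" "(1/2) ^ Suc k" "norm z"] by auto
  then show "\<exists>k. norm z \<le> (1/2) ^ k \<and> \<bar>indicator (cball 0 1) z * norm z powr (s - ?d)\<bar> \<le> ((1/2) ^ Suc k) powr (s - ?d)"
    using k2 by blast
qed auto

lemma integrable_far_kernel:
  fixes s \<delta> :: real
  assumes "0 < s" "0 < \<delta>"
  shows "integrable lborel (\<lambda>z::real^'n::finite. indicator {z. \<delta> < norm z} z * norm z powr (- (s + CARD('n))))"
proof (rule integrable_dyadic_majorant[where r = "\<lambda>k. \<delta> * 2 ^ Suc k" and c = "\<lambda>k. (\<delta> * 2 ^ k) powr (- (s + CARD('n)))"])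
  let ?d = "CARD('n)"
  have geo: "(\<delta> * 2 ^ k) powr (- (s + ?d)) * (\<delta> * 2 ^ Suc k) ^ ?d = (\<delta> powr (- s) * 2 ^ ?d) * (2 powr (- s)) ^ k" for k
  proof -
    have "(\<delta> * 2 ^ k) powr (- (s + ?d)) = (\<delta> * 2 ^ k) powr (- s) / (\<delta> * 2 ^ k) ^ ?d"
      using assms by (simp add: powr_diff powr_realpow)
    moreover have "(\<delta> * 2 ^ k) powr (- s) = \<delta> powr (- s) * (2 powr (- s)) ^ k"
      using assms by (simp add: powr_mult powr_powr powr_realpow[symmetric] mult.commute)
    ultimately show ?thesis using assms by (simp add: power_mult_distrib)
  qed
  show "summable (\<lambda>k. (\<delta> * 2 ^ k) powr (- (s + ?d)) * (\<delta> * 2 ^ Suc k) ^ ?d)"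
    unfolding geo by (rule summable_mult[OF summable_two_powr_neg[OF assms(1)]])
  show "(\<lambda>z::real^'n. indicator {z. \<delta> < norm z} z * norm z powr (- (s + CARD('n)))) \<in> borel_measurable lborel"
    by measurable
  fix z :: "real^'n"
  assume "indicator {z. \<delta> < norm z} z * norm z powr (- (s + ?d)) \<noteq> 0"
  then have z: "\<delta> < norm z" by (auto simp: indicator_def split: if_splits)
  define k where "k = (LEAST k. norm z \<le> \<delta> * 2 ^ Suc k)"
  obtain m where "norm z / \<delta> < 2 ^ m" using real_arch_pow[of 2 "norm z / \<delta>"] by auto
  then have "norm z \<le> \<delta> * 2 ^ m" using assms by (simp add: field_simps)
  also have "\<dots> \<le> \<delta> * 2 ^ Suc m" using assms by (intro mult_left_mono power_increasing) auto
  finally have "norm z \<le> \<delta> * 2 ^ Suc m" .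
  then have k1: "norm z \<le> \<delta> * 2 ^ Suc k" unfolding k_def by (rule LeastI)
  have k2: "\<delta> * 2 ^ k \<le> norm z"
  proof (cases k)
    case (Suc j)
    then have "j < k" by simp
    then have "\<not> norm z \<le> \<delta> * 2 ^ Suc j" unfolding k_def by (rule not_less_Least)
    then show ?thesis using Suc by simp
  qed (use z in simp)
  have "\<bar>indicator {z. \<delta> < norm z} z * norm z powr (- (s + ?d))\<bar> \<le> (\<delta> * 2 ^ k) powr (- (s + ?d))"
    using z k2 assms powr_mono2'[of "- (s + ?d)" "\<delta> * 2 ^ k" "norm z"] by auto
  then show "\<exists>k. norm z \<le> \<delta> * 2 ^ Suc k \<and> \<bar>indicator {z. \<delta> < norm z} z * norm z powr (- (s + ?d))\<bar> \<le> (\<delta> * 2 ^ k) powr (- (s + ?d))"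
    using k1 by blast
qed (use assms in auto)

text \<open>The integral is split at a small radius \<open>\<rho>\<close>. Inside, the quadratic bound leaves the integrable
kernel \<open>\<bar>z\<bar>\<^bsup>2 - 2\<alpha> - d\<^esup>\<close>, from which the factor \<open>\<rho>\<^bsup>1 - \<alpha>\<^esup>\<close> can be taken out and made small; outside, the uniform
bound is integrated against a kernel without singularity.\<close>

lemma singular_integral_estimate:
  fixes \<alpha> \<eta> :: real
  assumes al: "0 < \<alpha>" "\<alpha> < 1" and eta: "0 < \<eta>"
  shows "\<exists>C\<ge>0. \<forall>(f :: real^'n::finite \<Rightarrow> real) P Q. f \<in> borel_measurable lborel \<longrightarrow>
     (\<forall>z. \<bar>f z\<bar> \<le> P * (norm z)\<^sup>2) \<longrightarrow> (\<forall>z. \<bar>f z\<bar> \<le> Q) \<longrightarrow> 0 \<le> P \<longrightarrow>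
     integrable lborel (\<lambda>z. f z / norm z powr (real CARD('n) + 2 * \<alpha>)) \<and>
     \<bar>LINT z|lborel. f z / norm z powr (real CARD('n) + 2 * \<alpha>)\<bar> \<le> \<eta> * P + C * Q"
proof -
  let ?d = "real CARD('n)"
  define k1 where "k1 z = indicator (cball 0 1) z * norm z powr ((1 - \<alpha>) - ?d)" for z :: "real^'n"
  define I1 where "I1 = (LINT z|lborel. k1 z)"
  have i1: "integrable lborel k1"
  proof -
    have "1 \<le> ?d" by (simp add: Suc_le_eq)
    then have "1 - \<alpha> \<le> ?d" using al by linarith
    then show ?thesis unfolding k1_def[abs_def] using al by (intro integrable_near_kernel) auto
  qed
  have k1_nn: "k1 z \<ge> 0" for z by (simp add: k1_def)
  have I1: "I1 \<ge> 0" unfolding I1_def by (intro Bochner_Integration.integral_nonneg k1_nn)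
  define \<rho> where "\<rho> = min 1 ((\<eta> / (I1 + 1)) powr (1 / (1 - \<alpha>)))"
  have r: "0 < \<rho>" "\<rho> \<le> 1" using eta I1 by (auto simp: \<rho>_def)
  have rI: "\<rho> powr (1 - \<alpha>) * I1 \<le> \<eta>"
  proof -
    have "\<rho> powr (1 - \<alpha>) \<le> ((\<eta> / (I1 + 1)) powr (1 / (1 - \<alpha>))) powr (1 - \<alpha>)"
      using al r by (intro powr_mono2) (auto simp: \<rho>_def)
    also have "\<dots> = \<eta> / (I1 + 1)" using al eta I1 by (simp add: powr_powr)
    finally have "\<rho> powr (1 - \<alpha>) * I1 \<le> \<eta> / (I1 + 1) * (I1 + 1)" using I1 eta by (intro mult_mono) auto
    then show ?thesis using I1 by simp
  qed
  define k2 where "k2 z = indicator {z. \<rho> < norm z} z * norm z powr (- (2 * \<alpha> + ?d))" for z :: "real^'n"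
  define I2 where "I2 = (LINT z|lborel. k2 z)"
  have i2: "integrable lborel k2"
    unfolding k2_def[abs_def] using al r by (intro integrable_far_kernel) auto
  have k2_nn: "k2 z \<ge> 0" for z by (simp add: k2_def)
  have I2: "I2 \<ge> 0" unfolding I2_def by (intro Bochner_Integration.integral_nonneg k2_nn)
  have main: "integrable lborel (\<lambda>z. f z / norm z powr (?d + 2 * \<alpha>)) \<and>
     \<bar>LINT z|lborel. f z / norm z powr (?d + 2 * \<alpha>)\<bar> \<le> \<eta> * P + I2 * Q"
    if f: "f \<in> borel_measurable lborel" and P: "\<And>z. \<bar>f z\<bar> \<le> P * (norm z)\<^sup>2" and Q: "\<And>z. \<bar>f z\<bar> \<le> Q" and P0: "0 \<le> P"
    for f :: "real^'n \<Rightarrow> real" and P Q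
  proof -
    have Q0: "Q \<ge> 0" using Q[of 0] by linarith
    have bd: "\<bar>f z / norm z powr (?d + 2 * \<alpha>)\<bar> \<le> P * \<rho> powr (1 - \<alpha>) * k1 z + Q * k2 z" for z
    proof (cases "norm z \<le> \<rho>")
      case True
      show ?thesis
      proof (cases "z = 0")
        case True then show ?thesis using P0 Q0 k1_nn[of 0] k2_nn[of 0] by simp
      next
        case False
        have "\<bar>f z / norm z powr (?d + 2 * \<alpha>)\<bar> \<le> P * (norm z)\<^sup>2 / norm z powr (?d + 2 * \<alpha>)"
          using P[of z] by (simp add: divide_right_mono)
        also have "\<dots> = P * norm z powr (2 - (?d + 2 * \<alpha>))" using False by (simp add: powr_diff)
        also have "2 - (?d + 2 * \<alpha>) = (1 - \<alpha>) + ((1 - \<alpha>) - ?d)" by simp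
        also have "P * norm z powr \<dots> = P * norm z powr (1 - \<alpha>) * norm z powr ((1 - \<alpha>) - ?d)"
          unfolding powr_add by simp
        also have "\<dots> \<le> P * \<rho> powr (1 - \<alpha>) * norm z powr ((1 - \<alpha>) - ?d)"
          using True al P0 by (intro mult_right_mono mult_left_mono powr_mono2) auto
        also have "norm z powr ((1 - \<alpha>) - ?d) = k1 z" using True r by (simp add: k1_def)
        finally show ?thesis using Q0 k2_nn[of z] mult_nonneg_nonneg[of Q "k2 z"] by linarith
      qed
    next
      case False
      have "\<bar>f z / norm z powr (?d + 2 * \<alpha>)\<bar> \<le> Q / norm z powr (?d + 2 * \<alpha>)"
        using Q[of z] by (simp add: divide_right_mono)
      also have "\<dots> = Q * k2 z" using False by (simp add: k2_def powr_minus_divide add.commute powr_diff powr_add)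
      finally have "\<bar>f z / norm z powr (?d + 2 * \<alpha>)\<bar> \<le> Q * k2 z" .
      moreover have "0 \<le> P * \<rho> powr (1 - \<alpha>) * k1 z" using P0 k1_nn by (intro mult_nonneg_nonneg) auto
      ultimately show ?thesis by linarith
    qed
    have ib: "integrable lborel (\<lambda>z. P * \<rho> powr (1 - \<alpha>) * k1 z + Q * k2 z)"
      using i1 i2 by auto
    have int: "integrable lborel (\<lambda>z. f z / norm z powr (?d + 2 * \<alpha>))"
    proof (rule Bochner_Integration.integrable_bound[OF ib])
      show "(\<lambda>z. f z / norm z powr (?d + 2 * \<alpha>)) \<in> borel_measurable lborel" using f by measurable
      show "AE z in lborel. norm (f z / norm z powr (?d + 2 * \<alpha>)) \<le> norm (P * \<rho> powr (1 - \<alpha>) * k1 z + Q * k2 z)"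
        by (rule AE_I2) (metis bd abs_ge_self order_trans real_norm_def)
    qed
    have "\<bar>LINT z|lborel. f z / norm z powr (?d + 2 * \<alpha>)\<bar> \<le> (LINT z|lborel. P * \<rho> powr (1 - \<alpha>) * k1 z + Q * k2 z)"
      by (rule integral_abs_bound_integral[OF int ib bd])
    also have "\<dots> = P * \<rho> powr (1 - \<alpha>) * I1 + Q * I2"
      using i1 i2 by (simp add: I1_def I2_def)
    also have "\<dots> \<le> P * \<eta> + Q * I2" using mult_left_mono[OF rI P0] by (simp add: mult.assoc)
    finally show ?thesis using int by (simp add: mult.commute)
  qed
  show ?thesis by (rule exI[of _ I2]) (use I2 main in blast)
qed

definition second_diff :: "(real^'n::finite \<Rightarrow> real) \<Rightarrow> real^'n \<Rightarrow> real^'n \<Rightarrow> real" where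
  "second_diff u x z = 2 * u x - u (x + z) - u (x - z)"

lemma bilinear_form_bound:
  fixes M :: "real^'n::finite^'n"
  assumes "\<And>i j. \<bar>M $ i $ j\<bar> \<le> P"
  shows "\<bar>(z v* M) \<bullet> z\<bar> \<le> P * (real CARD('n))\<^sup>2 * (norm z)\<^sup>2"
proof -
  have P: "P \<ge> 0" using assms[of undefined undefined] by linarith
  have "\<bar>(z v* M) \<bullet> z\<bar> \<le> (\<Sum>i\<in>UNIV. \<Sum>j\<in>UNIV. \<bar>z $ i * z $ j * M $ i $ j\<bar>)"
    unfolding bilinear_form_expand by (rule order_trans[OF sum_abs]) (intro sum_mono sum_abs)
  also have "\<dots> \<le> (\<Sum>i\<in>(UNIV::'n set). \<Sum>j\<in>(UNIV::'n set). norm z * norm z * P)"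
    unfolding abs_mult by (intro sum_mono mult_mono component_le_norm_cart assms) auto
  also have "\<dots> = P * (real CARD('n))\<^sup>2 * (norm z)\<^sup>2" by (simp add: power2_eq_square)
  finally show ?thesis .
qed

lemma second_diff_hessian_bound:
  fixes u :: "real^'n::finite \<Rightarrow> real"
  assumes "has_hessian u G H" "\<And>x i j. \<bar>H x $ i $ j\<bar> \<le> P"
  shows "\<bar>second_diff u x z\<bar> \<le> P * (real CARD('n))\<^sup>2 * (norm z)\<^sup>2"
proof -
  obtain s t where "u ((x - z) + z + z) - u ((x - z) + z) - u ((x - z) + z) + u (x - z)
     = (z v* H ((x - z) + s *\<^sub>R z + t *\<^sub>R z)) \<bullet> z"
    using second_difference_mean_value[OF assms(1), of "x - z" z z] by blast
  then have "second_diff u x z = - ((z v* H ((x - z) + s *\<^sub>R z + t *\<^sub>R z)) \<bullet> z)"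
    by (simp add: second_diff_def)
  then show ?thesis using bilinear_form_bound[OF assms(2)] by simp
qed

lemma lborel_isometry:
  fixes x :: "'a::euclidean_space"
  assumes "c = 1 \<or> c = -1"
  shows "distr lborel borel (\<lambda>z. x + c *\<^sub>R z) = lborel"
  using lborel_affine[of c x] assms by (auto simp: density_1)

text \<open>Averaging the substitutions \<open>y = x + z\<close> and \<open>y = x - z\<close> cancels the first order term of \<open>u\<close>. The
remaining integrand is absolutely integrable, and dominated convergence removes the truncation.\<close>

lemma frac_laplacian_second_diff:
  fixes u :: "real^'n::finite \<Rightarrow> real"
  assumes al: "0 < \<alpha>" "\<alpha> < 1" and C: "has_hessian u G H" and P: "\<And>x i j. \<bar>H x $ i $ j\<bar> \<le> P"
    and S: "\<And>x. \<bar>u x\<bar> \<le> S"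
  shows "frac_laplacian \<alpha> u x = frac_laplacian_const CARD('n) \<alpha> / 2 *
       (LINT z|lborel. second_diff u x z / norm z powr (real CARD('n) + 2 * \<alpha>))"
    and "integrable lborel (\<lambda>z. second_diff u x z / norm z powr (real CARD('n) + 2 * \<alpha>))"
proof -
  let ?a = "real CARD('n) + 2 * \<alpha>"
  define q where "q z = second_diff u x z / norm z powr ?a" for z
  have um[measurable]: "u \<in> borel_measurable borel"
    by (rule borel_measurable_continuous_onI[OF has_hessian_continuous[OF C]])
  have P0: "P \<ge> 0" using P[of 0 undefined undefined] by linarith
  have sd4: "\<bar>second_diff u x z\<bar> \<le> 4 * S" for z
    using S[of x] S[of "x + z"] S[of "x - z"] unfolding second_diff_def by linarith
  have sdm[measurable]: "second_diff u x \<in> borel_measurable borel"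
    unfolding second_diff_def[abs_def] by measurable
  show iq: "integrable lborel (\<lambda>z. second_diff u x z / norm z powr ?a)"
  proof -
    have est: "\<exists>C\<ge>0. \<forall>(f :: real^'n \<Rightarrow> real) P Q. f \<in> borel_measurable lborel \<longrightarrow> (\<forall>z. \<bar>f z\<bar> \<le> P * (norm z)\<^sup>2) \<longrightarrow>
        (\<forall>z. \<bar>f z\<bar> \<le> Q) \<longrightarrow> 0 \<le> P \<longrightarrow> integrable lborel (\<lambda>z. f z / norm z powr ?a) \<and>
        \<bar>LINT z|lborel. f z / norm z powr ?a\<bar> \<le> 1 * P + C * Q"
      by (rule singular_integral_estimate[OF al zero_less_one])
    have sdm': "second_diff u x \<in> borel_measurable lborel" by simp
    have P': "\<forall>z. \<bar>second_diff u x z\<bar> \<le> (P * (real CARD('n))\<^sup>2) * (norm z)\<^sup>2"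
      using second_diff_hessian_bound[OF C P] by blast
    have "0 \<le> P * (real CARD('n))\<^sup>2" using P0 by simp
    then show ?thesis using est sdm' P' sd4 by blast
  qed
  then have iq: "integrable lborel q" by (simp add: q_def[abs_def])
  define h where "h \<delta> y = indicator {y. \<delta> < norm (x - y)} y * ((u x - u y) / norm (x - y) powr ?a)" for \<delta> y
  have hm[measurable]: "h \<delta> \<in> borel_measurable borel" for \<delta>
    unfolding h_def[abs_def] by measurable
  have half: "(LINT y|lborel. h \<delta> y) = (1/2) * (LINT z|lborel. indicator {z. \<delta> < norm z} z * q z)" if d: "\<delta> > 0" for \<delta>
  proof -
    have hi: "(LINT y|lborel. h \<delta> y) = (LINT z|lborel. h \<delta> (x + c *\<^sub>R z))"
       "integrable lborel (\<lambda>z. h \<delta> (x + c *\<^sub>R z))" if "c = 1 \<or> c = -1" for c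
    proof -
      show "(LINT y|lborel. h \<delta> y) = (LINT z|lborel. h \<delta> (x + c *\<^sub>R z))"
        by (subst lborel_isometry[OF that, of x, symmetric], rule integral_distr) auto
      have n: "norm (x - (x + c *\<^sub>R z)) = norm z" for z using that by auto
      have "integrable lborel (\<lambda>z::real^'n. 2 * S * (indicator {z. \<delta> < norm z} z * norm z powr (- (2 * \<alpha> + CARD('n)))))"
        using al d by (intro integrable_mult_right integrable_far_kernel) auto
      then show "integrable lborel (\<lambda>z. h \<delta> (x + c *\<^sub>R z))"
      proof (rule Bochner_Integration.integrable_bound)
        show "AE z in lborel. norm (h \<delta> (x + c *\<^sub>R z)) \<le> norm (2 * S * (indicator {z. \<delta> < norm z} z * norm z powr (- (2 * \<alpha> + CARD('n)))))"
        proof (rule AE_I2)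
          fix z
          have "\<bar>u x - u (x + c *\<^sub>R z)\<bar> \<le> 2 * S" using S[of x] S[of "x + c *\<^sub>R z"] by linarith
          moreover have "norm z powr (- (2 * \<alpha> + CARD('n))) = 1 / norm z powr ?a"
            by (simp add: powr_minus_divide[of "norm z" ?a, symmetric] add.commute)
          moreover have "h \<delta> (x + c *\<^sub>R z) = indicator {z. \<delta> < norm z} z * ((u x - u (x + c *\<^sub>R z)) / norm z powr ?a)"
            unfolding h_def indicator_def mem_Collect_eq n ..
          ultimately show "norm (h \<delta> (x + c *\<^sub>R z)) \<le> norm (2 * S * (indicator {z. \<delta> < norm z} z * norm z powr (- (2 * \<alpha> + CARD('n)))))"
            by (cases "\<delta> < norm z") (auto simp: abs_mult intro!: divide_right_mono)
        qed
      qed measurable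
    qed
    have "2 * (LINT y|lborel. h \<delta> y) = (LINT z|lborel. h \<delta> (x + 1 *\<^sub>R z)) + (LINT z|lborel. h \<delta> (x + (-1) *\<^sub>R z))"
      using hi(1)[of 1] hi(1)[of "-1"] by simp
    also have "\<dots> = (LINT z|lborel. h \<delta> (x + 1 *\<^sub>R z) + h \<delta> (x + (-1) *\<^sub>R z))"
      using hi(2)[of 1] hi(2)[of "-1"] by (intro Bochner_Integration.integral_add[symmetric]) auto
    also have "\<dots> = (LINT z|lborel. indicator {z. \<delta> < norm z} z * q z)"
      by (intro Bochner_Integration.integral_cong)
        (auto simp: h_def q_def second_diff_def indicator_def diff_divide_distrib add_divide_distrib)
    finally show ?thesis by simp
  qed
  have lim: "((\<lambda>\<delta>. LINT y|lborel. h \<delta> y) \<longlongrightarrow> (1/2) * (LINT z|lborel. q z)) (at_right 0)"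
  proof (rule tendsto_at_right_sequentially[of 0 1])
    fix X :: "nat \<Rightarrow> real" assume X: "\<And>n. 0 < X n" "X \<longlonglongrightarrow> 0"
    have "(\<lambda>n. (1/2) * (LINT z|lborel. indicator {z. X n < norm z} z * q z)) \<longlonglongrightarrow> (1/2) * (LINT z|lborel. q z)"
    proof (intro tendsto_mult_left integral_dominated_convergence[where w = "\<lambda>z. \<bar>q z\<bar>"])
      show "AE z in lborel. (\<lambda>n. indicator {z. X n < norm z} z * q z) \<longlonglongrightarrow> q z"
      proof (rule AE_I2)
        fix z
        show "(\<lambda>n. indicator {z. X n < norm z} z * q z) \<longlonglongrightarrow> q z"
        proof (cases "z = 0")
          case True then show ?thesis by (simp add: q_def)
        next
          case False
          then have "\<forall>\<^sub>F n in sequentially. X n < norm z" using X(2) order_tendstoD(2)[OF X(2), of "norm z"] by simp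
          then have "\<forall>\<^sub>F n in sequentially. indicator {z. X n < norm z} z * q z = q z"
            by eventually_elim simp
          then show ?thesis by (rule tendsto_eventually)
        qed
      qed
    qed (use iq in \<open>auto simp: indicator_def\<close>)
    then show "(\<lambda>n. LINT y|lborel. h (X n) y) \<longlonglongrightarrow> (1/2) * (LINT z|lborel. q z)"
      unfolding half[OF X(1)] .
  qed simp
  have "Lim (at_right 0) (\<lambda>\<delta>. LINT y:{y. \<delta> < norm (x - y)}|lborel. (u x - u y) / norm (x - y) powr ?a) = (1/2) * (LINT z|lborel. q z)"
    using lim by (intro tendsto_Lim) (auto simp: set_lebesgue_integral_def h_def[abs_def])
  then show "frac_laplacian \<alpha> u x = frac_laplacian_const CARD('n) \<alpha> / 2 *
       (LINT z|lborel. second_diff u x z / norm z powr ?a)"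
    unfolding frac_laplacian_def by (simp add: q_def[abs_def])
qed

lemma frac_laplacian_const_nonneg: "0 < \<alpha> \<Longrightarrow> 0 \<le> frac_laplacian_const d \<alpha>"
  unfolding frac_laplacian_const_def
  by (intro divide_nonneg_nonneg mult_nonneg_nonneg less_imp_le[OF Gamma_real_pos]) (auto simp: add_nonneg_pos)

text \<open>For functions in this class and \<open>0 < \<alpha> < 1\<close> the principal value converges at every point, so that the fractional
Laplacian acts linearly on them.\<close>

definition tame :: "(real^'n::finite \<Rightarrow> real) \<Rightarrow> (real^'n \<Rightarrow> real^'n) \<Rightarrow> (real^'n \<Rightarrow> real^'n^'n) \<Rightarrow> bool" where
  "tame u G H \<longleftrightarrow> has_hessian u G H \<and> (\<exists>S. \<forall>x. \<bar>u x\<bar> \<le> S) \<and> (\<exists>P. \<forall>x i j. \<bar>H x $ i $ j\<bar> \<le> P)"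

lemma frac_laplacian_diff:
  assumes "0 < \<alpha>" "\<alpha> < 1" "tame u G H" "tame u' G' H'"
  shows "frac_laplacian \<alpha> (\<lambda>x. u x - u' x) x = frac_laplacian \<alpha> u x - frac_laplacian \<alpha> u' x"
    and "tame (\<lambda>x. u x - u' x) (\<lambda>x. G x - G' x) (\<lambda>x. H x - H' x)"
proof -
  obtain S S' P P' where h: "has_hessian u G H" "has_hessian u' G' H'"
    and b: "\<And>x. \<bar>u x\<bar> \<le> S" "\<And>x. \<bar>u' x\<bar> \<le> S'" "\<And>x i j. \<bar>H x $ i $ j\<bar> \<le> P" "\<And>x i j. \<bar>H' x $ i $ j\<bar> \<le> P'"
    using assms(3,4) unfolding tame_def by blast
  have hd: "has_hessian (\<lambda>x. u x - u' x) (\<lambda>x. G x - G' x) (\<lambda>x. H x - H' x)" by (rule has_hessian_diff[OF h])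
  have bd: "\<bar>u x - u' x\<bar> \<le> S + S'" "\<bar>(H x - H' x) $ i $ j\<bar> \<le> P + P'" for x i j
    using b(1,2)[of x] b(3,4)[of x i j] by auto
  show "tame (\<lambda>x. u x - u' x) (\<lambda>x. G x - G' x) (\<lambda>x. H x - H' x)"
    unfolding tame_def using hd bd by blast
  note r = frac_laplacian_second_diff[OF assms(1,2)]
  have "second_diff (\<lambda>x. u x - u' x) x z / c = second_diff u x z / c - second_diff u' x z / c" for z c
    by (simp add: second_diff_def diff_divide_distrib add_divide_distrib algebra_simps)
  then show "frac_laplacian \<alpha> (\<lambda>x. u x - u' x) x = frac_laplacian \<alpha> u x - frac_laplacian \<alpha> u' x"
    unfolding r(1)[OF hd bd(2,1)] r(1)[OF h(1) b(3,1)] r(1)[OF h(2) b(4,2)]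
    by (simp add: r(2)[OF h(1) b(3,1)] r(2)[OF h(2) b(4,2)] right_diff_distrib)
qed

lemma frac_laplacian_cmult:
  assumes "0 < \<alpha>" "\<alpha> < 1" "tame u G H"
  shows "frac_laplacian \<alpha> (\<lambda>x. k * u x) x = k * frac_laplacian \<alpha> u x"
    and "tame (\<lambda>x. k * u x) (\<lambda>x. k *\<^sub>R G x) (\<lambda>x. k *\<^sub>R H x)"
proof -
  obtain S P where h: "has_hessian u G H" and b: "\<And>x. \<bar>u x\<bar> \<le> S" "\<And>x i j. \<bar>H x $ i $ j\<bar> \<le> P"
    using assms(3) unfolding tame_def by blast
  note hk = has_hessian_cmult[OF h, of k]
  have bk: "\<bar>k * u x\<bar> \<le> \<bar>k\<bar> * S" "\<bar>(k *\<^sub>R H x) $ i $ j\<bar> \<le> \<bar>k\<bar> * P" for x i j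
    using b by (auto simp: abs_mult intro!: mult_left_mono)
  show "tame (\<lambda>x. k * u x) (\<lambda>x. k *\<^sub>R G x) (\<lambda>x. k *\<^sub>R H x)"
    unfolding tame_def using hk bk by blast
  note r = frac_laplacian_second_diff[OF assms(1,2)]
  have sd: "second_diff (\<lambda>x. k * u x) x z = k * second_diff u x z" for z
    by (simp add: second_diff_def algebra_simps)
  show "frac_laplacian \<alpha> (\<lambda>x. k * u x) x = k * frac_laplacian \<alpha> u x"
    unfolding r(1)[OF hk bk(2,1)] r(1)[OF h b(2,1)] sd times_divide_eq_right[symmetric] integral_mult_right_zero by simp
qed

lemma frac_laplacian_translate:
  assumes "0 < \<alpha>" "\<alpha> < 1" "tame u G H"
  shows "frac_laplacian \<alpha> (\<lambda>y. u (a + y)) x = frac_laplacian \<alpha> u (a + x)"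
    and "tame (\<lambda>y. u (a + y)) (\<lambda>y. G (a + y)) (\<lambda>y. H (a + y))"
proof -
  obtain S P where h: "has_hessian u G H" and b: "\<And>x. \<bar>u x\<bar> \<le> S" "\<And>x i j. \<bar>H x $ i $ j\<bar> \<le> P"
    using assms(3) unfolding tame_def by blast
  note ht = has_hessian_translate[OF h, of a]
  show "tame (\<lambda>y. u (a + y)) (\<lambda>y. G (a + y)) (\<lambda>y. H (a + y))"
    unfolding tame_def using ht b by blast
  note r = frac_laplacian_second_diff[OF assms(1,2)]
  show "frac_laplacian \<alpha> (\<lambda>y. u (a + y)) x = frac_laplacian \<alpha> u (a + x)"
    unfolding r(1)[OF ht b(2,1)] r(1)[OF h b(2,1)]
    by (simp add: second_diff_def algebra_simps)
qed

abbreviation hessian_le :: "real \<Rightarrow> (real^'n::finite \<Rightarrow> real^'n^'n) \<Rightarrow> bool" where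
  "hessian_le P H \<equiv> (\<forall>x i j. \<bar>H x $ i $ j\<bar> \<le> P)"

text \<open>The Hessian may enter with an arbitrarily small weight, since the operator has order \<open>2 \<alpha> < 2\<close>.\<close>

lemma frac_laplacian_estimate:
  fixes \<alpha> \<eta> :: real
  assumes al: "0 < \<alpha>" "\<alpha> < 1" and eta: "0 < \<eta>"
  shows "\<exists>C\<ge>0. \<forall>(u :: real^'n::finite \<Rightarrow> real) G H P S x. has_hessian u G H \<longrightarrow>
     hessian_le P H \<longrightarrow> (\<forall>x. \<bar>u x\<bar> \<le> S) \<longrightarrow>
     \<bar>frac_laplacian \<alpha> u x\<bar> \<le> \<eta> * P + C * S"
proof -
  let ?c = "frac_laplacian_const CARD('n) \<alpha>" and ?d = "real CARD('n)"
  let ?a = "?d + 2 * \<alpha>"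
  have c: "?c \<ge> 0" using al by (intro frac_laplacian_const_nonneg)
  \<comment> \<open>The second difference is bounded by \<open>P d\<^sup>2 \<bar>z\<bar>\<^sup>2\<close>; the summand one avoids division by zero.\<close>
  define \<eta>' where "\<eta>' = \<eta> / ((?c + 1) * ?d\<^sup>2)"
  have e': "\<eta>' > 0" using eta c by (simp add: \<eta>'_def)
  from singular_integral_estimate[OF al e', where 'n='n]
  obtain C where C: "C \<ge> 0" and est0: "\<forall>(f :: real^'n \<Rightarrow> real) P Q. f \<in> borel_measurable lborel \<longrightarrow>
     (\<forall>z. \<bar>f z\<bar> \<le> P * (norm z)\<^sup>2) \<longrightarrow> (\<forall>z. \<bar>f z\<bar> \<le> Q) \<longrightarrow> 0 \<le> P \<longrightarrow>
     integrable lborel (\<lambda>z. f z / norm z powr ?a) \<and>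
     \<bar>LINT z|lborel. f z / norm z powr ?a\<bar> \<le> \<eta>' * P + C * Q"
    by (elim exE conjE)
  have est: "\<bar>LINT z|lborel. f z / norm z powr ?a\<bar> \<le> \<eta>' * P + C * Q"
    if "f \<in> borel_measurable lborel" "\<forall>z. \<bar>f z\<bar> \<le> P * (norm z)\<^sup>2" "\<forall>z. \<bar>f z\<bar> \<le> Q" "0 \<le> P"
    for f :: "real^'n \<Rightarrow> real" and P Q
    using est0 that by blast
  have "\<bar>frac_laplacian \<alpha> u x\<bar> \<le> \<eta> * P + (?c * C * 4) * S"
    if u: "has_hessian u G H" and P: "\<And>x i j. \<bar>H x $ i $ j\<bar> \<le> P" and S: "\<And>x. \<bar>u x\<bar> \<le> S" for u :: "real^'n \<Rightarrow> real" and G H P S x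
  proof -
    have P0: "P \<ge> 0" using P[of 0 undefined undefined] by linarith
    have S0: "S \<ge> 0" using S[of 0] by linarith
    have um[measurable]: "u \<in> borel_measurable borel"
      by (rule borel_measurable_continuous_onI[OF has_hessian_continuous[OF u]])
    have sd4: "\<bar>second_diff u x z\<bar> \<le> 4 * S" for z
      using S[of x] S[of "x + z"] S[of "x - z"] unfolding second_diff_def by linarith
    have sdm: "second_diff u x \<in> borel_measurable lborel"
      unfolding second_diff_def[abs_def] by measurable
    have "\<bar>LINT z|lborel. second_diff u x z / norm z powr ?a\<bar> \<le> \<eta>' * (P * ?d\<^sup>2) + C * (4 * S)"
      by (rule est[OF sdm]) (use second_diff_hessian_bound[OF u P] sd4 P0 in auto)
    then have "\<bar>frac_laplacian \<alpha> u x\<bar> \<le> ?c / 2 * (\<eta>' * (P * ?d\<^sup>2) + C * (4 * S))"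
      unfolding frac_laplacian_second_diff(1)[OF al u P S] abs_mult using c by (intro mult_mono) auto
    also have "\<dots> \<le> (?c + 1) * (\<eta>' * (P * ?d\<^sup>2)) + ?c * (C * (4 * S))"
      unfolding distrib_left using c e' P0 C S0 by (intro add_mono mult_right_mono) auto
    also have "(?c + 1) * (\<eta>' * (P * ?d\<^sup>2)) = \<eta> * P" using c by (simp add: \<eta>'_def)
    finally show ?thesis by (simp add: mult_ac)
  qed
  then show ?thesis using c C by (intro exI[of _ "?c * C * 4"]) auto
qed

lemma frac_laplacian_nonneg_at_max:
  assumes al: "0 < \<alpha>" "\<alpha> < 1" and u: "tame u G H" and m: "\<And>y. u y \<le> u x"
  shows "0 \<le> frac_laplacian \<alpha> u x"
proof -
  obtain S P where h: "has_hessian u G H" and b: "\<And>x. \<bar>u x\<bar> \<le> S" "\<And>x i j. \<bar>H x $ i $ j\<bar> \<le> P"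
    using u unfolding tame_def by blast
  have "0 \<le> second_diff u x z" for z using m[of "x + z"] m[of "x - z"] by (simp add: second_diff_def)
  then show ?thesis
    unfolding frac_laplacian_second_diff(1)[OF al h b(2,1)]
    using frac_laplacian_const_nonneg[OF al(1)] by (intro mult_nonneg_nonneg Bochner_Integration.integral_nonneg) auto
qed

section \<open>Hoelder bounds and interpolation\<close>

text \<open>One constant controls both the supremum and the Hoelder quotient, so that bounds for sums and
products combine without case distinctions. For \<open>x = y\<close> the condition is trivial because \<open>0 powr \<gamma> = 0\<close>.\<close>

definition holder_bound :: "real \<Rightarrow> real \<Rightarrow> (real^'n::finite \<Rightarrow> real) \<Rightarrow> bool" where
  "holder_bound \<gamma> Y f \<longleftrightarrow> (\<forall>x. \<bar>f x\<bar> \<le> Y) \<and> (\<forall>x y. \<bar>f x - f y\<bar> \<le> Y * norm (x - y) powr \<gamma>)"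

lemma holder_bound_nonneg: "holder_bound \<gamma> Y f \<Longrightarrow> 0 \<le> Y"
  unfolding holder_bound_def by (meson abs_ge_zero order_trans)

lemma holder_bound_mono: "holder_bound \<gamma> X f \<Longrightarrow> X \<le> Y \<Longrightarrow> holder_bound \<gamma> Y f"
  unfolding holder_bound_def by (meson mult_right_mono order_trans powr_ge_zero)

lemma holder_bound_add:
  "holder_bound \<gamma> X f \<Longrightarrow> holder_bound \<gamma> Y g \<Longrightarrow> holder_bound \<gamma> (X + Y) (\<lambda>x. f x + g x)"
  unfolding holder_bound_def
proof (intro conjI allI; elim conjE)
  fix x y
  assume a: "\<forall>x. \<bar>f x\<bar> \<le> X" "\<forall>x. \<bar>g x\<bar> \<le> Y"
    "\<forall>x y. \<bar>f x - f y\<bar> \<le> X * norm (x - y) powr \<gamma>" "\<forall>x y. \<bar>g x - g y\<bar> \<le> Y * norm (x - y) powr \<gamma>"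
  show "\<bar>f x + g x\<bar> \<le> X + Y" using a(1,2)[rule_format, of x] by linarith
  show "\<bar>f x + g x - (f y + g y)\<bar> \<le> (X + Y) * norm (x - y) powr \<gamma>"
    using a(3,4)[rule_format, of x y] unfolding distrib_right by linarith
qed

lemma holder_bound_cmult:
  assumes "holder_bound \<gamma> X f"
  shows "holder_bound \<gamma> (\<bar>c\<bar> * X) (\<lambda>x. c * f x)"
  using assms unfolding holder_bound_def
  by (auto simp: abs_mult mult.assoc simp flip: right_diff_distrib intro!: mult_left_mono)

lemma holder_bound_diff:
  assumes "holder_bound \<gamma> X f" "holder_bound \<gamma> Y g"
  shows "holder_bound \<gamma> (X + Y) (\<lambda>x. f x - g x)"
  using holder_bound_add[OF assms(1) holder_bound_cmult[OF assms(2), of "-1"]] by simp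

lemma holder_bound_mult:
  assumes f: "holder_bound \<gamma> X f" and g: "holder_bound \<gamma> Y g"
  shows "holder_bound \<gamma> (2 * X * Y) (\<lambda>x. f x * g x)"
proof -
  note XY = holder_bound_nonneg[OF f] holder_bound_nonneg[OF g]
  have b: "\<bar>f x\<bar> \<le> X" "\<bar>g x\<bar> \<le> Y" "\<bar>f x - f y\<bar> \<le> X * norm (x - y) powr \<gamma>" "\<bar>g x - g y\<bar> \<le> Y * norm (x - y) powr \<gamma>" for x y
    using f g unfolding holder_bound_def by auto
  have "\<bar>f x * g x\<bar> \<le> 2 * X * Y" for x
  proof -
    have "\<bar>f x * g x\<bar> \<le> X * Y" unfolding abs_mult using b XY by (intro mult_mono) auto
    also have "\<dots> \<le> 2 * X * Y" using XY by simp
    finally show ?thesis .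
  qed
  moreover have "\<bar>f x * g x - f y * g y\<bar> \<le> 2 * X * Y * norm (x - y) powr \<gamma>" for x y
  proof -
    have "f x * g x - f y * g y = f x * (g x - g y) + (f x - f y) * g y" by (simp add: algebra_simps)
    also have "\<bar>\<dots>\<bar> \<le> \<bar>f x\<bar> * \<bar>g x - g y\<bar> + \<bar>f x - f y\<bar> * \<bar>g y\<bar>"
      by (metis abs_mult abs_triangle_ineq)
    also have "\<dots> \<le> X * (Y * norm (x - y) powr \<gamma>) + (X * norm (x - y) powr \<gamma>) * Y"
      using b XY by (intro add_mono mult_mono) auto
    finally show ?thesis by (simp add: algebra_simps)
  qed
  ultimately show ?thesis unfolding holder_bound_def by blast
qed

lemma holder_bound_sum:
  assumes "finite I" "\<And>i. i \<in> I \<Longrightarrow> holder_bound \<gamma> Y (f i)"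
  shows "holder_bound \<gamma> (real (card I) * Y) (\<lambda>x. \<Sum>i\<in>I. f i x)"
  using assms
proof (induction I rule: finite_induct)
  case empty
  then show ?case by (simp add: holder_bound_def)
next
  case (insert i I)
  have "holder_bound \<gamma> (Y + real (card I) * Y) (\<lambda>x. f i x + (\<Sum>i\<in>I. f i x))"
    using insert by (intro holder_bound_add) auto
  then show ?case using insert by (simp add: algebra_simps)
qed

lemma holder_of_lipschitz:
  fixes f :: "real^'n::finite \<Rightarrow> real"
  assumes g: "0 < \<gamma>" "\<gamma> < 1" and S: "\<And>x. \<bar>f x\<bar> \<le> S" and L: "\<And>x y. \<bar>f x - f y\<bar> \<le> L * norm (x - y)" and L0: "0 \<le> L"
  shows "\<bar>f x - f y\<bar> \<le> (L + 2 * S) * norm (x - y) powr \<gamma>"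
proof (cases "norm (x - y) \<le> 1")
  case True
  have S0: "S \<ge> 0" using S[of x] by linarith
  have "norm (x - y) \<le> norm (x - y) powr \<gamma>"
  proof (cases "x = y")
    case False
    then show ?thesis using powr_mono'[of \<gamma> 1 "norm (x - y)"] True g by simp
  qed simp
  then have "L * norm (x - y) \<le> L * norm (x - y) powr \<gamma>" using L0 by (rule mult_left_mono)
  also have "\<dots> \<le> (L + 2 * S) * norm (x - y) powr \<gamma>" using S0 by (intro mult_right_mono) auto
  finally show ?thesis using L[of x y] by linarith
next
  case False
  have S0: "S \<ge> 0" using S[of x] by linarith
  have "1 \<le> norm (x - y) powr \<gamma>" using False g by (intro ge_one_powr_ge_zero) auto
  then have "(L + 2 * S) * 1 \<le> (L + 2 * S) * norm (x - y) powr \<gamma>" using L0 S0 by (intro mult_left_mono) auto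
  moreover have "\<bar>f x - f y\<bar> \<le> 2 * S" using S[of x] S[of y] by linarith
  ultimately show ?thesis using L0 by simp
qed

lemma inner_bound:
  fixes a v :: "real^'n::finite"
  assumes "\<And>j. \<bar>a $ j\<bar> \<le> X"
  shows "\<bar>a \<bullet> v\<bar> \<le> real CARD('n) * X * norm v"
proof -
  have X: "X \<ge> 0" using assms[of undefined] by linarith
  have "\<bar>a \<bullet> v\<bar> \<le> (\<Sum>j\<in>UNIV. \<bar>a $ j * v $ j\<bar>)" unfolding inner_vec_def by simp
  also have "\<dots> \<le> (\<Sum>j\<in>(UNIV::'n set). X * norm v)"
    unfolding abs_mult using X by (intro sum_mono mult_mono assms component_le_norm_cart) auto
  finally show ?thesis by simp
qed

lemma frobenius_prod_bound:
  fixes A M :: "real^'n::finite^'n"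
  assumes "\<And>i j. \<bar>A $ i $ j\<bar> \<le> X" "\<And>i j. \<bar>M $ i $ j\<bar> \<le> Y"
  shows "\<bar>frobenius_prod A M\<bar> \<le> (real CARD('n))\<^sup>2 * (X * Y)"
proof -
  have X: "X \<ge> 0" using assms(1)[of undefined undefined] by linarith
  have "\<bar>frobenius_prod A M\<bar> \<le> (\<Sum>i\<in>UNIV. \<Sum>j\<in>UNIV. \<bar>A $ i $ j * M $ i $ j\<bar>)"
    unfolding frobenius_prod_def by (rule order_trans[OF sum_abs]) (intro sum_mono sum_abs)
  also have "\<dots> \<le> (\<Sum>i\<in>(UNIV::'n set). \<Sum>j\<in>(UNIV::'n set). X * Y)"
    unfolding abs_mult using X by (intro sum_mono mult_mono assms) auto
  finally show ?thesis by (simp add: power2_eq_square)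
qed

lemma mean_value_line:
  assumes "has_hessian u G H"
  shows "\<exists>\<theta>. 0 < \<theta> \<and> \<theta> < 1 \<and> u (x + v) - u x = G (x + \<theta> *\<^sub>R v) \<bullet> v"
    and "\<exists>\<theta>. 0 < \<theta> \<and> \<theta> < 1 \<and> G (x + v) \<bullet> w - G x \<bullet> w = (v v* H (x + \<theta> *\<^sub>R v)) \<bullet> w"
proof -
  show "\<exists>\<theta>. 0 < \<theta> \<and> \<theta> < 1 \<and> u (x + v) - u x = G (x + \<theta> *\<^sub>R v) \<bullet> v"
    using MVT2[of 0 1 "\<lambda>t. u (x + t *\<^sub>R v)", OF _ has_hessian_deriv_line(1)[OF assms]] by auto
  show "\<exists>\<theta>. 0 < \<theta> \<and> \<theta> < 1 \<and> G (x + v) \<bullet> w - G x \<bullet> w = (v v* H (x + \<theta> *\<^sub>R v)) \<bullet> w"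
    using MVT2[of 0 1 "\<lambda>t. G (x + t *\<^sub>R v) \<bullet> w", OF _ has_hessian_deriv_line(2)[OF assms]] by auto
qed

text \<open>An entry of the Hessian equals a second difference quotient with step \<open>t\<close> up to its own oscillation
on the scale \<open>2 t\<close>.\<close>

lemma hessian_interpolation:
  fixes u :: "real^'n::finite \<Rightarrow> real"
  assumes u: "has_hessian u G H" and S: "\<And>x. \<bar>u x\<bar> \<le> S" and t: "t > 0" and g: "0 < \<gamma>" and K: "0 \<le> K"
    and HK: "\<And>x y i j. \<bar>H x $ i $ j - H y $ i $ j\<bar> \<le> K * norm (x - y) powr \<gamma>"
  shows "\<bar>H x $ i $ j\<bar> \<le> K * (2 * t) powr \<gamma> + 4 * S / t\<^sup>2"
proof -
  obtain \<xi> where xi: "norm \<xi> \<le> 2 * t" and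
    e: "(u (x + axis i t + axis j t) - u (x + axis i t) - u (x + axis j t) + u x) / t\<^sup>2 = H (x + \<xi>) $ i $ j"
    using second_difference_quotient[OF u t] by blast
  have "\<bar>H (x + \<xi>) $ i $ j\<bar> \<le> 4 * S / t\<^sup>2"
    unfolding e[symmetric] abs_divide
    using S[of "x + axis i t + axis j t"] S[of "x + axis i t"] S[of "x + axis j t"] S[of x]
    by (simp, intro divide_right_mono) auto
  moreover have "\<bar>H (x + \<xi>) $ i $ j - H x $ i $ j\<bar> \<le> K * norm \<xi> powr \<gamma>" using HK[of "x + \<xi>" i j x] by simp
  moreover have "K * norm \<xi> powr \<gamma> \<le> K * (2 * t) powr \<gamma>" using xi g K by (intro mult_left_mono powr_mono2) auto
  ultimately show ?thesis by linarith
qed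

lemma inner_axis_one: "v \<bullet> axis j 1 = v $ j" for v :: "real^'n::finite"
  by (simp add: inner_axis)

text \<open>A partial derivative is compared with the difference quotient of step one; Hoelder bounds follow from
Lipschitz bounds and boundedness.\<close>

lemma gradient_bounds:
  fixes u :: "real^'n::finite \<Rightarrow> real"
  assumes u: "has_hessian u G H" and S: "\<And>x. \<bar>u x\<bar> \<le> S" and P: "\<And>x i j. \<bar>H x $ i $ j\<bar> \<le> P"
    and g: "0 < \<gamma>" "\<gamma> < 1"
  shows "holder_bound \<gamma> ((real CARD('n) + 4) * (P + 2 * S)) u"
    and "holder_bound \<gamma> ((real CARD('n) + 4) * (P + 2 * S)) (\<lambda>x. G x $ j)"
proof -
  let ?d = "real CARD('n)"
  have S0: "S \<ge> 0" using S[of 0] by linarith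
  have P0: "P \<ge> 0" using P[of 0 undefined undefined] by linarith
  have Gb: "\<bar>G x $ j\<bar> \<le> P + 2 * S" for x j
  proof -
    obtain \<theta> where th: "0 < \<theta>" "\<theta> < 1" and 1: "u (x + axis j 1) - u x = G (x + \<theta> *\<^sub>R axis j 1) \<bullet> axis j 1"
      using mean_value_line(1)[OF u] by blast
    obtain \<theta>' where 2: "G (x + axis j \<theta>) \<bullet> axis j 1 - G x \<bullet> axis j 1 = (axis j \<theta> v* H (x + \<theta>' *\<^sub>R axis j \<theta>)) \<bullet> axis j 1"
      using mean_value_line(2)[OF u] by blast
    have ax: "\<theta> *\<^sub>R axis j 1 = (axis j \<theta> :: real^'n)" by (simp add: axis_def vec_eq_iff)
    have "\<theta> * \<bar>H (x + \<theta>' *\<^sub>R axis j \<theta>) $ j $ j\<bar> \<le> 1 * P" using th P by (intro mult_mono) auto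
    then have "\<bar>G (x + axis j \<theta>) $ j - G x $ j\<bar> \<le> P"
      using 2 th unfolding bilinear_form_axis unfolding inner_axis_one by (simp add: abs_mult)
    moreover have "\<bar>G (x + axis j \<theta>) $ j\<bar> \<le> 2 * S"
      using 1 S[of x] S[of "x + axis j 1"] unfolding inner_axis_one ax by linarith
    ultimately show ?thesis by linarith
  qed
  have uL: "\<bar>u x - u y\<bar> \<le> (?d * (P + 2 * S)) * norm (x - y)" for x y
  proof -
    obtain \<theta> where "u (y + (x - y)) - u y = G (y + \<theta> *\<^sub>R (x - y)) \<bullet> (x - y)"
      using mean_value_line(1)[OF u] by blast
    then show ?thesis using inner_bound[of "G (y + \<theta> *\<^sub>R (x - y))" "P + 2 * S" "x - y", OF Gb] by simp
  qed
  have GL: "\<bar>G x $ j - G y $ j\<bar> \<le> (?d * P) * norm (x - y)" for x y j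
  proof -
    obtain \<theta> where e: "G (y + (x - y)) \<bullet> axis j 1 - G y \<bullet> axis j 1 = ((x - y) v* H (y + \<theta> *\<^sub>R (x - y))) \<bullet> axis j 1"
      using mean_value_line(2)[OF u] by blast
    have "((x - y) v* M) \<bullet> axis j 1 = (\<chi> i. M $ i $ j) \<bullet> (x - y)" for M :: "real^'n^'n"
      unfolding inner_axis_one by (simp add: vector_matrix_mult_def inner_vec_def mult.commute)
    then show ?thesis using e inner_bound[of "(\<chi> i. H (y + \<theta> *\<^sub>R (x - y)) $ i $ j)" P "x - y"] P
      unfolding inner_axis_one by simp
  qed
  have r: "0 \<le> r \<Longrightarrow> a \<le> b \<Longrightarrow> z \<le> a * r \<Longrightarrow> z \<le> b * r" for a b r z :: real
    using mult_right_mono[of a b r] by linarith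
  have d0: "0 \<le> ?d * P" "0 \<le> ?d * S" using P0 S0 by auto
  have B: "(?d + 4) * (P + 2 * S) = ?d * P + 2 * (?d * S) + 4 * P + 8 * S" by (simp add: algebra_simps)
  have "\<bar>u x\<bar> \<le> (?d + 4) * (P + 2 * S)" for x using S[of x] S0 P0 d0 unfolding B by linarith
  moreover have "\<bar>u x - u y\<bar> \<le> ((?d + 4) * (P + 2 * S)) * norm (x - y) powr \<gamma>" for x y
  proof (rule r[OF _ _ holder_of_lipschitz[OF g S uL]])
    show "?d * (P + 2 * S) + 2 * S \<le> (?d + 4) * (P + 2 * S)" "0 \<le> ?d * (P + 2 * S)" using S0 P0 by (auto simp: algebra_simps)
  qed simp
  ultimately show "holder_bound \<gamma> ((?d + 4) * (P + 2 * S)) u" unfolding holder_bound_def by blast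
  have "\<bar>G x $ j\<bar> \<le> (?d + 4) * (P + 2 * S)" for x using Gb[of x j] S0 P0 d0 unfolding B by linarith
  moreover have "\<bar>G x $ j - G y $ j\<bar> \<le> ((?d + 4) * (P + 2 * S)) * norm (x - y) powr \<gamma>" for x y
  proof (rule r[OF _ _ holder_of_lipschitz[OF g Gb GL]])
    show "?d * P + 2 * (P + 2 * S) \<le> (?d + 4) * (P + 2 * S)" "0 \<le> ?d * P" using S0 P0 by (auto simp: algebra_simps)
  qed simp
  ultimately show "holder_bound \<gamma> ((?d + 4) * (P + 2 * S)) (\<lambda>x. G x $ j)" unfolding holder_bound_def by blast
qed

abbreviation lower_order_bound ::
    "real \<Rightarrow> real \<Rightarrow> real \<Rightarrow> (real^'n::finite \<Rightarrow> real) \<Rightarrow> (real^'n \<Rightarrow> real^'n) \<Rightarrow> (real^'n \<Rightarrow> real^'n^'n) \<Rightarrow> bool" where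
  "lower_order_bound \<gamma> \<alpha> Z u G H \<equiv> holder_bound \<gamma> Z u \<and> (\<forall>j. holder_bound \<gamma> Z (\<lambda>x. G x $ j)) \<and>
     hessian_le Z H \<and> holder_bound \<gamma> Z (frac_laplacian \<alpha> u)"

text \<open>The Hoelder seminorm of the fractional Laplacian is obtained by applying the pointwise estimate
to the function \<open>z \<mapsto> u (x + z) - u (y + z)\<close> at \<open>0\<close>: its Hessian is at most \<open>K \<bar>x - y\<bar>\<^bsup>\<gamma>\<^esup>\<close> and its values are at most
a multiple of \<open>\<bar>x - y\<bar>\<^bsup>\<gamma>\<^esup>\<close>.\<close>

lemma lower_order_interpolation:
  fixes \<gamma> \<alpha> \<eta> :: real
  assumes g: "0 < \<gamma>" "\<gamma> < 1" and al: "0 < \<alpha>" "\<alpha> < 1" and eta: "0 < \<eta>"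
  shows "\<exists>C\<ge>0. \<forall>(u :: real^'n::finite \<Rightarrow> real) G H S K. has_hessian u G H \<longrightarrow> (\<forall>x. \<bar>u x\<bar> \<le> S) \<longrightarrow> 0 \<le> K \<longrightarrow>
     hessian_holder \<gamma> K H \<longrightarrow>
     lower_order_bound \<gamma> \<alpha> (\<eta> * K + C * S) u G H"
proof -
  let ?d = "real CARD('n)"
  define \<eta>1 where "\<eta>1 = min 1 (\<eta> / 2)"
  have e1: "0 < \<eta>1" "\<eta>1 \<le> 1" "\<eta>1 \<le> \<eta> / 2" using eta by (auto simp: \<eta>1_def)
  obtain C1 where C1: "C1 \<ge> 0" and FL: "\<forall>(u :: real^'n::finite \<Rightarrow> real) G H P S x. has_hessian u G H \<longrightarrow>
     hessian_le P H \<longrightarrow> (\<forall>x. \<bar>u x\<bar> \<le> S) \<longrightarrow> \<bar>frac_laplacian \<alpha> u x\<bar> \<le> \<eta>1 * P + C1 * S"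
    using frac_laplacian_estimate[OF al e1(1), where 'n='n] by (elim exE conjE)
  define E where "E = (2 + C1) * (?d + 4)"
  have E: "E \<ge> 1"
  proof -
    have "1 * 1 \<le> (2 + C1) * (?d + 4)" using C1 by (intro mult_mono) auto
    then show ?thesis by (simp add: E_def)
  qed
  \<comment> \<open>The step \<open>t\<close> solves \<open>E (2 t)\<^bsup>\<gamma>\<^esup> = \<eta> / 2\<close>, which leaves the other half of \<open>\<eta>\<close> for the fractional Laplacian.\<close>
  define t where "t = (\<eta> / (2 * E)) powr (1 / \<gamma>) / 2"
  have t: "t > 0" using eta E by (simp add: t_def)
  have tp: "(2 * t) powr \<gamma> = \<eta> / (2 * E)" using eta E g by (simp add: t_def powr_powr)
  define C where "C = E * (4 / t\<^sup>2 + 2)"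
  have C0: "C \<ge> 0" using E by (simp add: C_def)
  have main: "lower_order_bound \<gamma> \<alpha> (\<eta> * K + C * S) u G H"
    if u: "has_hessian u G H" and S: "\<And>x. \<bar>u x\<bar> \<le> S" and K: "0 \<le> K"
      and HK: "\<And>x y i j. \<bar>H x $ i $ j - H y $ i $ j\<bar> \<le> K * norm (x - y) powr \<gamma>"
    for u :: "real^'n::finite \<Rightarrow> real" and G H S K
  proof -
    define P where "P = K * (\<eta> / (2 * E)) + 4 * S / t\<^sup>2"
    have S0: "S \<ge> 0" using S[of 0] by linarith
    have P: "\<bar>H x $ i $ j\<bar> \<le> P" for x i j
      using hessian_interpolation[OF u S t g(1) K HK] unfolding tp P_def .
    have P0: "P \<ge> 0" using P[of 0 undefined undefined] by linarith
    define B where "B = (?d + 4) * (P + 2 * S)"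
    note GB = gradient_bounds[OF u S P g, folded B_def]
    have B0: "B \<ge> 0" using holder_bound_nonneg GB by blast
    have PB: "P \<le> B" "S \<le> B"
    proof -
      have "1 * (P + 2 * S) \<le> B" unfolding B_def using S0 P0 by (intro mult_right_mono) auto
      then show "P \<le> B" "S \<le> B" using S0 P0 by auto
    qed
    define Z where "Z = \<eta> * K + C * S"
    have EZ: "(2 + C1) * B + \<eta>1 * K \<le> Z"
    proof -
      have "(2 + C1) * B = E * (P + 2 * S)" by (simp add: B_def E_def)
      also have "\<dots> = \<eta> / 2 * K + C * S" using E by (simp add: P_def C_def field_simps)
      finally have "(2 + C1) * B = \<eta> / 2 * K + C * S" .
      moreover have "\<eta>1 * K \<le> \<eta> / 2 * K" using e1 K by (intro mult_right_mono) auto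
      moreover have "\<eta> / 2 * K + \<eta> / 2 * K = \<eta> * K" by simp
      ultimately show ?thesis unfolding Z_def by linarith
    qed
    have K1: "0 \<le> \<eta>1 * K" "0 \<le> C1 * B" using e1 K C1 B0 by auto
    have BZ: "B \<le> Z" using EZ K1 B0 by (simp add: distrib_right)
    have tm: "tame u G H" unfolding tame_def using u S P by blast
    have FLs: "\<bar>frac_laplacian \<alpha> u x\<bar> \<le> Z" for x
    proof -
      have "\<bar>frac_laplacian \<alpha> u x\<bar> \<le> \<eta>1 * P + C1 * S" using FL u P S by blast
      also have "\<dots> \<le> 1 * B + C1 * B" using e1 C1 PB P0 S0 by (intro add_mono mult_mono) auto
      also have "\<dots> \<le> Z" using EZ K1 B0 by (simp add: distrib_right)
      finally show ?thesis .
    qed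
    have FLh: "\<bar>frac_laplacian \<alpha> u x - frac_laplacian \<alpha> u y\<bar> \<le> Z * norm (x - y) powr \<gamma>" for x y
    proof -
      let ?r = "norm (x - y) powr \<gamma>"
      let ?v = "\<lambda>z. u (x + z) - u (y + z)"
      note tr = frac_laplacian_translate[OF al tm]
      have "frac_laplacian \<alpha> ?v 0 = frac_laplacian \<alpha> u (x + 0) - frac_laplacian \<alpha> u (y + 0)"
        unfolding frac_laplacian_diff(1)[OF al tr(2)[of x] tr(2)[of y]] tr(1) ..
      moreover have "\<bar>frac_laplacian \<alpha> ?v 0\<bar> \<le> \<eta>1 * (K * ?r) + C1 * (B * ?r)"
      proof (rule FL[rule_format])
        show "has_hessian ?v (\<lambda>z. G (x + z) - G (y + z)) (\<lambda>z. H (x + z) - H (y + z))"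
          by (intro has_hessian_diff has_hessian_translate u)
        show "\<bar>(H (x + z) - H (y + z)) $ i $ j\<bar> \<le> K * ?r" for z i j using HK[of "x + z" i j "y + z"] by simp
        show "\<bar>u (x + z) - u (y + z)\<bar> \<le> B * ?r" for z
          using GB(1) unfolding holder_bound_def by (metis add_diff_cancel_right)
      qed
      moreover have "\<eta>1 * (K * ?r) + C1 * (B * ?r) = (\<eta>1 * K + C1 * B) * ?r" by (simp add: algebra_simps)
      moreover have "(\<eta>1 * K + C1 * B) * ?r \<le> Z * ?r"
        using EZ B0 by (intro mult_right_mono) (auto simp: distrib_right)
      ultimately show ?thesis by simp
    qed
    show ?thesis
      using holder_bound_mono[OF GB(1) BZ] holder_bound_mono[OF GB(2) BZ] order_trans[OF order_trans[OF P PB(1)] BZ] FLs FLh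
      unfolding Z_def[symmetric] by (auto simp: holder_bound_def)
  qed
  show ?thesis by (rule exI[of _ C]) (use C0 main in blast)
qed

text \<open>Absorption of a term \<open>K / 2\<close> into the left-hand side, in a form that works for any monotone family of bounds: starting
from some finite bound, the step drives it geometrically towards \<open>2 X\<close>.\<close>

lemma halving_iteration:
  fixes valid :: "real \<Rightarrow> bool"
  assumes mono: "\<And>a b. valid a \<Longrightarrow> a \<le> b \<Longrightarrow> valid b" and K0: "valid K0" "0 < K0" and X: "0 < X"
    and step: "\<And>K. 0 < K \<Longrightarrow> valid K \<Longrightarrow> valid (K / 2 + X)"
  shows "valid (3 * X)"
proof -
  have v: "valid (2 * X + K0 / 2 ^ n)" for n
  proof (induction n)
    case 0
    then show ?case using mono[OF K0(1)] X by simp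
  next
    case (Suc n)
    have "0 < 2 * X + K0 / 2 ^ n" using X K0 by (simp add: add_pos_pos)
    from step[OF this Suc] show ?case by (simp add: add_divide_distrib mult.commute)
  qed
  obtain n where "K0 / X < 2 ^ n" using real_arch_pow[of 2 "K0 / X"] by auto
  then have "K0 / 2 ^ n \<le> X" using X by (simp add: field_simps)
  then show ?thesis using mono[OF v[of n]] by simp
qed

section \<open>The maximum principle on the whole space\<close>

lemma has_hessian_bump:
  fixes x :: "real^'n::finite"
  defines "q \<equiv> \<lambda>x::real^'n. 1 + x \<bullet> x"
  shows "has_hessian (\<lambda>x. 1 / q x) (\<lambda>x. (- 2 / (q x)\<^sup>2) *\<^sub>R x)
     (\<lambda>x. (- 2 / (q x)\<^sup>2) *\<^sub>R mat 1 + (8 / (q x) ^ 3) *\<^sub>R (\<chi> i j. x $ i * x $ j))"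
proof -
  have q: "q x > 0" for x unfolding q_def by (simp add: add_pos_nonneg)
  have dq: "(q has_derivative (\<lambda>h. 2 * (x \<bullet> h))) (at x)" for x
    unfolding q_def by (auto intro!: derivative_eq_intros simp: inner_commute)
  have 1: "((\<lambda>x. 1 / q x) has_derivative (\<lambda>h. ((- 2 / (q x)\<^sup>2) *\<^sub>R x) \<bullet> h)) (at x)" for x
    using q[of x] by (auto intro!: derivative_eq_intros dq simp: field_simps power2_eq_square)
  have e: "h v* (a *\<^sub>R mat 1 + b *\<^sub>R (\<chi> i j. x $ i * x $ j)) = a *\<^sub>R h + (b * (x \<bullet> h)) *\<^sub>R x"
    for h x :: "real^'n" and a b
  proof -
    have ad: "h v* (P + Q) = h v* P + h v* Q" for P Q :: "real^'n^'n"
      by (simp add: vector_matrix_mult_def vec_eq_iff algebra_simps sum.distrib)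
    have "h v* (\<chi> i j. x $ i * x $ j) = (x \<bullet> h) *\<^sub>R x"
      by (simp add: vector_matrix_mult_def vec_eq_iff inner_vec_def sum_distrib_left sum_distrib_right mult_ac)
    then show ?thesis by (simp add: ad vector_matrix_mult_scaleR_right)
  qed
  have d2: "((\<lambda>x. - 2 / (q x)\<^sup>2) has_derivative (\<lambda>h. 8 / (q x) ^ 3 * (x \<bullet> h))) (at x)" for x
    using q[of x] by (auto intro!: derivative_eq_intros dq simp: field_simps power2_eq_square power3_eq_cube)
  have 2: "((\<lambda>x. (- 2 / (q x)\<^sup>2) *\<^sub>R x) has_derivative
      (\<lambda>h. (- 2 / (q x)\<^sup>2) *\<^sub>R h + (8 / (q x) ^ 3 * (x \<bullet> h)) *\<^sub>R x)) (at x)" for x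
    by (rule has_derivative_scaleR[OF d2 has_derivative_ident])
  show ?thesis unfolding has_hessian_def e using 1 2 by blast
qed

text \<open>Used to turn an almost-maximum on the whole space into a true maximum: the bump \<open>1 / (1 + \<bar>x\<bar>\<^sup>2)\<close> has
height one and is at most one half away from the unit ball.\<close>

lemma bump_exists:
  fixes \<alpha> :: real
  assumes al: "0 < \<alpha>" "\<alpha> < 1"
  shows "\<exists>(\<psi> :: real^'n::finite \<Rightarrow> real) G H C. tame \<psi> G H \<and> \<psi> 0 = 1 \<and> (\<forall>x. 0 \<le> \<psi> x \<and> \<psi> x \<le> 1) \<and>
     (\<forall>x. norm x > 1 \<longrightarrow> \<psi> x \<le> 1/2) \<and> 0 \<le> C \<and> (\<forall>x j. \<bar>G x $ j\<bar> \<le> C) \<and> hessian_le C H \<and>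
     (\<forall>x. \<bar>frac_laplacian \<alpha> \<psi> x\<bar> \<le> C)"
proof -
  define q where "q = (\<lambda>x::real^'n. 1 + x \<bullet> x)"
  define \<psi> where "\<psi> = (\<lambda>x::real^'n. 1 / q x)"
  define G where "G = (\<lambda>x. (- 2 / (q x)\<^sup>2) *\<^sub>R x)"
  define H where "H = (\<lambda>x. (- 2 / (q x)\<^sup>2) *\<^sub>R mat 1 + (8 / (q x) ^ 3) *\<^sub>R (\<chi> i j. x $ i * x $ j) :: real^'n^'n)"
  have hh: "has_hessian \<psi> G H" unfolding \<psi>_def G_def H_def q_def by (rule has_hessian_bump)
  have q1: "q x \<ge> 1" for x by (simp add: q_def)
  have qn: "\<bar>x $ i\<bar> \<le> q x" "\<bar>x $ i * x $ j\<bar> \<le> q x" for x i j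
  proof -
    have n: "q x = 1 + (norm x)\<^sup>2" by (simp add: q_def dot_square_norm)
    have "2 * norm x \<le> 1 + (norm x)\<^sup>2" using sum_squares_ge_zero[of "norm x - 1" 0] by (simp add: power2_eq_square algebra_simps)
    then show "\<bar>x $ i\<bar> \<le> q x" using component_le_norm_cart[of x i] norm_ge_zero[of x] unfolding n by linarith
    have "\<bar>x $ i * x $ j\<bar> \<le> norm x * norm x" unfolding abs_mult by (intro mult_mono component_le_norm_cart) auto
    then show "\<bar>x $ i * x $ j\<bar> \<le> q x" unfolding n by (simp add: power2_eq_square)
  qed
  have psi: "0 \<le> \<psi> x \<and> \<psi> x \<le> 1" for x using q1[of x] by (simp add: \<psi>_def)
  have Gb: "\<bar>G x $ j\<bar> \<le> 10" for x j
  proof -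
    have "2 * \<bar>x $ j\<bar> \<le> 2 * q x" using qn by simp
    also have "\<dots> \<le> 2 * q x * q x" using q1[of x] by simp
    finally show ?thesis using q1[of x] by (simp add: G_def power2_eq_square abs_mult field_simps)
  qed
  have Hb: "\<bar>H x $ i $ j\<bar> \<le> 10" for x i j
  proof -
    have q3: "q x \<le> (q x) ^ 3" "1 \<le> (q x)\<^sup>2" using q1[of x] power_increasing[of 1 3 "q x"] by auto
    have "\<bar>x $ i * x $ j\<bar> \<le> (q x) ^ 3" using qn(2)[of x i j] q3 by linarith
    then have a: "\<bar>8 / (q x) ^ 3 * (x $ i * x $ j)\<bar> \<le> 8" using q1[of x] by (simp add: abs_mult field_simps)
    have "\<bar>(mat 1 :: real^'n^'n) $ i $ j\<bar> \<le> 1" by (simp add: mat_def)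
    then have "2 * \<bar>(mat 1 :: real^'n^'n) $ i $ j\<bar> \<le> 2 * (q x)\<^sup>2" using q3 by linarith
    then have b: "\<bar>- 2 / (q x)\<^sup>2 * (mat 1 :: real^'n^'n) $ i $ j\<bar> \<le> 2" using q1[of x] by (simp add: abs_mult field_simps)
    have "H x $ i $ j = - 2 / (q x)\<^sup>2 * (mat 1 :: real^'n^'n) $ i $ j + 8 / (q x) ^ 3 * (x $ i * x $ j)"
      by (simp add: H_def)
    then show ?thesis using a b by linarith
  qed
  obtain C1 where C1: "C1 \<ge> 0" and FL: "\<forall>(u :: real^'n \<Rightarrow> real) G H P S x. has_hessian u G H \<longrightarrow>
     hessian_le P H \<longrightarrow> (\<forall>x. \<bar>u x\<bar> \<le> S) \<longrightarrow> \<bar>frac_laplacian \<alpha> u x\<bar> \<le> 1 * P + C1 * S"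
    using frac_laplacian_estimate[OF al zero_less_one, where 'n='n] by (elim exE conjE)
  have pb: "\<forall>x. \<bar>\<psi> x\<bar> \<le> 1" using psi by simp
  have fl: "\<bar>frac_laplacian \<alpha> \<psi> x\<bar> \<le> 10 + C1" for x using FL[rule_format, OF hh] Hb pb by fastforce
  have t: "tame \<psi> G H" unfolding tame_def using hh pb Hb by blast
  have far: "\<psi> x \<le> 1/2" if "norm x > 1" for x
  proof -
    have "q x \<ge> 2" using that power_mono[of 1 "norm x" 2] by (simp add: q_def dot_square_norm)
    then show ?thesis by (simp add: \<psi>_def field_simps)
  qed
  have "\<psi> 0 = 1" by (simp add: \<psi>_def q_def)
  moreover have "\<bar>G x $ j\<bar> \<le> 10 + C1" "\<bar>H x $ i $ j\<bar> \<le> 10 + C1" for x i j using Gb[of x j] Hb[of x i j] C1 by linarith+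
  ultimately show ?thesis using t psi far fl C1
    by (intro exI[of _ \<psi>] exI[of _ G] exI[of _ H] exI[of _ "10 + C1"]) auto
qed

text \<open>Taking \<open>G\<close> and \<open>H\<close> as arguments lets the equations of \<open>V\<close>, \<open>V'\<close> and their difference be combined
without forming derivatives of the difference.\<close>

abbreviation policy_equation ::
    "real \<Rightarrow> real \<Rightarrow> (real^'n::finite \<Rightarrow> real) \<Rightarrow> (real^'n \<Rightarrow> real^'n) \<Rightarrow> (real^'n \<Rightarrow> real^'n^'n) \<Rightarrow> (real^'n \<Rightarrow> real) \<Rightarrow>
     (real^'n \<Rightarrow> real) \<Rightarrow> (real^'n \<Rightarrow> real^'n) \<Rightarrow> (real^'n \<Rightarrow> real^'n^'n) \<Rightarrow> bool" where
  "policy_equation \<alpha> \<beta> g b A s u G H \<equiv>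
     (\<forall>x. \<beta> * u x = g x + b x \<bullet> G x + frobenius_prod (A x) (H x) - s x * frac_laplacian \<alpha> u x)"

locale elliptic_coefficients =
  fixes \<gamma> \<alpha> \<beta> c B :: real
    and b :: "real^'n::finite \<Rightarrow> real^'n" and Do :: "real^'n \<Rightarrow> real^'n^'n" and Df :: "real^'n \<Rightarrow> real"
  assumes gamma: "0 < \<gamma>" "\<gamma> < 1" and alpha: "0 < \<alpha>" "\<alpha> < 1" and beta: "0 < \<beta>" and c: "0 < c"
    and b_bound: "\<And>i. holder_bound \<gamma> B (\<lambda>x. b x $ i)"
    and Do_bound: "\<And>i j. holder_bound \<gamma> B (\<lambda>x. Do x $ i $ j)"
    and Df_bound: "holder_bound \<gamma> B Df"
    and Df_nonneg: "\<And>x. 0 \<le> Df x"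
    and Do_sym: "\<And>x. transpose (Do x) = Do x"
    and Do_elliptic: "\<And>x \<xi>. c * (norm \<xi>)\<^sup>2 \<le> \<xi> \<bullet> (Do x *v \<xi>)"
begin

lemma B_nonneg: "0 \<le> B" using Df_bound by (rule holder_bound_nonneg)

definition solves :: "(real^'n \<Rightarrow> real) \<Rightarrow> (real^'n \<Rightarrow> real) \<Rightarrow> (real^'n \<Rightarrow> real^'n) \<Rightarrow> (real^'n \<Rightarrow> real^'n^'n) \<Rightarrow> bool" where
  "solves g u G H \<longleftrightarrow> tame u G H \<and>
     policy_equation \<alpha> \<beta> g b Do Df u G H"

text \<open>Let \<open>u a > M - \<eta> / 2\<close>, where \<open>M\<close> is the supremum. Adding \<open>\<eta>\<close> times a bump centred at \<open>a\<close> lifts \<open>u a\<close>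
above \<open>M + \<eta> / 2\<close>, a value that is not exceeded outside the unit ball at \<open>a\<close>, so a global maximum exists. There the
equation gives \<open>\<beta> u \<le> E + O(\<eta>)\<close>, and \<open>\<eta>\<close> is arbitrary.\<close>

lemma maximum_principle:
  assumes sol: "solves g u G H" and gE: "\<And>x. g x \<le> E"
  shows "u x \<le> E / \<beta>"
proof -
  let ?d = "real CARD('n)"
  have tu: "tame u G H" and eq: "\<And>x. \<beta> * u x = g x + b x \<bullet> G x + frobenius_prod (Do x) (H x) - Df x * frac_laplacian \<alpha> u x"
    using sol unfolding solves_def by auto
  obtain S where S: "\<And>x. \<bar>u x\<bar> \<le> S" using tu unfolding tame_def by blast
  have hu: "has_hessian u G H" using tu unfolding tame_def by blast
  obtain \<psi> :: "real^'n \<Rightarrow> real" and G1 H1 C where t1: "tame \<psi> G1 H1" and p0: "\<psi> 0 = 1"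
    and p01: "\<forall>x. 0 \<le> \<psi> x \<and> \<psi> x \<le> 1" and far: "\<forall>x. norm x > 1 \<longrightarrow> \<psi> x \<le> 1/2"
    and C0: "0 \<le> C" and G1: "\<forall>x j. \<bar>G1 x $ j\<bar> \<le> C" and H1: "\<forall>x i j. \<bar>H1 x $ i $ j\<bar> \<le> C"
    and F1: "\<forall>x. \<bar>frac_laplacian \<alpha> \<psi> x\<bar> \<le> C"
    using bump_exists[OF alpha, where 'n='n] by (elim exE conjE)
  define M where "M = (SUP x. u x)"
  have bdd: "bdd_above (range u)" using S by (auto intro!: bdd_aboveI[of _ S] simp: abs_le_iff)
  have uM: "u x \<le> M" for x unfolding M_def by (rule cSUP_upper[OF _ bdd]) simp
  define D where "D = \<beta> / 2 + (?d * B * (?d * C) + ?d\<^sup>2 * (B * C) + B * C)"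
  have key: "\<beta> * M \<le> E + \<eta> * D" if eta: "\<eta> > 0" for \<eta>
  proof -
    have "\<exists>a. M - \<eta> / 2 < u a"
      using less_cSUP_iff[OF _ bdd, of "M - \<eta> / 2"] eta unfolding M_def by auto
    then obtain a where a: "M - \<eta> / 2 < u a" ..
    define \<phi> where "\<phi> = (\<lambda>y. u y - (- \<eta>) * \<psi> (- a + y))"
    have h\<phi>: "has_hessian \<phi> (\<lambda>y. G y - (- \<eta>) *\<^sub>R G1 (- a + y)) (\<lambda>y. H y - (- \<eta>) *\<^sub>R H1 (- a + y))"
      unfolding \<phi>_def using t1 hu unfolding tame_def
      by (intro has_hessian_diff has_hessian_cmult has_hessian_translate) auto
    have "\<exists>z\<in>cball a 1. \<forall>y\<in>cball a 1. \<phi> y \<le> \<phi> z"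
      by (intro continuous_attains_sup has_hessian_continuous[OF h\<phi>]) auto
    then obtain z where z: "\<And>y. y \<in> cball a 1 \<Longrightarrow> \<phi> y \<le> \<phi> z" by blast
    have za: "\<phi> z \<ge> \<phi> a" by (rule z) simp
    have pa: "\<phi> a > M + \<eta> / 2" using a p0 by (simp add: \<phi>_def)
    have max: "\<phi> y \<le> \<phi> z" for y
    proof (cases "y \<in> cball a 1")
      case False
      then have "\<psi> (- a + y) \<le> 1/2" using far by (simp add: dist_norm norm_minus_commute)
      then have "\<eta> * \<psi> (- a + y) \<le> \<eta> * (1/2)" using eta by (intro mult_left_mono) auto
      then show ?thesis using za pa uM[of y] by (simp add: \<phi>_def)
    qed (rule z)
    have Gz: "G z = - \<eta> *\<^sub>R G1 (- a + z)"
      using second_derivative_test(1)[OF h\<phi> open_UNIV UNIV_I max] by (simp add: eq_neg_iff_add_eq_0)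
    have psd: "0 \<le> \<xi> \<bullet> (Do z *v \<xi>)" for \<xi>
      using Do_elliptic[of \<xi> z] c by (meson mult_nonneg_nonneg less_imp_le order_trans zero_le_power2)
    have "frobenius_prod (Do z) (H z - (- \<eta>) *\<^sub>R H1 (- a + z)) \<le> 0"
      by (rule frobenius_prod_psd_nsd[OF Do_sym psd]) (rule second_derivative_test(2)[OF h\<phi> open_UNIV UNIV_I max])
    then have Hz: "frobenius_prod (Do z) (H z) \<le> - \<eta> * frobenius_prod (Do z) (H1 (- a + z))"
      unfolding frobenius_prod_diff_right frobenius_prod_scaleR_right by simp
    note tt = frac_laplacian_translate[OF alpha t1, of "- a"]
    note tc = frac_laplacian_cmult[OF alpha tt(2), of "- \<eta>"]
    have "0 \<le> frac_laplacian \<alpha> \<phi> z"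
      unfolding \<phi>_def
      by (rule frac_laplacian_nonneg_at_max[OF alpha frac_laplacian_diff(2)[OF alpha tu tc(2)]]) (use max in \<open>simp add: \<phi>_def\<close>)
    also have "\<dots> = frac_laplacian \<alpha> u z - (- \<eta>) * frac_laplacian \<alpha> \<psi> (- a + z)"
      unfolding \<phi>_def frac_laplacian_diff(1)[OF alpha tu tc(2)] tc(1) tt(1) ..
    finally have "- frac_laplacian \<alpha> u z \<le> \<eta> * frac_laplacian \<alpha> \<psi> (- a + z)" by simp
    also have "\<dots> \<le> \<eta> * C" using F1 eta by (intro mult_left_mono) (auto simp: abs_le_iff)
    finally have "Df z * (- frac_laplacian \<alpha> u z) \<le> Df z * (\<eta> * C)"
      using Df_nonneg by (intro mult_left_mono) auto
    also have "\<dots> \<le> B * (\<eta> * C)"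
      using Df_bound eta C0 by (intro mult_right_mono) (auto simp: holder_bound_def abs_le_iff)
    finally have T3: "- (Df z * frac_laplacian \<alpha> u z) \<le> \<eta> * (B * C)" by (simp add: mult_ac)
    have T2: "frobenius_prod (Do z) (H z) \<le> \<eta> * (?d\<^sup>2 * (B * C))"
    proof -
      have "\<bar>frobenius_prod (Do z) (H1 (- a + z))\<bar> \<le> ?d\<^sup>2 * (B * C)"
        by (rule frobenius_prod_bound) (use Do_bound H1 in \<open>auto simp: holder_bound_def\<close>)
      then have "\<eta> * (- frobenius_prod (Do z) (H1 (- a + z))) \<le> \<eta> * (?d\<^sup>2 * (B * C))"
        using eta by (intro mult_left_mono) auto
      then show ?thesis using Hz by simp
    qed
    have T1: "b z \<bullet> G z \<le> \<eta> * (?d * B * (?d * C))"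
    proof -
      have "\<bar>b z \<bullet> G1 (- a + z)\<bar> \<le> ?d * B * norm (G1 (- a + z))"
        by (rule inner_bound) (use b_bound in \<open>auto simp: holder_bound_def\<close>)
      also have "norm (G1 (- a + z)) \<le> (\<Sum>j\<in>(UNIV::'n set). C)"
        by (rule order_trans[OF norm_le_l1_cart]) (intro sum_mono, use G1 in simp)
      finally have "\<bar>b z \<bullet> G1 (- a + z)\<bar> \<le> ?d * B * (?d * C)" using B_nonneg by (simp add: mult_left_mono)
      then have "\<eta> * (- (b z \<bullet> G1 (- a + z))) \<le> \<eta> * (?d * B * (?d * C))"
        using eta by (intro mult_left_mono) auto
      then show ?thesis by (simp add: Gz)
    qed
    have "\<eta> * \<psi> (- a + z) \<le> \<eta> * 1" using p01 eta by (intro mult_left_mono) auto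
    then have "M - \<eta> / 2 \<le> u z" using za pa by (simp add: \<phi>_def)
    then have "\<beta> * (M - \<eta> / 2) \<le> \<beta> * u z" using beta by (intro mult_left_mono) auto
    then have "\<beta> * M - \<eta> * (\<beta> / 2) \<le> \<beta> * u z" by (simp add: algebra_simps)
    also have "\<dots> \<le> E + \<eta> * (?d * B * (?d * C)) + \<eta> * (?d\<^sup>2 * (B * C)) + \<eta> * (B * C)"
      unfolding eq[of z] using gE[of z] T1 T2 T3 by linarith
    finally show ?thesis by (simp add: D_def distrib_left)
  qed
  have D0: "D \<ge> 0" using beta C0 B_nonneg by (simp add: D_def)
  have "\<beta> * M \<le> E"
  proof (rule field_le_epsilon)
    fix e :: real assume e: "e > 0"
    have "e / (D + 1) * D \<le> e" using e D0 by (simp add: field_simps)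
    then show "\<beta> * M \<le> E + e" using key[of "e / (D + 1)"] e D0 by simp
  qed
  moreover have "\<beta> * u x \<le> \<beta> * M" using uM beta by (intro mult_left_mono) auto
  ultimately have "\<beta> * u x \<le> E" by linarith
  then show ?thesis using beta by (simp add: field_simps)
qed

lemma solution_bound:
  assumes sol: "solves g u G H" and gE: "\<And>x. \<bar>g x\<bar> \<le> E"
  shows "\<bar>u x\<bar> \<le> E / \<beta>"
proof -
  have tu: "tame u G H" and eq: "\<And>x. \<beta> * u x = g x + b x \<bullet> G x + frobenius_prod (Do x) (H x) - Df x * frac_laplacian \<alpha> u x"
    using sol unfolding solves_def by auto
  \<comment> \<open>The lower bound is the upper bound for \<open>- u\<close>, which solves the equation with source \<open>- g\<close>.\<close>
  note n = frac_laplacian_cmult[OF alpha tu, of "-1"]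
  have "\<beta> * ((-1) * u x) = (-1) * g x + b x \<bullet> ((-1) *\<^sub>R G x) + frobenius_prod (Do x) ((-1) *\<^sub>R H x)
      - Df x * frac_laplacian \<alpha> (\<lambda>x. (-1) * u x) x" for x
    unfolding n(1) frobenius_prod_scaleR_right using eq[of x] by (simp add: algebra_simps)
  then have s: "solves (\<lambda>x. (-1) * g x) (\<lambda>x. (-1) * u x) (\<lambda>x. (-1) *\<^sub>R G x) (\<lambda>x. (-1) *\<^sub>R H x)"
    unfolding solves_def using n(2) by blast
  have "g x \<le> E" "(-1) * g x \<le> E" for x using gE[of x] by auto
  then show ?thesis using maximum_principle[OF sol, of E x] maximum_principle[OF s, of E x] by (simp add: abs_le_iff)
qed

section \<open>Schauder estimate\<close>

lemma frozen_elliptic: "elliptic_matrix c ((real CARD('n))\<^sup>2 * B) (Do x)"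
proof -
  let ?d = "real CARD('n)"
  have Ab: "\<bar>Do x $ i $ j\<bar> \<le> B" for i j using Do_bound unfolding holder_bound_def by blast
  have d1: "1 \<le> ?d" by (simp add: Suc_le_eq)
  have "(\<Sum>i\<in>UNIV. Do x $ i $ i) \<le> (\<Sum>i\<in>(UNIV::'n set). B)"
    by (intro sum_mono) (use Ab in \<open>auto simp: abs_le_iff\<close>)
  also have "\<dots> = 1 * (?d * B)" by simp
  also have "\<dots> \<le> ?d * (?d * B)" using d1 B_nonneg by (intro mult_right_mono) auto
  finally have tr: "(\<Sum>i\<in>UNIV. Do x $ i $ i) \<le> ?d\<^sup>2 * B" by (simp add: power2_eq_square mult_ac)
  have "norm (Do x *v v) \<le> ?d\<^sup>2 * B * norm v" for v
  proof -
    have "norm (Do x *v v) \<le> (\<Sum>i\<in>UNIV. \<bar>(Do x *v v) $ i\<bar>)" by (rule norm_le_l1_cart)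
    also have "\<dots> \<le> (\<Sum>i\<in>(UNIV::'n set). ?d * B * norm v)"
      unfolding matrix_vector_mul_component by (intro sum_mono inner_bound Ab)
    finally show ?thesis by (simp add: power2_eq_square mult_ac)
  qed
  then show ?thesis unfolding elliptic_matrix_def using Do_sym Do_elliptic tr by blast
qed

text \<open>Freezing the coefficients at \<open>x\<close> leaves the error \<open>(D\<^sub>o(x) - D\<^sub>o(v)) : (H(v) - H(w))\<close>, a product of
two Hoelder increments and hence a small multiple of \<open>K \<bar>x - y\<bar>\<^bsup>\<gamma>\<^esup>\<close> at distances below some \<open>r0\<close>, and the
error \<open>(D\<^sub>o(w) - D\<^sub>o(v)) : H(w)\<close>, a multiple of \<open>P \<bar>x - y\<bar>\<^bsup>\<gamma>\<^esup>\<close>. At larger distances the bound \<open>P\<close> on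
the Hessian suffices.\<close>

lemma schauder_step:
  "\<exists>C\<ge>0. \<forall>u G H K P q. has_hessian u G H \<longrightarrow> 0 < K \<longrightarrow> 0 \<le> q \<longrightarrow>
     hessian_holder \<gamma> K H \<longrightarrow>
     hessian_le P H \<longrightarrow>
     (\<forall>x y. \<bar>frobenius_prod (Do x) (H x) - frobenius_prod (Do y) (H y)\<bar> \<le> q * norm (x - y) powr \<gamma>) \<longrightarrow>
     hessian_holder \<gamma> (K / 4 + C * (P + q)) H"
proof -
  let ?d = "real CARD('n)"
  define m where "m = ?d\<^sup>2 * B"
  have m0: "m \<ge> 0" using B_nonneg by (simp add: m_def)
  have eighth: "0 < (1/8 :: real)" by simp
  obtain N C0 where N: "N \<ge> 1" and C0: "C0 \<ge> 0" and osc: "\<forall>(A::real^'n^'n) u G H K q x h i j.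
     elliptic_matrix c m A \<longrightarrow> has_hessian u G H \<longrightarrow> 0 < K \<longrightarrow> 0 \<le> q \<longrightarrow>
     hessian_holder \<gamma> K H \<longrightarrow>
     (\<forall>y z. norm (y - x) \<le> N * norm h \<longrightarrow> norm (z - x) \<le> N * norm h \<longrightarrow>
        \<bar>frobenius_prod A (H y) - frobenius_prod A (H z)\<bar> \<le> q) \<longrightarrow>
     \<bar>H (x + h) $ i $ j - H x $ i $ j\<bar> \<le> 1/8 * K * norm h powr \<gamma> + C0 * q"
    using hessian_oscillation[OF gamma c m0 eighth, where 'n='n] by (elim exE conjE)
  define L where "L = (2 * N) powr \<gamma>"
  have L0: "L > 0" using N by (simp add: L_def)
  \<comment> \<open>This value of \<open>r0\<^bsup>\<gamma>\<^esup>\<close> makes the freezing error at most \<open>K / 8\<close>.\<close>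
  define \<tau> where "\<tau> = 1 / (8 * (C0 * L * m * L + 1))"
  have tau: "\<tau> > 0" using C0 L0 m0 by (simp add: \<tau>_def add_nonneg_pos)
  define r0 where "r0 = \<tau> powr (1 / \<gamma>)"
  have r0: "r0 > 0" "r0 powr \<gamma> = \<tau>" using tau gamma by (auto simp: r0_def powr_powr)
  have smallness: "C0 * L * m * L * \<tau> \<le> 1/8"
  proof -
    have "0 \<le> C0 * L * m * L" using C0 L0 m0 by simp
    then show ?thesis unfolding \<tau>_def by (simp add: divide_simps)
  qed
  define C where "C = C0 * L * (1 + m) + 2 / \<tau>"
  have Cn: "C \<ge> 0" using C0 L0 m0 tau by (simp add: C_def)
  have main: "\<bar>H y $ i $ j - H x $ i $ j\<bar> \<le> (K / 4 + C * (P + q)) * norm (y - x) powr \<gamma>"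
    if u: "has_hessian u G H" and K: "0 < K" and q: "0 \<le> q"
      and HK: "\<And>x y i j. \<bar>H x $ i $ j - H y $ i $ j\<bar> \<le> K * norm (x - y) powr \<gamma>"
      and P: "\<And>x i j. \<bar>H x $ i $ j\<bar> \<le> P"
      and F: "\<And>x y. \<bar>frobenius_prod (Do x) (H x) - frobenius_prod (Do y) (H y)\<bar> \<le> q * norm (x - y) powr \<gamma>"
    for u :: "real^'n \<Rightarrow> real" and G H K P q x y i j
  proof -
    define h where "h = y - x"
    define r where "r = norm h powr \<gamma>"
    have r: "r \<ge> 0" by (simp add: r_def)
    have P0: "P \<ge> 0" using P[of 0 undefined undefined] by linarith
    show ?thesis
    proof (cases "norm h \<le> r0")
      case True
      have rt: "r \<le> \<tau>" unfolding r_def r0(2)[symmetric] using True gamma by (intro powr_mono2) auto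
      have pw: "t powr \<gamma> \<le> L * r" if "0 \<le> t" "t \<le> 2 * N * norm h" for t
      proof -
        have "t powr \<gamma> \<le> (2 * N * norm h) powr \<gamma>" using that gamma by (intro powr_mono2) auto
        also have "\<dots> = L * r" using N by (simp add: L_def r_def powr_mult)
        finally show ?thesis .
      qed
      define Q where "Q = L * r * (q + m * L * \<tau> * K + m * P)"
      have Q0: "Q \<ge> 0" unfolding Q_def using L0 r q m0 tau K P0 by (intro mult_nonneg_nonneg add_nonneg_nonneg) auto
      have "\<bar>frobenius_prod (Do x) (H v) - frobenius_prod (Do x) (H w)\<bar> \<le> Q"
        if v: "norm (v - x) \<le> N * norm h" and w: "norm (w - x) \<le> N * norm h" for v w
      proof -
        have vw: "norm (v - w) \<le> 2 * N * norm h"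
          using norm_triangle_ineq4[of "v - x" "w - x"] v w by simp
        have vx: "norm (x - v) \<le> 2 * N * norm h"
        proof -
          have "0 \<le> N * norm h" using N by (intro mult_nonneg_nonneg) auto
          then show ?thesis using v unfolding norm_minus_commute[of x v] mult.assoc by linarith
        qed
        have e: "frobenius_prod (Do x) (H v) - frobenius_prod (Do x) (H w) =
            frobenius_prod (Do x - Do v) (H v - H w) + (frobenius_prod (Do v) (H v) - frobenius_prod (Do w) (H w))
            + frobenius_prod (Do w - Do v) (H w)"
          by (simp add: frobenius_prod_diff_left frobenius_prod_diff_right)
        have D: "\<bar>(Do v' - Do w') $ i $ j\<bar> \<le> B * norm (v' - w') powr \<gamma>" for v' w' i j
          using Do_bound[of i j] unfolding holder_bound_def by simp
        have "\<bar>frobenius_prod (Do x - Do v) (H v - H w)\<bar> \<le> ?d\<^sup>2 * (B * (L * \<tau>) * (K * (L * r)))"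
        proof (rule frobenius_prod_bound)
          show "\<bar>(Do x - Do v) $ i $ j\<bar> \<le> B * (L * \<tau>)" for i j
          proof (rule order_trans[OF D])
            have "norm (x - v) powr \<gamma> \<le> L * r" by (rule pw) (use vx in auto)
            also have "\<dots> \<le> L * \<tau>" using rt L0 by (intro mult_left_mono) auto
            finally show "B * norm (x - v) powr \<gamma> \<le> B * (L * \<tau>)" using B_nonneg by (rule mult_left_mono)
          qed
          show "\<bar>(H v - H w) $ i $ j\<bar> \<le> K * (L * r)" for i j
            using order_trans[OF HK[of v i j w] mult_left_mono[OF pw[OF norm_ge_zero vw]]] K by simp
        qed
        moreover have "\<bar>frobenius_prod (Do w - Do v) (H w)\<bar> \<le> ?d\<^sup>2 * (B * (L * r) * P)"
        proof (rule frobenius_prod_bound[OF _ P])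
          show "\<bar>(Do w - Do v) $ i $ j\<bar> \<le> B * (L * r)" for i j
            using order_trans[OF D[of w v i j] mult_left_mono[OF pw[OF norm_ge_zero] B_nonneg]] vw
            by (simp add: norm_minus_commute)
        qed
        moreover have "\<bar>frobenius_prod (Do v) (H v) - frobenius_prod (Do w) (H w)\<bar> \<le> q * (L * r)"
          by (rule order_trans[OF F mult_left_mono[OF pw[OF norm_ge_zero vw] q]])
        moreover have "?d\<^sup>2 * (B * (L * \<tau>) * (K * (L * r))) + q * (L * r) + ?d\<^sup>2 * (B * (L * r) * P) = Q"
          by (simp add: Q_def m_def algebra_simps)
        ultimately show ?thesis unfolding e by linarith
      qed
      then have "\<bar>H (x + h) $ i $ j - H x $ i $ j\<bar> \<le> 1/8 * K * norm h powr \<gamma> + C0 * Q"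
        using frozen_elliptic[of x, folded m_def] u K Q0 HK by (intro osc[rule_format]) auto
      also have "\<dots> = (K / 8 + C0 * L * m * L * \<tau> * K + C0 * L * (q + m * P)) * r"
        by (simp add: Q_def r_def algebra_simps)
      also have "\<dots> \<le> (K / 4 + C * (P + q)) * r"
      proof (rule mult_right_mono[OF _ r])
        have 1: "C0 * L * m * L * \<tau> * K \<le> 1/8 * K" using smallness K by (intro mult_right_mono) auto
        have "m * P \<le> (1 + m) * P" "q \<le> (1 + m) * q" using P0 q m0 by (auto simp: algebra_simps)
        then have "q + m * P \<le> (1 + m) * (P + q)" by (simp add: algebra_simps)
        then have "C0 * L * (q + m * P) \<le> C0 * L * ((1 + m) * (P + q))" using C0 L0 by (intro mult_left_mono) auto
        also have "\<dots> \<le> C * (P + q)"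
          using P0 q tau by (simp add: C_def distrib_right mult.assoc)
        finally show "K / 8 + C0 * L * m * L * \<tau> * K + C0 * L * (q + m * P) \<le> K / 4 + C * (P + q)" using 1 by linarith
      qed
      finally show ?thesis by (simp add: h_def r_def)
    next
      case False
      have "\<tau> \<le> r" unfolding r_def r0(2)[symmetric] using False r0 gamma by (intro powr_mono2) auto
      then have "2 * P \<le> 2 * P * (r / \<tau>)" using tau P0 by (simp add: field_simps mult_left_mono)
      also have "\<dots> = (2 / \<tau>) * P * r" by simp
      also have "\<dots> \<le> (K / 4 + C * (P + q)) * r"
      proof (rule mult_right_mono[OF _ r])
        have "(2 / \<tau>) * P \<le> C * (P + q)"
          unfolding C_def using C0 L0 m0 tau P0 q by (intro mult_mono) auto
        then show "(2 / \<tau>) * P \<le> K / 4 + C * (P + q)" using K by linarith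
      qed
      finally show ?thesis using P[of y i j] P[of x i j] by (simp add: h_def r_def)
    qed
  qed
  show ?thesis by (rule exI[of _ C]) (use Cn main in blast)
qed

end

text \<open>The qualitative counterpart of \<open>c2_bound\<close>: it provides the finite starting value that the absorption
arguments need.\<close>

definition regular :: "real \<Rightarrow> (real^'n::finite \<Rightarrow> real) \<Rightarrow> (real^'n \<Rightarrow> real^'n) \<Rightarrow> (real^'n \<Rightarrow> real^'n^'n) \<Rightarrow> bool" where
  "regular \<gamma> u G H \<longleftrightarrow> has_hessian u G H \<and> (\<exists>S. \<forall>x. \<bar>u x\<bar> \<le> S) \<and>
     (\<exists>K\<ge>0. \<forall>x y i j. \<bar>H x $ i $ j - H y $ i $ j\<bar> \<le> K * norm (x - y) powr \<gamma>)"

definition c2_bound ::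
    "real \<Rightarrow> real \<Rightarrow> real \<Rightarrow> (real^'n::finite \<Rightarrow> real) \<Rightarrow> (real^'n \<Rightarrow> real^'n) \<Rightarrow> (real^'n \<Rightarrow> real^'n^'n) \<Rightarrow> bool" where
  "c2_bound \<gamma> \<alpha> Y u G H \<longleftrightarrow> holder_bound \<gamma> Y u \<and> (\<forall>j. holder_bound \<gamma> Y (\<lambda>x. G x $ j)) \<and>
     (\<forall>i j. holder_bound \<gamma> Y (\<lambda>x. H x $ i $ j)) \<and> holder_bound \<gamma> Y (frac_laplacian \<alpha> u)"

lemma c2_bound_mono: "c2_bound \<gamma> \<alpha> X u G H \<Longrightarrow> X \<le> Y \<Longrightarrow> c2_bound \<gamma> \<alpha> Y u G H"
  unfolding c2_bound_def using holder_bound_mono by blast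

text \<open>By interpolation the Hoelder seminorm of the Hessian and the supremum control everything else.\<close>

lemma c2_bound_from_hessian:
  fixes \<gamma> \<alpha> :: real
  assumes g: "0 < \<gamma>" "\<gamma> < 1" and al: "0 < \<alpha>" "\<alpha> < 1"
  shows "\<exists>C\<ge>0. \<forall>(u :: real^'n::finite \<Rightarrow> real) G H S K. has_hessian u G H \<longrightarrow> (\<forall>x. \<bar>u x\<bar> \<le> S) \<longrightarrow> 0 \<le> K \<longrightarrow>
     hessian_holder \<gamma> K H \<longrightarrow> c2_bound \<gamma> \<alpha> (K + C * S) u G H"
proof -
  obtain C where C: "C \<ge> 0" and lo: "\<forall>(u :: real^'n \<Rightarrow> real) G H S K. has_hessian u G H \<longrightarrow> (\<forall>x. \<bar>u x\<bar> \<le> S) \<longrightarrow> 0 \<le> K \<longrightarrow>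
     hessian_holder \<gamma> K H \<longrightarrow>
     lower_order_bound \<gamma> \<alpha> (1 * K + C * S) u G H"
    using lower_order_interpolation[OF g al zero_less_one, where 'n='n] by (elim exE conjE)
  have "c2_bound \<gamma> \<alpha> (K + C * S) u G H"
    if u: "has_hessian u G H" and S: "\<forall>x. \<bar>u x\<bar> \<le> S" and K: "0 \<le> K"
     and HK: "hessian_holder \<gamma> K H" for u :: "real^'n \<Rightarrow> real" and G H S K
  proof -
    have S0: "S \<ge> 0" using S by (meson abs_ge_zero order_trans)
    note l = lo[rule_format, OF u S[rule_format] K HK[rule_format], unfolded mult_1]
    have le: "K * r \<le> (K + C * S) * r" if "r \<ge> 0" for r using that C S0 by (intro mult_right_mono) auto
    have "\<bar>H x $ i $ j - H y $ i $ j\<bar> \<le> (K + C * S) * norm (x - y) powr \<gamma>" for x y i j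
      by (rule order_trans[OF HK[rule_format] le[OF powr_ge_zero]])
    then have "holder_bound \<gamma> (K + C * S) (\<lambda>x. H x $ i $ j)" for i j
      using l unfolding holder_bound_def by simp
    then show ?thesis unfolding c2_bound_def using l by simp
  qed
  then show ?thesis using C by blast
qed

lemma regular_c2_bound:
  assumes "0 < \<gamma>" "\<gamma> < 1" "0 < \<alpha>" "\<alpha> < 1" "regular \<gamma> u G H"
  shows "\<exists>Y>0. c2_bound \<gamma> \<alpha> Y u G H"
proof -
  obtain S K where u: "has_hessian u G H" "\<forall>x. \<bar>u x\<bar> \<le> S" "0 \<le> K"
    "hessian_holder \<gamma> K H"
    using assms(5) unfolding regular_def by blast
  then obtain Y where "c2_bound \<gamma> \<alpha> Y u G H" using c2_bound_from_hessian[OF assms(1-4)] by blast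
  then have "c2_bound \<gamma> \<alpha> (max Y 1) u G H" by (rule c2_bound_mono) simp
  then show ?thesis by (intro exI[of _ "max Y 1"]) auto
qed

lemma c2_bound_tame: "has_hessian u G H \<Longrightarrow> c2_bound \<gamma> \<alpha> Y u G H \<Longrightarrow> tame u G H"
  unfolding tame_def by (intro conjI exI[of _ Y]) (simp_all add: c2_bound_def holder_bound_def)

lemma regular_diff:
  assumes "regular \<gamma> u G H" "regular \<gamma> u' G' H'"
  shows "regular \<gamma> (\<lambda>x. u x - u' x) (\<lambda>x. G x - G' x) (\<lambda>x. H x - H' x)"
proof -
  obtain S K S' K' where u: "has_hessian u G H" "has_hessian u' G' H'"
    and b: "\<And>x. \<bar>u x\<bar> \<le> S" "\<And>x. \<bar>u' x\<bar> \<le> S'" "K \<ge> 0" "K' \<ge> 0"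
    "\<And>x y i j. \<bar>H x $ i $ j - H y $ i $ j\<bar> \<le> K * norm (x - y) powr \<gamma>"
    "\<And>x y i j. \<bar>H' x $ i $ j - H' y $ i $ j\<bar> \<le> K' * norm (x - y) powr \<gamma>"
    using assms unfolding regular_def by blast
  have "\<bar>u x - u' x\<bar> \<le> S + S'" for x using b(1,2)[of x] by linarith
  moreover have "\<bar>(H x - H' x) $ i $ j - (H y - H' y) $ i $ j\<bar> \<le> (K + K') * norm (x - y) powr \<gamma>" for x y i j
    using b(5,6)[of x i j y] by (simp add: distrib_right)
  ultimately show ?thesis unfolding regular_def using has_hessian_diff[OF u] b(3,4) by (meson add_nonneg_nonneg)
qed

lemma c2_bound_diff:
  assumes al: "0 < \<alpha>" "\<alpha> < 1" and t: "tame u G H" "tame u' G' H'"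
    and b: "c2_bound \<gamma> \<alpha> X u G H" "c2_bound \<gamma> \<alpha> Y u' G' H'"
  shows "c2_bound \<gamma> \<alpha> (X + Y) (\<lambda>x. u x - u' x) (\<lambda>x. G x - G' x) (\<lambda>x. H x - H' x)"
proof -
  have f: "frac_laplacian \<alpha> (\<lambda>x. u x - u' x) = (\<lambda>x. frac_laplacian \<alpha> u x - frac_laplacian \<alpha> u' x)"
    using frac_laplacian_diff(1)[OF al t] by blast
  show ?thesis using b unfolding c2_bound_def f by (auto intro!: holder_bound_diff)
qed

lemma holder_bound_first_order:
  fixes b G :: "real^'n::finite \<Rightarrow> real^'n"
  assumes b: "\<And>j. holder_bound \<gamma> X (\<lambda>x. b x $ j)" and G: "\<And>j. holder_bound \<gamma> Y (\<lambda>x. G x $ j)"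
  shows "holder_bound \<gamma> (real CARD('n) * (2 * X * Y)) (\<lambda>x. b x \<bullet> G x)"
  unfolding inner_vec_def inner_real_def by (intro holder_bound_sum holder_bound_mult b G) simp

lemma holder_bound_second_order:
  fixes A H :: "real^'n::finite \<Rightarrow> real^'n^'n"
  assumes A: "\<And>i j. holder_bound \<gamma> X (\<lambda>x. A x $ i $ j)" and H: "\<And>i j. holder_bound \<gamma> Y (\<lambda>x. H x $ i $ j)"
  shows "holder_bound \<gamma> (real CARD('n) * (real CARD('n) * (2 * X * Y))) (\<lambda>x. frobenius_prod (A x) (H x))"
  unfolding frobenius_prod_def by (intro holder_bound_sum holder_bound_mult A H) simp_all

context elliptic_coefficients
begin

text \<open>The equation expresses \<open>D\<^sub>o : \<nabla>\<^sup>2u\<close> through the source and lower order terms. By interpolation these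
contribute at most a small multiple of the Hoelder constant \<open>K\<close> of the Hessian, so any admissible \<open>K\<close> may be
replaced by \<open>K / 2\<close> plus a multiple of the data.\<close>

lemma schauder_estimate:
  "\<exists>C\<ge>0. \<forall>g u G H S E. solves g u G H \<longrightarrow> regular \<gamma> u G H \<longrightarrow> (\<forall>x. \<bar>u x\<bar> \<le> S) \<longrightarrow> 0 < E \<longrightarrow> holder_bound \<gamma> E g \<longrightarrow>
     hessian_holder \<gamma> (C * (S + E)) H"
proof -
  let ?d = "real CARD('n)"
  obtain C1 where C1: "C1 \<ge> 0" and ss: "\<forall>u G H K P q. has_hessian u G H \<longrightarrow> 0 < K \<longrightarrow> 0 \<le> q \<longrightarrow>
     hessian_holder \<gamma> K H \<longrightarrow>
     hessian_le P H \<longrightarrow>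
     (\<forall>x y. \<bar>frobenius_prod (Do x) (H x) - frobenius_prod (Do y) (H y)\<bar> \<le> q * norm (x - y) powr \<gamma>) \<longrightarrow>
     hessian_holder \<gamma> (K / 4 + C1 * (P + q)) H"
    using schauder_step by (elim exE conjE)
  define D where "D = \<beta> + ?d * (2 * B) + 2 * B"
  have D0: "D \<ge> 0" using beta B_nonneg by (simp add: D_def)
  define \<eta> where "\<eta> = 1 / (4 * (C1 * (1 + D) + 1))"
  have eta: "\<eta> > 0" using C1 D0 by (simp add: \<eta>_def add_nonneg_pos)
  have small: "C1 * (1 + D) * \<eta> \<le> 1/4"
  proof -
    have "0 \<le> C1 * (1 + D)" using C1 D0 by simp
    then show ?thesis unfolding \<eta>_def by (simp add: divide_simps)
  qed
  obtain C2 where C2: "C2 \<ge> 0" and lo: "\<forall>(u :: real^'n \<Rightarrow> real) G H S K. has_hessian u G H \<longrightarrow> (\<forall>x. \<bar>u x\<bar> \<le> S) \<longrightarrow> 0 \<le> K \<longrightarrow>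
     hessian_holder \<gamma> K H \<longrightarrow>
     lower_order_bound \<gamma> \<alpha> (\<eta> * K + C2 * S) u G H"
    using lower_order_interpolation[OF gamma alpha eta, where 'n='n] by (elim exE conjE)
  define C where "C = C1 * (1 + D) * C2 + C1 + 1"
  have C0: "C > 0" using C1 C2 D0 by (simp add: C_def add_nonneg_pos)
  have main: "hessian_holder \<gamma> (3 * (C * (S + E))) H"
    if sol: "solves g u G H" and reg: "regular \<gamma> u G H" and S: "\<forall>x. \<bar>u x\<bar> \<le> S" and E: "0 < E" and gE: "holder_bound \<gamma> E g" for g u G H S E
  proof -
    have S0: "S \<ge> 0" using S by (meson abs_ge_zero order_trans)
    have eq: "\<And>x. \<beta> * u x = g x + b x \<bullet> G x + frobenius_prod (Do x) (H x) - Df x * frac_laplacian \<alpha> u x"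
      using sol unfolding solves_def by auto
    have hu: "has_hessian u G H" using reg unfolding regular_def by blast
    obtain K0 where K0: "K0 \<ge> 0" "hessian_holder \<gamma> K0 H"
      using reg unfolding regular_def by blast
    have mono: "hessian_holder \<gamma> k' H"
      if "hessian_holder \<gamma> k H" "k \<le> k'" for k k'
      using that by (meson mult_right_mono order_trans powr_ge_zero)
    show ?thesis
    proof (rule halving_iteration[of "\<lambda>k. hessian_holder \<gamma> k H"])
      show "hessian_holder \<gamma> k' H"
        if "hessian_holder \<gamma> k H" "k \<le> k'" for k k'
        by (rule mono[OF that])
      show "hessian_holder \<gamma> (K0 + 1) H" by (rule mono[OF K0(2)]) simp
      show "0 < K0 + 1" using K0 by simp
      show "0 < C * (S + E)" using C0 S0 E by simp
      fix K assume K: "0 < K" and HK: "hessian_holder \<gamma> K H"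
      define Z where "Z = \<eta> * K + C2 * S"
      have l: "holder_bound \<gamma> Z u" "\<And>j. holder_bound \<gamma> Z (\<lambda>x. G x $ j)" "\<forall>x i j. \<bar>H x $ i $ j\<bar> \<le> Z" "holder_bound \<gamma> Z (frac_laplacian \<alpha> u)"
        using lo[rule_format, OF hu S[rule_format] less_imp_le[OF K] HK[rule_format]] unfolding Z_def by auto
      have Z0: "Z \<ge> 0" using l(1) by (rule holder_bound_nonneg)
      have "holder_bound \<gamma> (((\<bar>\<beta>\<bar> * Z + E) + ?d * (2 * B * Z)) + 2 * B * Z)
          (\<lambda>x. ((\<beta> * u x - g x) - b x \<bullet> G x) + Df x * frac_laplacian \<alpha> u x)"
        by (intro holder_bound_add holder_bound_diff holder_bound_cmult holder_bound_first_order holder_bound_mult l gE b_bound Df_bound)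
      moreover have "(\<lambda>x. ((\<beta> * u x - g x) - b x \<bullet> G x) + Df x * frac_laplacian \<alpha> u x) = (\<lambda>x. frobenius_prod (Do x) (H x))"
        using eq by (intro ext) (simp add: algebra_simps)
      moreover have "((\<bar>\<beta>\<bar> * Z + E) + ?d * (2 * B * Z)) + 2 * B * Z = E + D * Z"
        using beta by (simp add: D_def algebra_simps)
      ultimately have F: "holder_bound \<gamma> (E + D * Z) (\<lambda>x. frobenius_prod (Do x) (H x))" by simp
      have "hessian_holder \<gamma> (K / 4 + C1 * (Z + (E + D * Z))) H"
        using ss hu K HK l(3) F holder_bound_nonneg[OF F] unfolding holder_bound_def by blast
      moreover have "K / 4 + C1 * (Z + (E + D * Z)) \<le> K / 2 + C * (S + E)"
      proof -
        have "C1 * (Z + (E + D * Z)) = C1 * (1 + D) * \<eta> * K + C1 * (1 + D) * C2 * S + C1 * E"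
          by (simp add: Z_def algebra_simps)
        moreover have "C1 * (1 + D) * \<eta> * K \<le> 1/4 * K" using small K by (intro mult_right_mono) auto
        moreover have "C1 * (1 + D) * C2 * S \<le> C * S" using S0 C1 by (intro mult_right_mono) (auto simp: C_def)
        moreover have "C1 * E \<le> C * E" using E C1 C2 D0 by (intro mult_right_mono) (auto simp: C_def)
        ultimately show ?thesis by (simp add: distrib_left)
      qed
      ultimately show "hessian_holder \<gamma> (K / 2 + C * (S + E)) H"
        by (rule mono)
    qed
  qed
  show ?thesis
    by (rule exI[of _ "3 * C"]) (use main C0 in \<open>auto simp: mult.assoc\<close>)
qed

section \<open>A priori estimate and stability\<close>

lemma a_priori_estimate:
  "\<exists>C>0. \<forall>g u G H E. solves g u G H \<longrightarrow> regular \<gamma> u G H \<longrightarrow> 0 < E \<longrightarrow> holder_bound \<gamma> E g \<longrightarrow> c2_bound \<gamma> \<alpha> (C * E) u G H"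
proof -
  obtain C1 where C1: "C1 \<ge> 0" and sch: "\<forall>g u G H S E. solves g u G H \<longrightarrow> regular \<gamma> u G H \<longrightarrow> (\<forall>x. \<bar>u x\<bar> \<le> S) \<longrightarrow> 0 < E \<longrightarrow> holder_bound \<gamma> E g \<longrightarrow>
     hessian_holder \<gamma> (C1 * (S + E)) H"
    using schauder_estimate by (elim exE conjE)
  obtain C2 where C2: "C2 \<ge> 0" and c2: "\<forall>(u :: real^'n \<Rightarrow> real) G H S K. has_hessian u G H \<longrightarrow> (\<forall>x. \<bar>u x\<bar> \<le> S) \<longrightarrow> 0 \<le> K \<longrightarrow>
     hessian_holder \<gamma> K H \<longrightarrow> c2_bound \<gamma> \<alpha> (K + C2 * S) u G H"
    using c2_bound_from_hessian[OF gamma alpha, where 'n='n] by (elim exE conjE)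
  define C where "C = C1 * (1 / \<beta> + 1) + C2 / \<beta> + 1"
  have C0: "C > 0" using C1 C2 beta by (simp add: C_def add_nonneg_pos)
  have "c2_bound \<gamma> \<alpha> (C * E) u G H"
    if sol: "solves g u G H" and reg: "regular \<gamma> u G H" and E: "0 < E" and gE: "holder_bound \<gamma> E g" for g u G H E
  proof -
    have S: "\<forall>x. \<bar>u x\<bar> \<le> E / \<beta>" using solution_bound[OF sol, of E] gE unfolding holder_bound_def by blast
    have hu: "has_hessian u G H" using reg unfolding regular_def by blast
    have HK: "hessian_holder \<gamma> (C1 * (E / \<beta> + E)) H"
      using sch sol reg S E gE by blast
    have "0 \<le> C1 * (E / \<beta> + E)" using C1 E beta by simp
    then have "c2_bound \<gamma> \<alpha> (C1 * (E / \<beta> + E) + C2 * (E / \<beta>)) u G H" using c2 hu S HK by blast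
    then show ?thesis by (rule c2_bound_mono) (use E in \<open>simp add: C_def algebra_simps\<close>)
  qed
  then show ?thesis using C0 by blast
qed

text \<open>A bound \<open>Y\<close> for \<open>W = V - V'\<close> gives the bound \<open>X + Y\<close> for \<open>V' = V - W\<close>, hence a source of size
\<open>D \<epsilon> (X + Y)\<close> in the equation of \<open>W\<close>, hence the new bound \<open>C1 D \<epsilon> (X + Y)\<close> for \<open>W\<close>. The choice of
\<open>\<epsilon>0\<close> makes this at most \<open>Y / 2 + C1 D X \<epsilon>\<close>.\<close>

lemma stability:
  assumes rE: "\<exists>E. holder_bound \<gamma> E r"
  shows "\<exists>\<epsilon>0>0. \<exists>C>0. \<forall>\<epsilon> b' Do' Df' V G H V' G' H'. 0 < \<epsilon> \<longrightarrow> \<epsilon> \<le> \<epsilon>0 \<longrightarrow>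
     (\<forall>i. holder_bound \<gamma> \<epsilon> (\<lambda>x. (b x - b' x) $ i)) \<longrightarrow>
     (\<forall>i j. holder_bound \<gamma> \<epsilon> (\<lambda>x. (Do x - Do' x) $ i $ j)) \<longrightarrow>
     holder_bound \<gamma> \<epsilon> (\<lambda>x. Df x - Df' x) \<longrightarrow> regular \<gamma> V G H \<longrightarrow> regular \<gamma> V' G' H' \<longrightarrow>
     policy_equation \<alpha> \<beta> r b Do Df V G H \<longrightarrow>
     policy_equation \<alpha> \<beta> r b' Do' Df' V' G' H' \<longrightarrow>
     c2_bound \<gamma> \<alpha> (C * \<epsilon>) (\<lambda>x. V x - V' x) (\<lambda>x. G x - G' x) (\<lambda>x. H x - H' x)"
proof -
  let ?d = "real CARD('n)"
  obtain C1 where C1: "C1 > 0" and ap: "\<forall>g u G H E. solves g u G H \<longrightarrow> regular \<gamma> u G H \<longrightarrow> 0 < E \<longrightarrow> holder_bound \<gamma> E g \<longrightarrow> c2_bound \<gamma> \<alpha> (C1 * E) u G H"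
    using a_priori_estimate by (elim exE conjE)
  obtain E0 where "holder_bound \<gamma> E0 r" using rE by blast
  then have Er: "holder_bound \<gamma> (max E0 1) r" by (rule holder_bound_mono) simp
  define X where "X = C1 * max E0 1"
  have X: "X > 0" using C1 by (simp add: X_def)
  define D where "D = 2 * (?d + ?d * ?d + 1)"
  have D: "D > 0" by (simp add: D_def add_nonneg_pos)
  define \<epsilon>0 where "\<epsilon>0 = 1 / (2 * (C1 * D))"
  have e0: "\<epsilon>0 > 0" using C1 D by (simp add: \<epsilon>0_def)
  define C where "C = 3 * (C1 * D * X)"
  have C: "C > 0" using C1 D X by (simp add: C_def)
  have main: "c2_bound \<gamma> \<alpha> (C * \<epsilon>) (\<lambda>x. V x - V' x) (\<lambda>x. G x - G' x) (\<lambda>x. H x - H' x)"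
    if eps: "0 < \<epsilon>" "\<epsilon> \<le> \<epsilon>0" and db: "\<And>i. holder_bound \<gamma> \<epsilon> (\<lambda>x. (b x - b' x) $ i)"
     and dDo: "\<And>i j. holder_bound \<gamma> \<epsilon> (\<lambda>x. (Do x - Do' x) $ i $ j)"
     and dDf: "holder_bound \<gamma> \<epsilon> (\<lambda>x. Df x - Df' x)" and V: "regular \<gamma> V G H" and V': "regular \<gamma> V' G' H'"
     and eq: "policy_equation \<alpha> \<beta> r b Do Df V G H"
     and eq': "policy_equation \<alpha> \<beta> r b' Do' Df' V' G' H'"
    for \<epsilon> b' Do' Df' V G H V' G' H'
  proof -
    define W where "W = (\<lambda>x. V x - V' x)"
    define GW where "GW = (\<lambda>x. G x - G' x)"
    define HW where "HW = (\<lambda>x. H x - H' x)"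
    have W: "regular \<gamma> W GW HW" unfolding W_def GW_def HW_def by (rule regular_diff[OF V V'])
    have tame: "tame u G H" if "regular \<gamma> u G H" for u :: "real^'n \<Rightarrow> real" and G H
      using regular_c2_bound[OF gamma alpha that] that c2_bound_tame unfolding regular_def by blast
    have solV: "solves r V G H" unfolding solves_def using tame[OF V] eq by blast
    have bV: "c2_bound \<gamma> \<alpha> X V G H"
      unfolding X_def using ap[rule_format, OF solV V _ Er] by simp
    define g where "g = (\<lambda>x. ((b x - b' x) \<bullet> G' x + frobenius_prod (Do x - Do' x) (H' x)) - (Df x - Df' x) * frac_laplacian \<alpha> V' x)"
    have FW: "frac_laplacian \<alpha> W x = frac_laplacian \<alpha> V x - frac_laplacian \<alpha> V' x" for x
      unfolding W_def by (rule frac_laplacian_diff(1)[OF alpha tame[OF V] tame[OF V']])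
    have solW: "solves g W GW HW"
      unfolding solves_def
    proof (intro conjI allI tame[OF W])
      fix x
      show "\<beta> * W x = g x + b x \<bullet> GW x + frobenius_prod (Do x) (HW x) - Df x * frac_laplacian \<alpha> W x"
        unfolding FW using eq[rule_format, of x] eq'[rule_format, of x]
        by (simp add: g_def W_def GW_def HW_def frobenius_prod_diff_left frobenius_prod_diff_right
              inner_diff_left inner_diff_right algebra_simps)
    qed
    have step: "c2_bound \<gamma> \<alpha> (Y / 2 + C1 * D * X * \<epsilon>) W GW HW" if Y: "0 < Y" and bW: "c2_bound \<gamma> \<alpha> Y W GW HW" for Y
    proof -
      have "c2_bound \<gamma> \<alpha> (X + Y) (\<lambda>x. V x - W x) (\<lambda>x. G x - GW x) (\<lambda>x. H x - HW x)"
        by (rule c2_bound_diff[OF alpha tame[OF V] tame[OF W] bV bW])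
      then have bV': "c2_bound \<gamma> \<alpha> (X + Y) V' G' H'" by (simp add: W_def GW_def HW_def)
      have "holder_bound \<gamma> ((?d * (2 * \<epsilon> * (X + Y)) + ?d * (?d * (2 * \<epsilon> * (X + Y)))) + 2 * \<epsilon> * (X + Y)) g"
        unfolding g_def using bV' unfolding c2_bound_def
        by (intro holder_bound_diff holder_bound_add holder_bound_first_order holder_bound_second_order holder_bound_mult db dDo dDf) auto
      also have "(?d * (2 * \<epsilon> * (X + Y)) + ?d * (?d * (2 * \<epsilon> * (X + Y)))) + 2 * \<epsilon> * (X + Y) = D * \<epsilon> * (X + Y)"
        by (simp add: D_def algebra_simps)
      finally have "holder_bound \<gamma> (D * \<epsilon> * (X + Y)) g" .
      moreover have "0 < D * \<epsilon> * (X + Y)" using D eps X Y by simp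
      ultimately have "c2_bound \<gamma> \<alpha> (C1 * (D * \<epsilon> * (X + Y))) W GW HW" using ap solW W by blast
      moreover have "C1 * (D * \<epsilon> * (X + Y)) \<le> Y / 2 + C1 * D * X * \<epsilon>"
      proof -
        have "C1 * D * \<epsilon> \<le> C1 * D * \<epsilon>0" using eps C1 D by (intro mult_left_mono) auto
        also have "\<dots> = 1/2" using C1 D by (simp add: \<epsilon>0_def)
        finally have "C1 * D * \<epsilon> * Y \<le> 1/2 * Y" using Y by (intro mult_right_mono) auto
        then show ?thesis by (simp add: algebra_simps)
      qed
      ultimately show ?thesis by (rule c2_bound_mono)
    qed
    obtain Y0 where Y0: "Y0 > 0" "c2_bound \<gamma> \<alpha> Y0 W GW HW" using regular_c2_bound[OF gamma alpha W] by blast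
    have "c2_bound \<gamma> \<alpha> (3 * (C1 * D * X * \<epsilon>)) W GW HW"
    proof (rule halving_iteration[of "\<lambda>Y. c2_bound \<gamma> \<alpha> Y W GW HW"])
      show "c2_bound \<gamma> \<alpha> l W GW HW" if "c2_bound \<gamma> \<alpha> k W GW HW" "k \<le> l" for k l
        by (rule c2_bound_mono[OF that])
    qed (use Y0 step C1 D X eps in auto)
    then show ?thesis by (simp add: C_def W_def GW_def HW_def mult.assoc)
  qed
  show ?thesis by (rule exI[of _ \<epsilon>0], intro conjI e0, rule exI[of _ C]) (use C main in blast)
qed

end

section \<open>Hoelder spaces and norms\<close>

lemma differentiable_partials:
  fixes f :: "real^'n::finite \<Rightarrow> real"
  assumes "f differentiable (at x)"
  shows "(f has_derivative (\<lambda>h. \<Sum>i\<in>UNIV. h $ i * partial_deriv i f x)) (at x)"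
proof -
  let ?D = "frechet_derivative f (at x)"
  have D: "(f has_derivative ?D) (at x)" using assms frechet_derivative_works by blast
  have lin: "linear ?D" using D by (rule has_derivative_linear)
  have "?D h = (\<Sum>i\<in>UNIV. h $ i * partial_deriv i f x)" for h
  proof -
    have "?D h = ?D (\<Sum>i\<in>UNIV. h $ i *\<^sub>R axis i 1)"
      by (simp add: basis_expansion flip: scalar_mult_eq_scaleR)
    also have "\<dots> = (\<Sum>i\<in>UNIV. h $ i * partial_deriv i f x)"
      by (simp add: linear_sum[OF lin] linear_scale[OF lin] partial_deriv_def)
    finally show ?thesis .
  qed
  then have "?D = (\<lambda>h. \<Sum>i\<in>UNIV. h $ i * partial_deriv i f x)" by blast
  then show ?thesis using D by simp
qed

lemma has_derivative_vec_componentwise: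
  fixes g :: "real^'n::finite \<Rightarrow> real^'n"
  assumes "\<And>j. ((\<lambda>x. g x $ j) has_derivative (\<lambda>h. g' h $ j)) (at x)"
  shows "(g has_derivative g') (at x)"
proof -
  have "((\<lambda>x. g x \<bullet> e) has_derivative (\<lambda>h. g' h \<bullet> e)) (at x)" if "e \<in> Basis" for e
  proof -
    obtain j where "e = axis j 1" using \<open>e \<in> Basis\<close> by (auto simp: Basis_vec_def)
    then show ?thesis using assms[of j] by (simp add: inner_axis)
  qed
  then show ?thesis using has_derivative_componentwise_within[of g g' x UNIV] by simp
qed

lemma holder_space_real: "f \<in> holder_space k \<gamma> \<longleftrightarrow> f \<in> scalar_holder_space k \<gamma>"
  for f :: "real^'n::finite \<Rightarrow> real"
  by (simp add: holder_space_def)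

lemma holder_norm_real: "holder_norm k \<gamma> f = scalar_holder_norm k \<gamma> f"
  for f :: "real^'n::finite \<Rightarrow> real"
  by (simp add: holder_norm_def)

lemma regular_of_holder_space:
  fixes V :: "real^'n::finite \<Rightarrow> real"
  assumes "V \<in> holder_space 2 \<gamma>"
  shows "regular \<gamma> V (gradient V) (hessian V)"
proof -
  have V: "\<And>is x. length is < 2 \<Longrightarrow> partial_derivs is V differentiable at x"
    "\<And>is. length is \<le> 2 \<Longrightarrow> bounded (range (partial_derivs is V))"
    "\<And>is. length is = 2 \<Longrightarrow> holder_continuous \<gamma> (partial_derivs is V)"
    using assms unfolding holder_space_real scalar_holder_space_def by auto
  have "has_hessian V (gradient V) (hessian V)"
    unfolding has_hessian_def
  proof (intro conjI allI)
    fix x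
    have "(V has_derivative (\<lambda>h. \<Sum>i\<in>UNIV. h $ i * partial_deriv i V x)) (at x)"
      using V(1)[of "[]"] by (intro differentiable_partials) simp
    then show "(V has_derivative (\<lambda>h. gradient V x \<bullet> h)) (at x)"
      by (simp add: gradient_def inner_vec_def mult.commute)
    show "(gradient V has_derivative (\<lambda>h. h v* hessian V x)) (at x)"
    proof (rule has_derivative_vec_componentwise)
      fix j
      have "(partial_derivs [j] V has_derivative (\<lambda>h. \<Sum>i\<in>UNIV. h $ i * partial_deriv i (partial_derivs [j] V) x)) (at x)"
        using V(1)[of "[j]"] by (intro differentiable_partials) simp
      then show "((\<lambda>x. gradient V x $ j) has_derivative (\<lambda>h. (h v* hessian V x) $ j)) (at x)"
        by (simp add: gradient_def[abs_def] hessian_def vector_matrix_mult_def mult.commute)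
    qed
  qed
  moreover have "\<exists>S. \<forall>x. \<bar>V x\<bar> \<le> S"
    using V(2)[of "[]"] by (auto simp: bounded_iff)
  moreover have "\<exists>K\<ge>0. \<forall>x y i j. \<bar>hessian V x $ i $ j - hessian V y $ i $ j\<bar> \<le> K * norm (x - y) powr \<gamma>"
  proof -
    have "\<forall>i j. \<exists>K. \<forall>x y. \<bar>hessian V x $ i $ j - hessian V y $ i $ j\<bar> \<le> K * norm (x - y) powr \<gamma>"
      using V(3)[of "[_, _]"] by (auto simp: holder_continuous_def hessian_def dist_norm)
    then obtain k where k: "\<And>i j x y. \<bar>hessian V x $ i $ j - hessian V y $ i $ j\<bar> \<le> k i j * norm (x - y) powr \<gamma>"
      by metis
    define K where "K = (\<Sum>i\<in>UNIV. \<Sum>j\<in>UNIV. \<bar>k i j\<bar>)"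
    have kK: "k i j \<le> K" for i j
    proof -
      have "k i j \<le> \<bar>k i j\<bar>" by simp
      also have "\<dots> \<le> (\<Sum>j\<in>UNIV. \<bar>k i j\<bar>)" by (rule member_le_sum) auto
      also have "\<dots> \<le> K" unfolding K_def by (rule member_le_sum[of i UNIV "\<lambda>i. \<Sum>j\<in>UNIV. \<bar>k i j\<bar>"]) (auto intro: sum_nonneg)
      finally show ?thesis .
    qed
    have "K \<ge> 0" unfolding K_def by (intro sum_nonneg) auto
    moreover have "\<bar>hessian V x $ i $ j - hessian V y $ i $ j\<bar> \<le> K * norm (x - y) powr \<gamma>" for x y i j
      by (rule order_trans[OF k mult_right_mono[OF kK]]) simp
    ultimately show ?thesis by blast
  qed
  ultimately show ?thesis unfolding regular_def by blast
qed

lemma scalar_holder_space_bound: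
  fixes f :: "real^'n::finite \<Rightarrow> real"
  assumes "f \<in> scalar_holder_space 0 \<gamma>"
  shows "\<exists>Y. holder_bound \<gamma> Y f"
proof -
  have "bounded (range f)" "holder_continuous \<gamma> f"
    using assms unfolding scalar_holder_space_def by auto
  then obtain S K where S: "\<And>x. \<bar>f x\<bar> \<le> S" and K: "\<And>x y. \<bar>f x - f y\<bar> \<le> K * norm (x - y) powr \<gamma>"
    unfolding bounded_iff holder_continuous_def dist_norm by auto
  have "\<bar>f x - f y\<bar> \<le> max S K * norm (x - y) powr \<gamma>" for x y
    by (rule order_trans[OF K mult_right_mono]) auto
  moreover have "\<bar>f x\<bar> \<le> max S K" for x using S[of x] by simp
  ultimately show ?thesis unfolding holder_bound_def by blast
qed

text \<open>A suprema-based norm bounds a function only if the suprema are taken over bounded sets, which the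
finite bound \<open>Y\<close> ensures. Both suprema are nonnegative, so each of them is at most \<open>\<epsilon>\<close>.\<close>

lemma scalar_holder_norm_0_bound:
  fixes f :: "real^'n::finite \<Rightarrow> real"
  assumes Y: "holder_bound \<gamma> Y f" and e: "scalar_holder_norm 0 \<gamma> f \<le> \<epsilon>"
  shows "holder_bound \<gamma> \<epsilon> f"
proof -
  let ?Q = "{\<bar>f x - f y\<bar> / dist x y powr \<gamma> |x y. x \<noteq> y}"
  have n: "scalar_holder_norm 0 \<gamma> f = (SUP x. \<bar>f x\<bar>) + Sup ?Q"
    by (simp add: scalar_holder_norm_def holder_seminorm_def)
  have Y': "\<bar>f x\<bar> \<le> Y" "\<bar>f x - f y\<bar> \<le> Y * norm (x - y) powr \<gamma>" for x y
    using Y unfolding holder_bound_def by auto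
  have b1: "bdd_above (range (\<lambda>x. \<bar>f x\<bar>))" using Y' by (auto intro!: bdd_aboveI[of _ Y])
  have b2: "bdd_above ?Q"
  proof (rule bdd_aboveI[of _ Y])
    fix q assume "q \<in> ?Q"
    then obtain x y where "x \<noteq> y" "q = \<bar>f x - f y\<bar> / dist x y powr \<gamma>" by blast
    then show "q \<le> Y" using Y'(2)[of x y] by (simp add: dist_norm divide_le_eq)
  qed
  have 1: "\<bar>f x\<bar> \<le> (SUP x. \<bar>f x\<bar>)" for x by (rule cSUP_upper[OF _ b1]) simp
  have 2: "\<bar>f x - f y\<bar> / dist x y powr \<gamma> \<le> Sup ?Q" if "x \<noteq> y" for x y
    by (rule cSup_upper[OF _ b2]) (use that in blast)
  have s1: "0 \<le> (SUP x. \<bar>f x\<bar>)" using 1[of 0] by linarith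
  have s2: "0 \<le> Sup ?Q"
  proof -
    have "(0::real^'n) \<noteq> axis undefined 1" by (simp add: axis_eq_0_iff)
    from order_trans[OF _ 2[OF this]] show ?thesis by simp
  qed
  have "\<bar>f x\<bar> \<le> \<epsilon>" for x using 1[of x] s2 e n by linarith
  moreover have "\<bar>f x - f y\<bar> \<le> \<epsilon> * norm (x - y) powr \<gamma>" for x y
  proof (cases "x = y")
    case False
    then have "\<bar>f x - f y\<bar> / dist x y powr \<gamma> \<le> \<epsilon>" using 2[OF False] s1 e n by linarith
    then show ?thesis using False by (simp add: dist_norm divide_le_eq)
  qed simp
  ultimately show ?thesis unfolding holder_bound_def by blast
qed

lemma triple_Basis:
  "((axis i 1 :: real^'n::finite), (0 :: real^'n^'n), (0 :: real)) \<in> Basis"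
  "((0 :: real^'n), (axis i (axis j 1) :: real^'n^'n), (0 :: real)) \<in> Basis"
  "((0 :: real^'n), (0 :: real^'n^'n), (1 :: real)) \<in> Basis"
  by (auto simp: Basis_prod_def Basis_vec_def image_iff zero_prod_def)

lemma triple_inner:
  fixes v :: "real^'n::finite" and A :: "real^'n^'n" and s :: real
  shows "(v, A, s) \<bullet> (axis i 1, 0, 0) = v $ i"
    "(v, A, s) \<bullet> (0, axis i (axis j 1), 0) = A $ i $ j"
    "(v, A, s) \<bullet> (0, 0, 1) = s"
  by (simp_all add: inner_axis)

lemma coefficient_bounds:
  fixes b :: "real^'n::finite \<Rightarrow> real^'n" and A :: "real^'n \<Rightarrow> real^'n^'n" and s :: "real^'n \<Rightarrow> real"
  assumes "(\<lambda>x. (b x, A x, s x)) \<in> holder_space 0 \<gamma>"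
  shows "\<exists>B. (\<forall>i. holder_bound \<gamma> B (\<lambda>x. b x $ i)) \<and> (\<forall>i j. holder_bound \<gamma> B (\<lambda>x. A x $ i $ j)) \<and> holder_bound \<gamma> B s"
proof -
  let ?\<Theta> = "\<lambda>x. (b x, A x, s x)"
  have ex: "\<exists>Y. holder_bound \<gamma> Y (\<lambda>x. ?\<Theta> x \<bullet> e)" if "e \<in> Basis" for e
    using assms that unfolding holder_space_def by (intro scalar_holder_space_bound) auto
  have "\<exists>Y. \<forall>e\<in>Basis. holder_bound \<gamma> (Y e) (\<lambda>x. ?\<Theta> x \<bullet> e)"
    by (rule bchoice) (simp add: ex)
  then obtain Y where Y: "\<And>e. e \<in> Basis \<Longrightarrow> holder_bound \<gamma> (Y e) (\<lambda>x. ?\<Theta> x \<bullet> e)" by auto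
  define B where "B = (\<Sum>e\<in>(Basis :: ((real^'n) \<times> (real^'n^'n) \<times> real) set). Y e)"
  have Y0: "0 \<le> Y e" if "e \<in> Basis" for e
    by (rule holder_bound_nonneg[OF Y[OF that]])
  have "holder_bound \<gamma> B (\<lambda>x. ?\<Theta> x \<bullet> e)" if "e \<in> Basis" for e
    by (rule holder_bound_mono[OF Y[OF that]], unfold B_def, rule member_le_sum[OF that])
       (use Y0 in \<open>blast intro: finite_Basis\<close>)+
  from this[OF triple_Basis(1)] this[OF triple_Basis(2)] this[OF triple_Basis(3)]
  show ?thesis unfolding triple_inner by blast
qed

lemma coefficient_distance:
  fixes b b' :: "real^'n::finite \<Rightarrow> real^'n" and A A' :: "real^'n \<Rightarrow> real^'n^'n" and s s' :: "real^'n \<Rightarrow> real"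
  assumes h: "(\<lambda>x. (b x, A x, s x)) \<in> holder_space 0 \<gamma>" "(\<lambda>x. (b' x, A' x, s' x)) \<in> holder_space 0 \<gamma>"
    and e: "holder_norm 0 \<gamma> (\<lambda>x. (b x, A x, s x) - (b' x, A' x, s' x)) \<le> \<epsilon>"
  shows "holder_bound \<gamma> \<epsilon> (\<lambda>x. (b x - b' x) $ i)" "holder_bound \<gamma> \<epsilon> (\<lambda>x. (A x - A' x) $ i $ j)"
    "holder_bound \<gamma> \<epsilon> (\<lambda>x. s x - s' x)"
proof -
  let ?\<Delta> = "\<lambda>x. (b x, A x, s x) - (b' x, A' x, s' x)"
  have k: "holder_bound \<gamma> \<epsilon> (\<lambda>x. ?\<Delta> x \<bullet> k)" if k: "k \<in> Basis" for k
  proof -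
    obtain Y Y' where "holder_bound \<gamma> Y (\<lambda>x. (b x, A x, s x) \<bullet> k)" "holder_bound \<gamma> Y' (\<lambda>x. (b' x, A' x, s' x) \<bullet> k)"
      using h k scalar_holder_space_bound unfolding holder_space_def by blast
    then have Y: "holder_bound \<gamma> (Y + Y') (\<lambda>x. ?\<Delta> x \<bullet> k)"
      unfolding inner_diff_left by (rule holder_bound_diff)
    have "scalar_holder_norm 0 \<gamma> (\<lambda>x. ?\<Delta> x \<bullet> k) \<le> holder_norm 0 \<gamma> ?\<Delta>"
      unfolding holder_norm_def using k by (intro Max_ge) auto
    then show ?thesis using scalar_holder_norm_0_bound[OF Y] e by simp
  qed
  show "holder_bound \<gamma> \<epsilon> (\<lambda>x. (b x - b' x) $ i)" "holder_bound \<gamma> \<epsilon> (\<lambda>x. (A x - A' x) $ i $ j)"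
    "holder_bound \<gamma> \<epsilon> (\<lambda>x. s x - s' x)"
    using k[OF triple_Basis(1), of i] k[OF triple_Basis(2), of i j] k[OF triple_Basis(3)]
    unfolding diff_Pair triple_inner by auto
qed

lemma partial_derivs_has_hessian:
  assumes "has_hessian u G H"
  shows "partial_derivs [j] u = (\<lambda>x. G x $ j)" and "partial_derivs [i, j] u = (\<lambda>x. H x $ i $ j)"
proof -
  have "frechet_derivative u (at x) = (\<lambda>h. G x \<bullet> h)" for x
    using assms unfolding has_hessian_def by (metis frechet_derivative_at)
  then show 1: "partial_derivs [j] u = (\<lambda>x. G x $ j)"
    by (simp add: fun_eq_iff partial_deriv_def inner_axis)
  have "((\<lambda>x. G x \<bullet> axis j 1) has_derivative (\<lambda>h. (h v* H x) \<bullet> axis j 1)) (at x)" for x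
    using assms unfolding has_hessian_def by (intro has_derivative_inner_left) auto
  then have "frechet_derivative (\<lambda>x. G x $ j) (at x) = (\<lambda>h. (h v* H x) \<bullet> axis j 1)" for x
    unfolding inner_axis_one by (metis frechet_derivative_at)
  moreover have "partial_deriv j u = (\<lambda>x. G x $ j)" using 1 by simp
  ultimately show "partial_derivs [i, j] u = (\<lambda>x. H x $ i $ j)"
    by (auto simp: partial_deriv_def[of i] bilinear_form_axis)
qed

lemma holder_norm_2_le:
  fixes u :: "real^'n::finite \<Rightarrow> real"
  assumes u: "has_hessian u G H" and b: "c2_bound \<gamma> \<alpha> Y u G H"
  shows "holder_norm 2 \<gamma> u \<le> 4 * Y"
proof -
  have hb: "holder_bound \<gamma> Y (partial_derivs is u)" if len: "length is \<le> 2" for "is" :: "'n list"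
  proof -
    consider "is = []" | j where "is = [j]" | i j where "is = [i, j]"
      using len by (auto simp: numeral_2_eq_2 le_Suc_eq length_Suc_conv)
    then show ?thesis
      using b partial_derivs_has_hessian[OF u] unfolding c2_bound_def by cases auto
  qed
  have Y0: "Y \<ge> 0" using hb[of "[]"] holder_bound_nonneg by auto
  have fin: "finite {is :: 'n list. length is = m}" for m
    using finite_lists_length_eq[of "UNIV :: 'n set" m] by simp
  have ne: "{is :: 'n list. length is = m} \<noteq> {}" for m
    using length_replicate[of m undefined] by blast
  have "(MAX is\<in>{is :: 'n list. length is = m}. SUP x. \<bar>partial_derivs is u x\<bar>) \<le> Y" if "m \<le> 2" for m
  proof (rule Max.boundedI)
    fix a assume "a \<in> (\<lambda>is. SUP x. \<bar>partial_derivs is u x\<bar>) ` {is :: 'n list. length is = m}"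
    then obtain "is" where i: "length is = m" "a = (SUP x. \<bar>partial_derivs is u x\<bar>)" by blast
    show "a \<le> Y" unfolding i(2) using hb[of "is"] i(1) that by (intro cSUP_least) (auto simp: holder_bound_def)
  qed (use fin ne in auto)
  then have "(\<Sum>m\<le>2. MAX is\<in>{is :: 'n list. length is = m}. SUP x. \<bar>partial_derivs is u x\<bar>) \<le> (\<Sum>m\<le>(2::nat). Y)"
    by (intro sum_mono) auto
  moreover have "(MAX is\<in>{is :: 'n list. length is = 2}. holder_seminorm \<gamma> (partial_derivs is u)) \<le> Y"
  proof (rule Max.boundedI)
    fix a assume "a \<in> (\<lambda>is. holder_seminorm \<gamma> (partial_derivs is u)) ` {is :: 'n list. length is = 2}"
    then obtain "is" where i: "length is = 2" "a = holder_seminorm \<gamma> (partial_derivs is u)" by blast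
    have n: "(0::real^'n) \<noteq> axis undefined 1" by (simp add: axis_eq_0_iff)
    show "a \<le> Y" unfolding i(2) holder_seminorm_def
    proof (rule cSup_least)
      show "{\<bar>partial_derivs is u x - partial_derivs is u y\<bar> / dist x y powr \<gamma> |x y. x \<noteq> y} \<noteq> {}" using n by blast
      fix q assume "q \<in> {\<bar>partial_derivs is u x - partial_derivs is u y\<bar> / dist x y powr \<gamma> |x y. x \<noteq> y}"
      then obtain x y where "x \<noteq> y" "q = \<bar>partial_derivs is u x - partial_derivs is u y\<bar> / dist x y powr \<gamma>" by blast
      then show "q \<le> Y" using hb[of "is"] i(1) by (simp add: holder_bound_def dist_norm divide_le_eq)
    qed
  qed (use fin ne in auto)
  ultimately show ?thesis unfolding holder_norm_real scalar_holder_norm_def by simp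
qed

theorem theorem3p1:
  "\<exists>\<gamma>0>0. \<gamma>0 \<le> 1 \<and>
    (\<forall>\<gamma> \<alpha> \<beta> lf (r :: real^'n::finite \<Rightarrow> real)
       (b :: real^'n \<Rightarrow> real^'n) (D\<^sub>o :: real^'n \<Rightarrow> real^'n^'n) (D\<^sub>f :: real^'n \<Rightarrow> real).
      0 < \<gamma> \<and> \<gamma> < \<gamma>0 \<and> 0 < \<alpha> \<and> \<alpha> < 1 \<and> 0 < \<beta> \<and>
      r \<in> holder_space 0 \<gamma> \<and> cell_periodic r \<and>
      (\<lambda>x. (b x, D\<^sub>o x, D\<^sub>f x)) \<in> holder_space 0 \<gamma> \<and> cell_periodic (\<lambda>x. (b x, D\<^sub>o x, D\<^sub>f x)) \<and>
      (\<forall>x. transpose (D\<^sub>o x) = D\<^sub>o x) \<and> uniformly_positive_definite D\<^sub>o \<and>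
      0 < lf \<and> (\<forall>x. lf \<le> D\<^sub>f x) \<longrightarrow>
      (\<exists>\<epsilon>0>0. \<exists>C>0. \<forall>\<epsilon> b' D\<^sub>o' D\<^sub>f' V V'.
        0 < \<epsilon> \<and> \<epsilon> \<le> \<epsilon>0 \<and>
        (\<lambda>x. (b' x, D\<^sub>o' x, D\<^sub>f' x)) \<in> holder_space 0 \<gamma> \<and>
        cell_periodic (\<lambda>x. (b' x, D\<^sub>o' x, D\<^sub>f' x)) \<and>
        holder_norm 0 \<gamma> (\<lambda>x. (b x, D\<^sub>o x, D\<^sub>f x) - (b' x, D\<^sub>o' x, D\<^sub>f' x)) \<le> \<epsilon> \<and>
        V \<in> holder_space 2 \<gamma> \<and> policy_evaluation_solution \<alpha> \<beta> r b D\<^sub>o D\<^sub>f V \<and>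
        V' \<in> holder_space 2 \<gamma> \<and> policy_evaluation_solution \<alpha> \<beta> r b' D\<^sub>o' D\<^sub>f' V' \<longrightarrow>
        holder_norm 2 \<gamma> (\<lambda>x. V x - V' x) < C * \<epsilon>))"
proof (rule exI[of _ "1::real"], intro conjI allI impI; (elim conjE)?)
  fix \<gamma> \<alpha> \<beta> lf :: real and r :: "real^'n \<Rightarrow> real" and b :: "real^'n \<Rightarrow> real^'n"
    and D\<^sub>o :: "real^'n \<Rightarrow> real^'n^'n" and D\<^sub>f :: "real^'n \<Rightarrow> real"
  assume g: "0 < \<gamma>" "\<gamma> < 1" and al: "0 < \<alpha>" "\<alpha> < 1" and be: "0 < \<beta>" and r: "r \<in> holder_space 0 \<gamma>"
    and th: "(\<lambda>x. (b x, D\<^sub>o x, D\<^sub>f x)) \<in> holder_space 0 \<gamma>"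
    and sym: "\<forall>x. transpose (D\<^sub>o x) = D\<^sub>o x" and upd: "uniformly_positive_definite D\<^sub>o"
    and lf: "0 < lf" "\<forall>x. lf \<le> D\<^sub>f x"
  obtain c where c: "c > 0" "\<And>x \<xi>. c * (norm \<xi>)\<^sup>2 \<le> \<xi> \<bullet> (D\<^sub>o x *v \<xi>)"
    using upd unfolding uniformly_positive_definite_def by blast
  obtain B where B: "\<forall>i. holder_bound \<gamma> B (\<lambda>x. b x $ i)" "\<forall>i j. holder_bound \<gamma> B (\<lambda>x. D\<^sub>o x $ i $ j)" "holder_bound \<gamma> B D\<^sub>f"
    using coefficient_bounds[OF th] by blast
  interpret elliptic_coefficients \<gamma> \<alpha> \<beta> c B b D\<^sub>o D\<^sub>f
    by unfold_locales (use g al be c B sym lf in \<open>auto intro: order_trans[OF less_imp_le]\<close>)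
  have "\<exists>E. holder_bound \<gamma> E r"
    using r unfolding holder_space_real by (rule scalar_holder_space_bound)
  from stability[OF this] obtain \<epsilon>0 C where e0: "\<epsilon>0 > 0" and C: "C > 0" and
    st: "\<forall>\<epsilon> b' Do' Df' V G H V' G' H'. 0 < \<epsilon> \<longrightarrow> \<epsilon> \<le> \<epsilon>0 \<longrightarrow>
     (\<forall>i. holder_bound \<gamma> \<epsilon> (\<lambda>x. (b x - b' x) $ i)) \<longrightarrow>
     (\<forall>i j. holder_bound \<gamma> \<epsilon> (\<lambda>x. (D\<^sub>o x - Do' x) $ i $ j)) \<longrightarrow>
     holder_bound \<gamma> \<epsilon> (\<lambda>x. D\<^sub>f x - Df' x) \<longrightarrow> regular \<gamma> V G H \<longrightarrow> regular \<gamma> V' G' H' \<longrightarrow>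
     policy_equation \<alpha> \<beta> r b D\<^sub>o D\<^sub>f V G H \<longrightarrow>
     policy_equation \<alpha> \<beta> r b' Do' Df' V' G' H' \<longrightarrow>
     c2_bound \<gamma> \<alpha> (C * \<epsilon>) (\<lambda>x. V x - V' x) (\<lambda>x. G x - G' x) (\<lambda>x. H x - H' x)"
    by (elim exE conjE)
  show "\<exists>\<epsilon>0>0. \<exists>C>0. \<forall>\<epsilon> b' D\<^sub>o' D\<^sub>f' V V'.
        0 < \<epsilon> \<and> \<epsilon> \<le> \<epsilon>0 \<and>
        (\<lambda>x. (b' x, D\<^sub>o' x, D\<^sub>f' x)) \<in> holder_space 0 \<gamma> \<and>
        cell_periodic (\<lambda>x. (b' x, D\<^sub>o' x, D\<^sub>f' x)) \<and>
        holder_norm 0 \<gamma> (\<lambda>x. (b x, D\<^sub>o x, D\<^sub>f x) - (b' x, D\<^sub>o' x, D\<^sub>f' x)) \<le> \<epsilon> \<and>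
        V \<in> holder_space 2 \<gamma> \<and> policy_evaluation_solution \<alpha> \<beta> r b D\<^sub>o D\<^sub>f V \<and>
        V' \<in> holder_space 2 \<gamma> \<and> policy_evaluation_solution \<alpha> \<beta> r b' D\<^sub>o' D\<^sub>f' V' \<longrightarrow>
        holder_norm 2 \<gamma> (\<lambda>x. V x - V' x) < C * \<epsilon>"
  proof (rule exI[of _ \<epsilon>0], intro conjI e0, rule exI[of _ "4 * C + 1"], intro conjI allI impI; (elim conjE)?)
    show "0 < 4 * C + 1" using C by simp
    fix \<epsilon> b' D\<^sub>o' D\<^sub>f' V V'
    assume eps: "0 < \<epsilon>" "\<epsilon> \<le> \<epsilon>0" and th': "(\<lambda>x. (b' x, D\<^sub>o' x, D\<^sub>f' x)) \<in> holder_space 0 \<gamma>"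
      and d: "holder_norm 0 \<gamma> (\<lambda>x. (b x, D\<^sub>o x, D\<^sub>f x) - (b' x, D\<^sub>o' x, D\<^sub>f' x)) \<le> \<epsilon>"
      and V: "V \<in> holder_space 2 \<gamma>" and solV: "policy_evaluation_solution \<alpha> \<beta> r b D\<^sub>o D\<^sub>f V"
      and V': "V' \<in> holder_space 2 \<gamma>" and solV': "policy_evaluation_solution \<alpha> \<beta> r b' D\<^sub>o' D\<^sub>f' V'"
    note rV = regular_of_holder_space[OF V] and rV' = regular_of_holder_space[OF V']
    have "c2_bound \<gamma> \<alpha> (C * \<epsilon>) (\<lambda>x. V x - V' x) (\<lambda>x. gradient V x - gradient V' x) (\<lambda>x. hessian V x - hessian V' x)"
      by (rule st[rule_format, OF eps coefficient_distance[OF th th' d] rV rV'])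
        (use solV solV' in \<open>simp_all add: policy_evaluation_solution_def\<close>)
    moreover have "has_hessian (\<lambda>x. V x - V' x) (\<lambda>x. gradient V x - gradient V' x) (\<lambda>x. hessian V x - hessian V' x)"
      using regular_diff[OF rV rV'] unfolding regular_def by blast
    ultimately have "holder_norm 2 \<gamma> (\<lambda>x. V x - V' x) \<le> 4 * (C * \<epsilon>)" by (intro holder_norm_2_le)
    then show "holder_norm 2 \<gamma> (\<lambda>x. V x - V' x) < (4 * C + 1) * \<epsilon>" using eps by (simp add: distrib_right)
  qed
qed simp_all

end
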